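(* Let $D,G$ be bounded domains in $\mathbb C^n$. Suppose that $G$ is $(m_1,\ldots,m_n)$-circular and contains the origin. Assume moreover that $D$ satisfies the following property: for any open, relatively compact subset $K$ of $D$ there is an open set $U$ containing $\overline D$ such that the function $(z,w)\mapsto k_D(z,\overline w)$ extends holomorphically to $U\times\tilde K$. Then any proper holomorphic mapping $f:D\to G$ extends holomorphically to a neighborhood of $\overline D$.
   Context: Let $m_1,\ldots,m_n$ be relatively prime positive natural numbers. A domain $G\subset\mathbb C^n$ is $(m_1,\ldots,m_n)$-circular if $(\lambda^{m_1}x_1,\ldots,\lambda^{m_n}x_n)\in G$ for all $x=(x_1,\ldots,x_n)\in G$ and all $\lambda\in\mathbb C$ with $|\lambda|=1$. $k_D$ denotes the Bergman kernel of $D$ (holomorphic in the first, antiholomorphic in the second variable). For $K\subset\mathbb C^n$, $\tilde K:=\{\overline x: x\in K\}$. *)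

theory Defs
  imports "HOL-Analysis.Analysis"
begin

section \<open>Holomorphic maps of several variables\<close>

text \<open>
  Frechet differentiable with complex-linear derivative. There is no type class of complex vector
  spaces here, so the two complex scalar multiplications are parameters.
\<close>

definition holomorphic_wrt ::
  "(complex \<Rightarrow> 'a \<Rightarrow> 'a) \<Rightarrow> (complex \<Rightarrow> 'b \<Rightarrow> 'b) \<Rightarrow>
   ('a::real_normed_vector \<Rightarrow> 'b::real_normed_vector) \<Rightarrow> 'a set \<Rightarrow> bool"
  where "holomorphic_wrt s1 s2 f S \<longleftrightarrow>
    (\<forall>z\<in>S. \<exists>L. (f has_derivative L) (at z within S) \<and> Vector_Spaces.linear s1 s2 L)"

abbreviation holomorphic_fun_on :: "(complex^'n \<Rightarrow> complex) \<Rightarrow> (complex^'n) set \<Rightarrow> bool"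
  where "holomorphic_fun_on \<equiv> holomorphic_wrt (*s) (*)"

abbreviation holomorphic_map_on :: "(complex^'n \<Rightarrow> complex^'m) \<Rightarrow> (complex^'n) set \<Rightarrow> bool"
  where "holomorphic_map_on \<equiv> holomorphic_wrt (*s) (*s)"

definition pair_scale :: "complex \<Rightarrow> (complex^'n) \<times> (complex^'m) \<Rightarrow> (complex^'n) \<times> (complex^'m)"
  where "pair_scale c p = (c *s fst p, c *s snd p)"

abbreviation holomorphic_fun2_on ::
  "((complex^'n) \<times> (complex^'m) \<Rightarrow> complex) \<Rightarrow> ((complex^'n) \<times> (complex^'m)) set \<Rightarrow> bool"
  where "holomorphic_fun2_on \<equiv> holomorphic_wrt pair_scale (*)"

text \<open>
  The predicate \<open>Vector_Spaces.linear\<close> includes the vector space axioms for both scalar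
  multiplications, so these need to hold for the definitions above to be meaningful.
\<close>

lemma vector_space_complex_mult: "vector_space ((*) :: complex \<Rightarrow> complex \<Rightarrow> complex)"
  by unfold_locales (auto simp: algebra_simps)

lemma vector_space_pair_scale: "vector_space pair_scale"
  by unfold_locales
    (auto simp: pair_scale_def vec.scale_right_distrib vec.scale_left_distrib)


section \<open>The Bergman kernel\<close>

text \<open>
  Functions in the Bergman space are normalised to vanish outside \<open>D\<close>, so that each one is
  determined, as a total function, by its values on \<open>D\<close>.
\<close>

definition bergman_space :: "(complex^'n) set \<Rightarrow> (complex^'n \<Rightarrow> complex) set"
  where "bergman_space D =
    {f. holomorphic_fun_on f D \<and> (\<forall>z. z \<notin> D \<longrightarrow> f z = 0) \<and>
        set_integrable lborel D (\<lambda>z. (norm (f z))\<^sup>2)}"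

text \<open>
  \<open>bergman_kernel D z w\<close> is the value at \<open>z\<close> of the unique \<open>g\<close> in the Bergman space
  representing evaluation at \<open>w \<in> D\<close>.
\<close>

definition bergman_kernel :: "(complex^'n) set \<Rightarrow> complex^'n \<Rightarrow> complex^'n \<Rightarrow> complex"
  where "bergman_kernel D z w =
    (THE g. g \<in> bergman_space D \<and>
      (\<forall>f\<in>bergman_space D. f w = (LINT \<zeta>:D|lborel. f \<zeta> * cnj (g \<zeta>)))) z"


section \<open>Domains, circularity, properness\<close>

definition bounded_domain :: "(complex^'n) set \<Rightarrow> bool"
  where "bounded_domain D \<longleftrightarrow> open D \<and> connected D \<and> D \<noteq> {} \<and> bounded D"

definition quasi_circular :: "('n \<Rightarrow> nat) \<Rightarrow> (complex^'n) set \<Rightarrow> bool"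
  where "quasi_circular m G \<longleftrightarrow>
    (\<forall>x\<in>G. \<forall>c. norm c = 1 \<longrightarrow> (\<chi> j. c ^ m j * x $ j) \<in> G)"

definition cnj_vec :: "complex^'n \<Rightarrow> complex^'n"
  where "cnj_vec x = (\<chi> j. cnj (x $ j))"

definition proper_holomorphic ::
  "(complex^'n) set \<Rightarrow> (complex^'m) set \<Rightarrow> (complex^'n \<Rightarrow> complex^'m) \<Rightarrow> bool"
  where "proper_holomorphic D G f \<longleftrightarrow>
    holomorphic_map_on f D \<and> f ` D \<subseteq> G \<and> proper_map (top_of_set D) (top_of_set G) f"

text \<open>The library's notion of properness is the usual one: preimages of compact sets are compact.\<close>

lemma proper_holomorphic_iff_compact_preimages:
  "proper_holomorphic D G f \<longleftrightarrow>
    holomorphic_map_on f D \<and> f ` D \<subseteq> G \<and> (\<forall>K. compact K \<and> K \<subseteq> G \<longrightarrow> compact {z \<in> D. f z \<in> K})"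
proof -
  have "proper_map (top_of_set D) (top_of_set G) f \<longleftrightarrow>
      (\<forall>K. compact K \<and> K \<subseteq> G \<longrightarrow> compact {z \<in> D. f z \<in> K})" (is "?L \<longleftrightarrow> ?R")
    if fim: "f ` D \<subseteq> G"
  proof
    assume ?L
    then show ?R
      using compactin_proper_map_preimage[of "top_of_set D" "top_of_set G" f]
      by (auto simp: compactin_subtopology)
  next
    assume R: ?R
    have "metrizable_space (top_of_set D)" "metrizable_space (top_of_set G)"
      by (simp_all add: metrizable_space_euclidean metrizable_space_subtopology)
    then have "k_space (top_of_set G)" "kc_space (top_of_set G)" "kc_space (top_of_set D)"
      by (simp_all add: metrizable_imp_k_space metrizable_imp_Hausdorff_space Hausdorff_imp_kc_space)
    then show ?L
      using R fim by (intro compact_imp_proper_map) (auto simp: compactin_subtopology)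
  qed
  then show ?thesis
    by (auto simp: proper_holomorphic_def)
qed

end

theory Submission
  imports Defs "HOL-Complex_Analysis.Complex_Analysis"
begin

text \<open>
  The proof follows Bell. Let \<open>J = det f'\<close>. For holomorphic \<open>b\<close> on \<open>D\<close>, the push-forward along \<open>f\<close> of the
  measure with density \<open>cnj J * b\<close> has a holomorphic density on \<open>G\<close>: the adjugate of \<open>f'\<close> turns the
  antiholomorphic derivatives of a test function on \<open>G\<close> into derivatives of its pullback along
  divergence-free fields on \<open>D\<close>, so they integrate to zero. This replaces the usual argument with
  the local inverses of \<open>f\<close>. For \<open>b = J\<close> the density is real, hence constant, and therefore \<open>J\<close> is
  square integrable.

  Let \<open>q w = (w $ j) ^ k\<close>, which is homogeneous for the circle action on \<open>G\<close>. The pairing of a holomorphic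
  function with \<open>q\<close> over \<open>G\<close> depends only on its part of the same weight, which is determined near the
  origin, so \<open>q\<close> may be replaced by a function supported in a small ball. With the Bergman kernel
  in place of \<open>b\<close> this expresses \<open>J * q \<circ> f\<close> as an integral of the kernel over a fixed compact subset of \<open>D\<close>;
  hence all \<open>J * (f $ j) ^ k\<close> extend to one neighbourhood of the closure of \<open>D\<close>, with values at each
  point bounded geometrically in \<open>k\<close>. Taking \<open>k\<close>-th roots, the extension of \<open>J * f $ j\<close> is bounded by a
  multiple of that of \<open>J\<close>, so the quotient extends holomorphically by Riemann's theorem.
\<close>

section \<open>Holomorphic functions of several variables\<close>

text \<open>The kernel hypothesis lets \<open>z\<close> leave \<open>D\<close> only while
  \<open>w\<close> stays in a relatively compact subset, whereas the reproducing formula for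
  \<open>J * q \<circ> f\<close> integrates over all of \<open>D\<close>. Cutting this integral down
  to a compact set is the purpose of the circle action: the dilation \<open>wact m s\<close> carries
  the bounded \<open>G\<close> into a small ball around the origin and acts on the part of weight
  \<open>d\<close> as multiplication by \<open>s ^ d\<close>. One factor \<open>s\<close> serves all
  degrees, so dividing by \<open>s ^ (m j * k)\<close> costs only a factor geometric in
  \<open>k\<close>, and constants in front of it disappear under \<open>k\<close>-th roots. All
  powers are used because the extension of \<open>J\<close> may have zeros: dividing the extension
  of \<open>J * f $ j\<close> by it requires a bound, which comes from
  \<open>(J * f $ j) ^ k = J ^ (k - 1) * (J * (f $ j) ^ k)\<close>, continued from \<open>D\<close>.
  Square integrability of \<open>J\<close> has to come first, since it is what puts
  \<open>J * q \<circ> f\<close> into the Bergman space. About the fibres of \<open>f\<close> the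
  push-forward uses nothing but the compactness of preimages of compact sets.\<close>

definition complex_linear :: "(complex^'n::finite \<Rightarrow> complex) \<Rightarrow> bool" where
  "complex_linear L \<longleftrightarrow> (\<forall>x y. L (x + y) = L x + L y) \<and> (\<forall>c x. L (c *s x) = c * L x)"

text \<open>The vector space axioms contained in \<open>Vector_Spaces.linear\<close> hold for both
  scalar multiplications, so only additivity and homogeneity have to be carried through the
  calculations.\<close>

lemma linear_scale_iff_complex_linear: "Vector_Spaces.linear (*s) (*) L \<longleftrightarrow> complex_linear L"
proof -
  have vs: "vector_space ((*s) :: complex \<Rightarrow> complex^'n \<Rightarrow> complex^'n)" by (rule vec.vector_space_axioms)
  show ?thesis
    unfolding Vector_Spaces.linear_iff complex_linear_def
    using vs vector_space_complex_mult by auto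
qed

lemma scaleR_eq_vector_scale: "(r::real) *\<^sub>R (x::complex^'n) = complex_of_real r *s x"
  unfolding vec_eq_iff vector_scaleR_component vector_smult_component by (simp add: scaleR_conv_of_real)

lemma has_derivative_vec_complex:
  assumes "\<And>j. (f j has_derivative f' j) F"
  shows "((\<lambda>x. (\<chi> j. f j x) :: complex^'n::finite) has_derivative (\<lambda>v. \<chi> j. f' j v)) F"
proof -
  have e: "(\<chi> j. g j) = (\<Sum>j\<in>UNIV. axis j (g j))" for g :: "'n \<Rightarrow> complex"
    by (simp add: vec_eq_iff axis_def)
  have bl: "bounded_linear (axis j :: complex \<Rightarrow> complex^'n)" for j
    unfolding linear_conv_bounded_linear[symmetric]
    by (rule linearI) (auto simp: vec_eq_iff axis_def)
  show ?thesis
    unfolding e by (intro has_derivative_sum bounded_linear.has_derivative[OF bl] assms)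
qed

lemma norm_vector_scale [simp]: "norm ((c::complex) *s (x::complex^'n)) = norm c * norm x"
  by (simp add: norm_vec_def norm_mult L2_set_right_distrib)

lemma complex_linear_expand:
  assumes "complex_linear L"
  shows "L v = (\<Sum>i\<in>UNIV. v $ i * L (axis i 1))"
proof -
  have s: "L (\<Sum>i\<in>A. g i) = (\<Sum>i\<in>A. L (g i))" if "finite A" for A and g :: "'a \<Rightarrow> complex^'a"
    using that
  proof (induction A rule: finite_induct)
    case empty
    have "L (0 *s 0) = 0 * L 0" using assms unfolding complex_linear_def by blast
    then show ?case by simp
  next
    case (insert x F)
    then show ?case using assms by (simp add: complex_linear_def)
  qed
  have "v = (\<Sum>i\<in>UNIV. v $ i *s axis i 1)" by (rule basis_expansion[symmetric])
  then have "L v = L (\<Sum>i\<in>UNIV. v $ i *s axis i 1)" by simp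
  also have "\<dots> = (\<Sum>i\<in>UNIV. v $ i * L (axis i 1))"
    unfolding s[OF finite] using assms unfolding complex_linear_def by (intro sum.cong) auto
  finally show ?thesis .
qed

lemma complex_linear_sum_form: "complex_linear (\<lambda>v. \<Sum>i\<in>UNIV. v $ i * g i)"
  by (auto simp: complex_linear_def sum.distrib algebra_simps sum_distrib_left)

lemma has_derivative_complex_linear_eq:
  assumes "(f has_derivative L) (at z)" "complex_linear L"
  shows "(f has_derivative (\<lambda>v. \<Sum>i\<in>UNIV. v $ i * L (axis i 1))) (at z)"
proof -
  have "(\<lambda>v. \<Sum>i\<in>UNIV. v $ i * L (axis i 1)) = L"
    by (rule ext) (rule complex_linear_expand[OF assms(2), symmetric])
  then show ?thesis using assms(1) by (simp only:)
qed

lemma hol_iff_complex_linear: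
  assumes "open S"
  shows "holomorphic_fun_on f S \<longleftrightarrow> (\<forall>z\<in>S. \<exists>L. (f has_derivative L) (at z) \<and> complex_linear L)"
  unfolding holomorphic_wrt_def linear_scale_iff_complex_linear
  using assms by (simp add: at_within_open[of _ S])

section \<open>Closure properties of holomorphic functions\<close>

lemma hol_subset: "holomorphic_wrt s1 s2 f S \<Longrightarrow> T \<subseteq> S \<Longrightarrow> holomorphic_wrt s1 s2 f T"
  unfolding holomorphic_wrt_def using has_derivative_subset by blast

lemma hol_continuous: "holomorphic_wrt s1 s2 f S \<Longrightarrow> continuous_on S f"
  unfolding holomorphic_wrt_def continuous_on_eq_continuous_within
  using has_derivative_continuous by blast

lemma hol_transform:
  assumes "open S" "holomorphic_fun_on f S" "\<And>z. z \<in> S \<Longrightarrow> f z = g z"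
  shows "holomorphic_fun_on g S"
  unfolding hol_iff_complex_linear[OF assms(1)]
proof
  fix z assume z: "z \<in> S"
  then obtain L where "(f has_derivative L) (at z)" "complex_linear L"
    using assms hol_iff_complex_linear by blast
  then show "\<exists>L. (g has_derivative L) (at z) \<and> complex_linear L"
    using has_derivative_transform_within_open[OF _ assms(1) z] assms(3) by blast
qed

lemma hol_locally:
  assumes "open S" "\<And>z. z \<in> S \<Longrightarrow> \<exists>T. open T \<and> z \<in> T \<and> holomorphic_fun_on f T"
  shows "holomorphic_fun_on f S"
  unfolding hol_iff_complex_linear[OF assms(1)] using assms(2) hol_iff_complex_linear by blast

lemma hol_const: "open S \<Longrightarrow> holomorphic_fun_on (\<lambda>z. c) S"
  unfolding hol_iff_complex_linear by (auto intro!: exI[of _ "\<lambda>_. 0"] simp: complex_linear_def)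

lemma hol_component: "open S \<Longrightarrow> holomorphic_fun_on (\<lambda>z. z $ i) S"
  unfolding hol_iff_complex_linear
  by (auto intro!: exI[of _ "\<lambda>v. v $ i"] bounded_linear_imp_has_derivative bounded_linear_vec_nth simp: complex_linear_def)

lemma hol_add:
  assumes "open S" "holomorphic_fun_on f S" "holomorphic_fun_on g S"
  shows "holomorphic_fun_on (\<lambda>z. f z + g z) S"
  unfolding hol_iff_complex_linear[OF assms(1)]
proof
  fix z assume "z \<in> S"
  then obtain L M where "(f has_derivative L) (at z)" "complex_linear L" "(g has_derivative M) (at z)" "complex_linear M"
    using assms hol_iff_complex_linear by meson
  then show "\<exists>L. ((\<lambda>z. f z + g z) has_derivative L) (at z) \<and> complex_linear L"
    by (intro exI[of _ "\<lambda>v. L v + M v"]) (auto simp: complex_linear_def algebra_simps intro!: derivative_eq_intros)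
qed

lemma hol_mult:
  assumes "open S" "holomorphic_fun_on f S" "holomorphic_fun_on g S"
  shows "holomorphic_fun_on (\<lambda>z. f z * g z) S"
  unfolding hol_iff_complex_linear[OF assms(1)]
proof
  fix z assume "z \<in> S"
  then obtain L M where "(f has_derivative L) (at z)" "complex_linear L" "(g has_derivative M) (at z)" "complex_linear M"
    using assms hol_iff_complex_linear by meson
  then show "\<exists>L. ((\<lambda>z. f z * g z) has_derivative L) (at z) \<and> complex_linear L"
    by (intro exI[of _ "\<lambda>v. f z * M v + L v * g z"]) (auto simp: complex_linear_def algebra_simps intro!: derivative_eq_intros)
qed

lemma hol_cmult: "open S \<Longrightarrow> holomorphic_fun_on f S \<Longrightarrow> holomorphic_fun_on (\<lambda>z. c * f z) S"
  by (intro hol_mult hol_const)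

lemma hol_diff:
  assumes "open S" "holomorphic_fun_on f S" "holomorphic_fun_on g S"
  shows "holomorphic_fun_on (\<lambda>z. f z - g z) S"
  using hol_add[OF assms(1,2) hol_cmult[OF assms(1,3), of "-1"]] by simp

lemma hol_sum:
  assumes "open S" "\<And>i. i \<in> A \<Longrightarrow> holomorphic_fun_on (f i) S"
  shows "holomorphic_fun_on (\<lambda>z. \<Sum>i\<in>A. f i z) S"
  using assms(2)
  by (induction A rule: infinite_finite_induct) (auto intro!: hol_const hol_add assms(1))

lemma hol_prod:
  assumes "open S" "\<And>i. i \<in> A \<Longrightarrow> holomorphic_fun_on (f i) S"
  shows "holomorphic_fun_on (\<lambda>z. \<Prod>i\<in>A. f i z) S"
  using assms(2)
  by (induction A rule: infinite_finite_induct) (auto intro!: hol_const hol_mult assms(1))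

lemma hol_power:
  assumes "open S" "holomorphic_fun_on f S"
  shows "holomorphic_fun_on (\<lambda>z. f z ^ k) S"
  by (induction k) (auto intro!: hol_const hol_mult assms)

lemma hol_inverse:
  assumes "open S" "holomorphic_fun_on f S" "\<And>z. z \<in> S \<Longrightarrow> f z \<noteq> 0"
  shows "holomorphic_fun_on (\<lambda>z. inverse (f z)) S"
  unfolding hol_iff_complex_linear[OF assms(1)]
proof
  fix z assume z: "z \<in> S"
  then obtain L where L: "(f has_derivative L) (at z)" "complex_linear L"
    using assms hol_iff_complex_linear by meson
  then show "\<exists>L. ((\<lambda>z. inverse (f z)) has_derivative L) (at z) \<and> complex_linear L"
    using Deriv.has_derivative_inverse[OF assms(3)[OF z] L(1)]
    by (intro exI[of _ "\<lambda>v. - (inverse (f z) * L v * inverse (f z))"] conjI)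
       (auto simp: complex_linear_def algebra_simps)
qed

lemma hol_divide:
  assumes "open S" "holomorphic_fun_on f S" "holomorphic_fun_on g S" "\<And>z. z \<in> S \<Longrightarrow> g z \<noteq> 0"
  shows "holomorphic_fun_on (\<lambda>z. f z / g z) S"
  using hol_mult[OF assms(1,2) hol_inverse[OF assms(1,3,4)]] by (simp add: divide_inverse)

lemma hol_map_components:
  assumes "open S"
  shows "holomorphic_map_on f S \<longleftrightarrow> (\<forall>j. holomorphic_fun_on (\<lambda>z. f z $ j) S)"
proof
  assume f: "holomorphic_map_on f S"
  show "\<forall>j. holomorphic_fun_on (\<lambda>z. f z $ j) S"
    unfolding hol_iff_complex_linear[OF assms]
  proof (intro allI ballI)
    fix j z assume "z \<in> S"
    then obtain L where L: "(f has_derivative L) (at z)" "Vector_Spaces.linear (*s) (*s) L"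
      using f assms unfolding holomorphic_wrt_def by (auto simp: at_within_open[of _ S])
    have "((\<lambda>z. f z $ j) has_derivative (\<lambda>v. L v $ j)) (at z)"
      using bounded_linear.has_derivative[OF bounded_linear_vec_nth L(1)] .
    moreover have "complex_linear (\<lambda>v. L v $ j)"
      using L(2) unfolding complex_linear_def Vector_Spaces.linear_iff by auto
    ultimately show "\<exists>L. ((\<lambda>z. f z $ j) has_derivative L) (at z) \<and> complex_linear L" by blast
  qed
next
  assume f: "\<forall>j. holomorphic_fun_on (\<lambda>z. f z $ j) S"
  show "holomorphic_map_on f S"
    unfolding holomorphic_wrt_def
  proof
    fix z assume z: "z \<in> S"
    have "\<forall>j. \<exists>L. ((\<lambda>z. f z $ j) has_derivative L) (at z) \<and> complex_linear L"
      using f z hol_iff_complex_linear[OF assms] by blast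
    then obtain L where L: "\<And>j. ((\<lambda>z. f z $ j) has_derivative L j) (at z)" "\<And>j. complex_linear (L j)" by metis
    have "((\<lambda>z. \<chi> j. f z $ j) has_derivative (\<lambda>v. \<chi> j. L j v)) (at z)"
      using L(1) by (intro has_derivative_vec_complex)
    moreover have "Vector_Spaces.linear (*s) (*s) (\<lambda>v. \<chi> j. L j v)"
      using L(2) unfolding complex_linear_def Vector_Spaces.linear_iff
      by (auto simp: vec_eq_iff intro: vec.vector_space_axioms)
    ultimately show "\<exists>L. (f has_derivative L) (at z within S) \<and> Vector_Spaces.linear (*s) (*s) L"
      using assms z by (auto simp: at_within_open[of _ S])
  qed
qed

section \<open>Composition and restriction to complex lines\<close>

lemma hol_compose:
  fixes g :: "complex^'m::finite \<Rightarrow> complex^'n::finite"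
  assumes "open S" "open T" "holomorphic_fun_on h S" "\<And>j. holomorphic_fun_on (\<lambda>z. g z $ j) T" "g ` T \<subseteq> S"
  shows "holomorphic_fun_on (\<lambda>z. h (g z)) T"
  unfolding hol_iff_complex_linear[OF assms(2)]
proof
  fix z assume z: "z \<in> T"
  have "holomorphic_map_on g T" using hol_map_components[OF assms(2)] assms(4) by blast
  then obtain L where L: "(g has_derivative L) (at z)" "Vector_Spaces.linear (*s) (*s) L"
    using z assms unfolding holomorphic_wrt_def by (auto simp: at_within_open[of _ T])
  have "g z \<in> S" using z assms by blast
  then obtain M where M: "(h has_derivative M) (at (g z))" "complex_linear M"
    using assms hol_iff_complex_linear by meson
  have "((\<lambda>z. h (g z)) has_derivative (\<lambda>v. M (L v))) (at z)"
    using has_derivative_compose[OF L(1) M(1)] .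
  moreover have "complex_linear (\<lambda>v. M (L v))"
    using M(2) L(2) unfolding complex_linear_def Vector_Spaces.linear_iff by auto
  ultimately show "\<exists>L. ((\<lambda>z. h (g z)) has_derivative L) (at z) \<and> complex_linear L" by blast
qed

text \<open>The bridge to one variable: along a holomorphic curve a function of several variables
  becomes \<open>holomorphic_on\<close>, so that Cauchy's formula, the identity theorem and
  removable singularities are available.\<close>

lemma hol_compose_curve:
  fixes g :: "complex \<Rightarrow> complex^'n::finite"
  assumes "open S" "open T" "holomorphic_fun_on h S" "\<And>j. (\<lambda>t. g t $ j) holomorphic_on T" "g ` T \<subseteq> S"
  shows "(\<lambda>t. h (g t)) holomorphic_on T"
  unfolding holomorphic_on_open[OF assms(2)]
proof
  fix t assume t: "t \<in> T"
  have "\<forall>j. \<exists>d. ((\<lambda>t. g t $ j) has_field_derivative d) (at t)"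
    using assms(4) t unfolding holomorphic_on_open[OF assms(2)] by blast
  then obtain d where d: "\<And>j. ((\<lambda>t. g t $ j) has_field_derivative d j) (at t)" by metis
  have g: "((\<lambda>t. \<chi> j. g t $ j) has_derivative (\<lambda>x. \<chi> j. d j * x)) (at t)"
    using d by (intro has_derivative_vec_complex) (simp add: has_field_derivative_def)
  have "g t \<in> S" using t assms by blast
  then obtain M where M: "(h has_derivative M) (at (g t))" "complex_linear M"
    using assms hol_iff_complex_linear by meson
  have "((\<lambda>t. h (g t)) has_derivative (\<lambda>x. M (\<chi> j. d j * x))) (at t)"
    using has_derivative_compose[of g "\<lambda>x. \<chi> j. d j * x" t UNIV h M] g M(1) by simp
  moreover have "M (\<chi> j. d j * x) = M (\<chi> j. d j) * x" for x
  proof -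
    have "(\<chi> j. d j * x) = x *s (\<chi> j. d j)" by (simp add: vec_eq_iff mult.commute)
    then show ?thesis using M(2) by (simp add: complex_linear_def mult.commute)
  qed
  ultimately have "((\<lambda>t. h (g t)) has_field_derivative M (\<chi> j. d j)) (at t)"
    by (simp add: has_field_derivative_def)
  then show "\<exists>f'. ((\<lambda>t. h (g t)) has_field_derivative f') (at t)" by blast
qed

lemma hol_line:
  assumes "open S" "holomorphic_fun_on h S"
  shows "(\<lambda>t. h (z + t *s v)) holomorphic_on {t. z + t *s v \<in> S}"
proof (rule hol_compose_curve[OF assms(1) _ assms(2)])
  show "open {t. z + t *s v \<in> S}"
    using open_vimage[OF assms(1), of "\<lambda>t. z + t *s v"]
    by (simp add: vimage_def continuous_on_vec_lambda vector_scalar_mult_def continuous_intros)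
  show "(\<lambda>t. (z + t *s v) $ j) holomorphic_on {t. z + t *s v \<in> S}" for j
    by (auto intro!: holomorphic_intros)
qed auto

lemma continuous_on_vector_scale [continuous_intros]:
  fixes g :: "'a::topological_space \<Rightarrow> complex^'n"
  assumes "continuous_on S f" "continuous_on S g"
  shows "continuous_on S (\<lambda>x. f x *s g x)"
  unfolding vector_scalar_mult_def by (intro continuous_intros assms)

lemma open_line_preimage: "open S \<Longrightarrow> open {t. z + t *s v \<in> (S::(complex^'n) set)}"
  using open_vimage[of S "\<lambda>t. z + t *s v"]
  by (simp add: vimage_def continuous_intros)

lemma hol_line_deriv:
  assumes "(h has_derivative L) (at (z + t *s v))" "complex_linear L"
  shows "((\<lambda>t. h (z + t *s v)) has_field_derivative L v) (at t)"
proof -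
  have "((\<lambda>t. z + t *s v) has_derivative (\<lambda>x. x *s v)) (at t)"
  proof -
    have "bounded_linear (\<lambda>x. x *s v)"
      by (rule bounded_linear_intro[of _ "norm v"]) (auto simp: vec_eq_iff algebra_simps)
    then show ?thesis by (auto intro!: derivative_eq_intros bounded_linear_imp_has_derivative)
  qed
  from has_derivative_compose[OF this assms(1)]
  have "((\<lambda>t. h (z + t *s v)) has_derivative (\<lambda>x. L (x *s v))) (at t)" .
  moreover have "(\<lambda>x. L (x *s v)) = (*) (L v)" using assms(2) by (auto simp: complex_linear_def mult.commute)
  ultimately show ?thesis by (simp add: has_field_derivative_def)
qed

lemma cauchy_estimate:
  fixes h :: "complex^'n::finite \<Rightarrow> complex"
  assumes h: "holomorphic_fun_on h (ball z r)" and r: "r > 0" and M: "\<And>x. x \<in> ball z r \<Longrightarrow> norm (h x) \<le> M"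
    and L: "(h has_derivative L) (at z)" "complex_linear L"
  shows "norm (L v) \<le> 2 * M / r * norm v"
proof (cases "v = 0")
  case True
  have "L v = 0 * L v" using L(2) True unfolding complex_linear_def
    by (metis vector_smult_lzero vector_smult_rzero)
  then show ?thesis using True by simp
next
  case False
  define g where "g = (\<lambda>t. h (z + t *s v))"
  \<comment> \<open>Half of the largest possible radius, so that the closed disc stays inside the
    open ball; this is the factor 2 in the estimate.\<close>
  define R where "R = r / (2 * norm v)"
  have R: "R > 0" using r False by (simp add: R_def)
  have sub: "cball 0 R \<subseteq> {t. z + t *s v \<in> ball z r}"
  proof
    fix t :: complex assume "t \<in> cball 0 R"
    then have "norm t * norm v \<le> R * norm v" by (simp add: mult_right_mono)
    also have "\<dots> = r / 2" using False by (simp add: R_def)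
    also have "\<dots> < r" using r by simp
    finally have "norm (t *s v) < r" by simp
    then show "t \<in> {t. z + t *s v \<in> ball z r}" by (simp add: dist_norm)
  qed
  have hg: "g holomorphic_on cball 0 R"
    unfolding g_def by (rule holomorphic_on_subset[OF hol_line[OF open_ball h] sub])
  have "norm ((deriv ^^ 1) g 0) \<le> fact 1 * M / R ^ 1"
  proof (rule Cauchy_inequality)
    show "g holomorphic_on ball 0 R" using hg holomorphic_on_subset ball_subset_cball by blast
    show "continuous_on (cball 0 R) g" using hg holomorphic_on_imp_continuous_on by blast
    show "norm (g x) \<le> M" if "norm (0 - x) = R" for x
      using that sub M by (auto simp: g_def subset_eq)
  qed (rule R)
  moreover have "deriv g 0 = L v"
    unfolding g_def by (rule DERIV_imp_deriv, rule hol_line_deriv) (use L in auto)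
  ultimately have "norm (L v) \<le> M / R" by simp
  then show ?thesis using False by (simp add: R_def field_simps)
qed

section \<open>Integrals depending holomorphically on a parameter\<close>

text \<open>Dominated convergence along sequences. The derivative is only real linear here, because
  the lemma also serves for translates of bump functions.\<close>

lemma derivative_lebesgue_integral:
  fixes F :: "'a::euclidean_space \<Rightarrow> 'x \<Rightarrow> complex"
  assumes r: "r > 0"
    and int: "\<And>v. v \<in> ball 0 r \<Longrightarrow> integrable M (F (z + v))"
    and der: "\<And>x. x \<in> space M \<Longrightarrow> ((\<lambda>z. F z x) has_derivative L x) (at z)"
    and lip: "\<And>x v. x \<in> space M \<Longrightarrow> v \<in> ball 0 r \<Longrightarrow> norm (F (z + v) x - F z x) \<le> B x * norm v"
    and B: "integrable M B"
  shows integrable_derivative_lebesgue_integral: "integrable M (\<lambda>x. L x v)"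
    and has_derivative_lebesgue_integral:
      "((\<lambda>z. \<integral>x. F z x \<partial>M) has_derivative (\<lambda>v. \<integral>x. L x v \<partial>M)) (at z)"
proof -
  have bl: "bounded_linear (L x)" if "x \<in> space M" for x
    using der[OF that] has_derivative_bounded_linear by blast
  have seq: "(\<lambda>n. norm (F (z + v n) x - F z x - L x (v n)) / norm (v n)) \<longlonglongrightarrow> 0"
    if "x \<in> space M" "v \<longlonglongrightarrow> 0" "\<And>n. v n \<noteq> 0" for x and v :: "nat \<Rightarrow> 'a"
  proof -
    have "(\<lambda>h. norm (F (z + h) x - F z x - L x h) / norm h) \<midarrow>0\<rightarrow> 0"
      using der[OF that(1)] by (simp add: has_derivative_at)
    then show ?thesis
      using that(2,3) unfolding tendsto_at_iff_sequentially by (auto simp: comp_def)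
  qed
  \<comment> \<open>Being the pointwise limit of these difference quotients, \<open>L x v\<close>
    inherits from them both its measurability and the bound \<open>B x * norm v\<close>.\<close>
  have lim: "(\<lambda>n. real (Suc n) *\<^sub>R (F (z + (1 / real (Suc n)) *\<^sub>R v) x - F z x)) \<longlonglongrightarrow> L x v"
    if x: "x \<in> space M" for x v
  proof (cases "v = 0")
    case True
    then show ?thesis using bl[OF x] by (simp add: linear_simps)
  next
    case False
    define w where "w = (\<lambda>n. (1 / real (Suc n)) *\<^sub>R v)"
    have "(\<lambda>n. (1 / real (Suc n)) *\<^sub>R v) \<longlonglongrightarrow> 0 *\<^sub>R v"
      using LIMSEQ_inverse_real_of_nat by (intro tendsto_intros) (simp add: divide_inverse)
    then have w0: "w \<longlonglongrightarrow> 0" by (simp add: w_def)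
    have "(\<lambda>n. norm v * (norm (F (z + w n) x - F z x - L x (w n)) / norm (w n))) \<longlonglongrightarrow> norm v * 0"
      using False by (intro tendsto_intros seq[OF x w0]) (simp add: w_def)
    moreover have "norm v * (norm (F (z + w n) x - F z x - L x (w n)) / norm (w n)) =
        norm (real (Suc n) *\<^sub>R (F (z + w n) x - F z x) - L x v)" for n
    proof -
      have Lw: "L x (w n) = (1 / real (Suc n)) *\<^sub>R L x v"
        using bl[OF x] by (simp add: w_def linear_simps)
      have "real (Suc n) *\<^sub>R (F (z + w n) x - F z x) - L x v =
          real (Suc n) *\<^sub>R (F (z + w n) x - F z x - L x (w n))"
        unfolding Lw scaleR_diff_right scaleR_scaleR by simp
      moreover have "norm (w n) = norm v / real (Suc n)"
        by (simp add: w_def)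
      ultimately show ?thesis using False by simp
    qed
    ultimately have "(\<lambda>n. norm (real (Suc n) *\<^sub>R (F (z + w n) x - F z x) - L x v)) \<longlonglongrightarrow> 0"
      by simp
    then show ?thesis
      unfolding w_def by (rule LIM_zero_cancel[OF tendsto_norm_zero_cancel])
  qed
  have Fz: "integrable M (F z)" using int[of 0] r by simp
  have Lb: "norm (L x v) \<le> B x * norm v" if x: "x \<in> space M" for x v
  proof (rule tendsto_upperbound[OF tendsto_norm[OF lim[OF x]]])
    obtain N :: nat where N: "norm v / r < real N" using reals_Archimedean2 by blast
    show "\<forall>\<^sub>F n in sequentially. norm (real (Suc n) *\<^sub>R (F (z + (1 / real (Suc n)) *\<^sub>R v) x - F z x)) \<le> B x * norm v"
    proof (rule eventually_sequentiallyI[of N])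
      fix n assume "N \<le> n"
      then have "norm v / r < real (Suc n)" using N by linarith
      then have "norm v < r * real (Suc n)" using r by (simp add: field_simps)
      then have "(1 / real (Suc n)) *\<^sub>R v \<in> ball 0 r" by (simp add: divide_less_eq field_simps)
      from lip[OF x this]
      have "norm (F (z + (1 / real (Suc n)) *\<^sub>R v) x - F z x) \<le> B x * (norm v / real (Suc n))"
        by simp
      then have "real (Suc n) * norm (F (z + (1 / real (Suc n)) *\<^sub>R v) x - F z x) \<le> B x * norm v"
        by (simp add: field_simps)
      then show "norm (real (Suc n) *\<^sub>R (F (z + (1 / real (Suc n)) *\<^sub>R v) x - F z x)) \<le> B x * norm v"
        unfolding norm_scaleR by simp
    qed
  qed auto
  have meas: "(\<lambda>x. L x v) \<in> borel_measurable M" for v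
  proof -
    obtain N :: nat where N: "norm v / r < real N" using reals_Archimedean2 by blast
    show ?thesis
    proof (rule borel_measurable_LIMSEQ_metric[OF _ LIMSEQ_ignore_initial_segment[OF lim, of _ N]])
      fix n
      have "norm v / r < real (Suc (n + N))" using N by linarith
      then have "norm v < r * real (Suc (n + N))" using r by (simp add: field_simps)
      then have "(1 / real (Suc (n + N))) *\<^sub>R v \<in> ball 0 r" by (simp add: divide_less_eq field_simps)
      from int[OF this] Fz
      show "(\<lambda>x. real (Suc (n + N)) *\<^sub>R (F (z + (1 / real (Suc (n + N))) *\<^sub>R v) x - F z x)) \<in> borel_measurable M"
        by (intro borel_measurable_scaleR borel_measurable_diff) auto
    qed
  qed
  have intL: "integrable M (\<lambda>x. L x v)" for v
  proof (rule Bochner_Integration.integrable_bound[OF _ meas])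
    show "integrable M (\<lambda>x. B x * norm v)" using B by simp
    show "AE x in M. norm (L x v) \<le> norm (B x * norm v)"
      using Lb by (intro AE_I2) (metis abs_ge_self order_trans real_norm_def)
  qed
  then show "integrable M (\<lambda>x. L x v)" .
  show "((\<lambda>z. \<integral>x. F z x \<partial>M) has_derivative (\<lambda>v. \<integral>x. L x v \<partial>M)) (at z)"
    unfolding has_derivative_at
  proof
    have lin: "L x (a + b) = L x a + L x b" "L x (c *\<^sub>R a) = c *\<^sub>R L x a" if "x \<in> space M" for x a b c
      using bl[OF that] by (simp_all add: linear_simps)
    show "bounded_linear (\<lambda>v. \<integral>x. L x v \<partial>M)"
    proof (rule bounded_linear_intro)
      fix a b
      have "(\<integral>x. L x (a + b) \<partial>M) = (\<integral>x. L x a + L x b \<partial>M)"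
        by (rule Bochner_Integration.integral_cong) (auto simp: lin)
      then show "(\<integral>x. L x (a + b) \<partial>M) = (\<integral>x. L x a \<partial>M) + (\<integral>x. L x b \<partial>M)"
        using intL by simp
    next
      fix c a
      have "(\<integral>x. L x (c *\<^sub>R a) \<partial>M) = (\<integral>x. c *\<^sub>R L x a \<partial>M)"
        by (rule Bochner_Integration.integral_cong) (auto simp: lin)
      then show "(\<integral>x. L x (c *\<^sub>R a) \<partial>M) = c *\<^sub>R (\<integral>x. L x a \<partial>M)"
        using intL by simp
    next
      fix a
      have "norm (\<integral>x. L x a \<partial>M) \<le> (\<integral>x. norm (L x a) \<partial>M)" by (rule integral_norm_bound)
      also have "\<dots> \<le> (\<integral>x. B x * norm a \<partial>M)"
        using intL B Lb by (intro integral_mono) auto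
      finally show "norm (\<integral>x. L x a \<partial>M) \<le> norm a * (\<integral>x. B x \<partial>M)"
        by (simp add: mult.commute)
    qed
    show "(\<lambda>h. norm ((\<integral>x. F (z + h) x \<partial>M) - (\<integral>x. F z x \<partial>M) - (\<integral>x. L x h \<partial>M)) / norm h) \<midarrow>0\<rightarrow> 0"
      unfolding tendsto_at_iff_sequentially comp_def
    proof (intro allI impI)
      fix v :: "nat \<Rightarrow> 'a"
      assume v0: "\<forall>i. v i \<in> UNIV - {0}" and v: "v \<longlonglongrightarrow> 0"
      \<comment> \<open>The normalised remainder is dominated by \<open>2 * B\<close>: once for the
        difference quotient and once for \<open>L\<close>.\<close>
      define G where "G = (\<lambda>n x. (1 / norm (v n)) *\<^sub>R (F (z + v n) x - F z x - L x (v n)))"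
      have evb: "\<forall>\<^sub>F n in sequentially. v n \<in> ball 0 r"
        by (rule topological_tendstoD[OF v open_ball]) (use r in simp)
      have "\<exists>N. \<forall>n\<ge>N. v n \<in> ball 0 r" using evb by (simp add: eventually_sequentially)
      then obtain N where N: "\<And>n. n \<ge> N \<Longrightarrow> v n \<in> ball 0 r" by blast
      have Gint: "integrable M (G (n + N))" for n
        unfolding G_def using int[OF N[of "n + N"]] Fz intL by simp
      have "(\<lambda>n. \<integral>x. G (n + N) x \<partial>M) \<longlonglongrightarrow> (\<integral>x. 0 \<partial>M)"
      proof (rule integral_dominated_convergence[where w = "\<lambda>x. 2 * B x"])
        show "integrable M (\<lambda>x. 2 * B x)" using B by simp
        show "G (n + N) \<in> borel_measurable M" for n using Gint by auto
        show "AE x in M. (\<lambda>n. G (n + N) x) \<longlonglongrightarrow> 0"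
        proof (rule AE_I2)
          fix x assume x: "x \<in> space M"
          have "(\<lambda>n. norm (G n x)) \<longlonglongrightarrow> 0"
            using seq[OF x v] v0 by (simp add: G_def)
          then have "(\<lambda>n. G n x) \<longlonglongrightarrow> 0" by (rule tendsto_norm_zero_cancel)
          then show "(\<lambda>n. G (n + N) x) \<longlonglongrightarrow> 0" by (rule LIMSEQ_ignore_initial_segment)
        qed
        show "AE x in M. norm (G (n + N) x) \<le> 2 * B x" for n
        proof (rule AE_I2)
          fix x assume x: "x \<in> space M"
          let ?v = "v (n + N)"
          have vp: "norm ?v > 0" using v0 by simp
          have "norm (F (z + ?v) x - F z x - L x ?v) \<le> norm (F (z + ?v) x - F z x) + norm (L x ?v)"
            by (rule norm_triangle_ineq4)
          also have "\<dots> \<le> B x * norm ?v + B x * norm ?v"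
            using lip[OF x N[of "n + N"]] Lb[OF x] by (intro add_mono) auto
          finally show "norm (G (n + N) x) \<le> 2 * B x"
            using vp unfolding G_def norm_scaleR by (simp add: field_simps)
        qed
      qed simp
      moreover have "(\<integral>x. G (n + N) x \<partial>M) = (1 / norm (v (n + N))) *\<^sub>R
          ((\<integral>x. F (z + v (n + N)) x \<partial>M) - (\<integral>x. F z x \<partial>M) - (\<integral>x. L x (v (n + N)) \<partial>M))" for n
        unfolding G_def using int[OF N[of "n + N"]] Fz intL by simp
      ultimately have "(\<lambda>n. (1 / norm (v (n + N))) *\<^sub>R
          ((\<integral>x. F (z + v (n + N)) x \<partial>M) - (\<integral>x. F z x \<partial>M) - (\<integral>x. L x (v (n + N)) \<partial>M))) \<longlonglongrightarrow> 0"
        by simp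
      from tendsto_norm_zero[OF this]
      have "(\<lambda>n. norm ((\<integral>x. F (z + v (n + N)) x \<partial>M) - (\<integral>x. F z x \<partial>M) - (\<integral>x. L x (v (n + N)) \<partial>M))
          / norm (v (n + N))) \<longlonglongrightarrow> 0"
        unfolding norm_scaleR by simp
      then show "(\<lambda>n. norm ((\<integral>x. F (z + v n) x \<partial>M) - (\<integral>x. F z x \<partial>M) - (\<integral>x. L x (v n) \<partial>M)) / norm (v n)) \<longlonglongrightarrow> 0"
        by (rule LIMSEQ_offset)
    qed
  qed
qed

text \<open>Cauchy's estimate on balls of radius \<open>r / 2\<close> centred in
  \<open>ball z (r/2)\<close> bounds the derivative by \<open>4 * M / r\<close>; the mean value
  inequality does the rest.\<close>

lemma hol_lipschitz:
  fixes h :: "complex^'n::finite \<Rightarrow> complex"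
  assumes h: "holomorphic_fun_on h (ball z r)" and r: "r > 0" and M: "\<And>x. x \<in> ball z r \<Longrightarrow> norm (h x) \<le> M"
    and v: "v \<in> ball 0 (r/2)"
  shows "norm (h (z + v) - h z) \<le> 4 * M / r * norm v"
proof -
  have sub: "ball y (r/2) \<subseteq> ball z r" if y: "y \<in> ball z (r/2)" for y
  proof
    fix x assume "x \<in> ball y (r/2)"
    with y show "x \<in> ball z r" using dist_triangle[of z x y] by auto
  qed
  obtain L where L: "\<And>y. y \<in> ball z r \<Longrightarrow> (h has_derivative L y) (at y) \<and> complex_linear (L y)"
    using h unfolding hol_iff_complex_linear[OF open_ball] by metis
  have "norm (h (z + v) - h z) \<le> (4 * M / r) * norm (z + v - z)"
  proof (rule differentiable_bound[of "ball z (r/2)" h L])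
    fix y assume y: "y \<in> ball z (r/2)"
    then have yr: "y \<in> ball z r" using r by auto
    show "(h has_derivative L y) (at y within ball z (r/2))"
      using L[OF yr] has_derivative_at_withinI by blast
    have "norm (L y x) \<le> 4 * M / r * norm x" for x
      using cauchy_estimate[of h y "r/2" M "L y" x] hol_subset[OF h sub[OF y]] sub[OF y] M r L[OF yr]
      by (auto simp: subset_eq)
    then show "onorm (L y) \<le> 4 * M / r"
      using L[OF yr] by (intro onorm_bound) (auto intro: order_trans[OF norm_ge_zero] mult_nonneg_nonneg
        simp: divide_nonneg_pos r order_trans[OF norm_ge_zero M[OF yr]])
  qed (use v r in \<open>auto simp: dist_norm\<close>)
  then show ?thesis by simp
qed

text \<open>A local dominating function for the values suffices: \<open>hol_lipschitz\<close> turns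
  it into the Lipschitz constant \<open>4 * B x / r\<close> that differentiation under the integral
  asks for.\<close>

lemma hol_lebesgue_integral:
  fixes F :: "complex^'n::finite \<Rightarrow> 'x \<Rightarrow> complex"
  assumes V: "open V"
    and hol: "\<And>x. x \<in> space M \<Longrightarrow> holomorphic_fun_on (\<lambda>z. F z x) V"
    and meas: "\<And>z. z \<in> V \<Longrightarrow> F z \<in> borel_measurable M"
    and bnd: "\<And>z. z \<in> V \<Longrightarrow> \<exists>r>0. \<exists>B. ball z r \<subseteq> V \<and> integrable M B \<and>
        (\<forall>y\<in>ball z r. \<forall>x\<in>space M. norm (F y x) \<le> B x)"
  shows "holomorphic_fun_on (\<lambda>z. \<integral>x. F z x \<partial>M) V"
  unfolding hol_iff_complex_linear[OF V]
proof
  fix z assume z: "z \<in> V"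
  obtain r B where r: "r > 0" "ball z r \<subseteq> V" "integrable M B"
    and B: "\<And>y x. y \<in> ball z r \<Longrightarrow> x \<in> space M \<Longrightarrow> norm (F y x) \<le> B x"
    using bnd[OF z] by blast
  have "\<forall>x. \<exists>L. x \<in> space M \<longrightarrow> ((\<lambda>z. F z x) has_derivative L) (at z) \<and> complex_linear L"
    using hol z unfolding hol_iff_complex_linear[OF V] by blast
  then obtain L where L: "\<And>x. x \<in> space M \<Longrightarrow> ((\<lambda>z. F z x) has_derivative L x) (at z)"
     "\<And>x. x \<in> space M \<Longrightarrow> complex_linear (L x)" by metis
  have int: "integrable M (F (z + v))" if "v \<in> ball 0 r" for v
  proof (rule Bochner_Integration.integrable_bound[OF r(3)])
    have zv: "z + v \<in> ball z r" using that by (simp add: dist_norm)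
    show "F (z + v) \<in> borel_measurable M" using meas zv r(2) by blast
    show "AE x in M. norm (F (z + v) x) \<le> norm (B x)"
      using B[OF zv] by (intro AE_I2) (metis abs_ge_self order_trans real_norm_def)
  qed
  note D = derivative_lebesgue_integral[where F = F and L = L and z = z and M = M and r = "r/2" and B = "\<lambda>x. 4 * B x / r"]
  have lip: "norm (F (z + v) x - F z x) \<le> 4 * B x / r * norm v" if "x \<in> space M" "v \<in> ball 0 (r/2)" for x v
    using hol_lipschitz[of "\<lambda>z. F z x" z r "B x" v] hol_subset[OF hol[OF that(1)] r(2)] r(1) B that by auto
  have "((\<lambda>z. \<integral>x. F z x \<partial>M) has_derivative (\<lambda>v. \<integral>x. L x v \<partial>M)) (at z)"
    using r int L(1) lip by (intro D(2)) auto
  moreover have iL: "integrable M (\<lambda>x. L x v)" for v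
    using r int L(1) lip by (intro D(1)) auto
  have "complex_linear (\<lambda>v. \<integral>x. L x v \<partial>M)"
    unfolding complex_linear_def
  proof (intro conjI allI)
    fix a b
    have "(\<integral>x. L x (a + b) \<partial>M) = (\<integral>x. L x a + L x b \<partial>M)"
      by (rule Bochner_Integration.integral_cong) (use L(2) in \<open>auto simp: complex_linear_def\<close>)
    then show "(\<integral>x. L x (a + b) \<partial>M) = (\<integral>x. L x a \<partial>M) + (\<integral>x. L x b \<partial>M)"
      using iL by simp
  next
    fix c a
    have "(\<integral>x. L x (c *s a) \<partial>M) = (\<integral>x. c * L x a \<partial>M)"
      by (rule Bochner_Integration.integral_cong) (use L(2) in \<open>auto simp: complex_linear_def\<close>)
    then show "(\<integral>x. L x (c *s a) \<partial>M) = c * (\<integral>x. L x a \<partial>M)"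
      using iL by simp
  qed
  ultimately show "\<exists>L. ((\<lambda>z. \<integral>x. F z x \<partial>M) has_derivative L) (at z) \<and> complex_linear L" by blast
qed

section \<open>Averages over the unit circle\<close>

definition unit_circle :: "real \<Rightarrow> complex" where
  "unit_circle t = exp (2 * of_real pi * \<i> * of_real t)"

lemma norm_unit_circle [simp]: "norm (unit_circle t) = 1"
  by (simp add: unit_circle_def)

lemma unit_circle_nonzero [simp]: "unit_circle t \<noteq> 0"
  by (simp add: unit_circle_def)

lemma continuous_on_unit_circle [continuous_intros]:
  "continuous_on S f \<Longrightarrow> continuous_on S (\<lambda>x. unit_circle (f x))"
  unfolding unit_circle_def by (intro continuous_intros)

text \<open>Normalised arc length as a measure on the whole line: circle averages become Bochner
  integrals, to which Fubini and the lemmas on parameters apply directly.\<close>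

definition circle_measure :: "real measure" where
  "circle_measure = density lborel (\<lambda>x. ennreal (indicator {0..1} x))"

lemma sets_circle_measure [simp, measurable_cong]: "sets circle_measure = sets borel"
  by (simp add: circle_measure_def)

lemma space_circle_measure [simp]: "space circle_measure = UNIV"
  by (simp add: circle_measure_def)

lemma emeasure_circle_measure: "emeasure circle_measure UNIV = 1"
  unfolding circle_measure_def by (simp add: emeasure_density ennreal_indicator)

lemma finite_measure_circle: "finite_measure circle_measure"
  by (rule finite_measureI) (simp add: emeasure_circle_measure)

lemma integral_circle_measure:
  fixes f :: "real \<Rightarrow> complex"
  assumes "f \<in> borel_measurable borel"
  shows "integral\<^sup>L circle_measure f = (LINT x:{0..1}|lborel. f x)"
  unfolding circle_measure_def set_lebesgue_integral_def
  using assms by (subst integral_density) auto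

lemma circle_integral_const: "integral\<^sup>L circle_measure (\<lambda>x. c::complex) = c"
proof -
  have "measure circle_measure UNIV = 1" by (simp add: measure_def emeasure_circle_measure)
  then show ?thesis by simp
qed

lemma continuous_circle_measurable:
  fixes f :: "real \<Rightarrow> complex"
  assumes "continuous_on UNIV f" shows "f \<in> borel_measurable circle_measure"
  using borel_measurable_continuous_onI[OF assms] by (simp cong: measurable_cong_sets)

text \<open>Cauchy's formula for the \<open>d\<close>-th derivative. The velocity of the circle
  contributes the factor \<open>2 * pi * \<i>\<close> times the point itself, which cancels one
  power in the denominator.\<close>

lemma circle_coefficient:
  assumes g: "g holomorphic_on S" and S: "open S" "cball 0 r \<subseteq> S" and r: "r > 0"
  shows "integral\<^sup>L circle_measure (\<lambda>t. g (of_real r * unit_circle t) / (of_real r * unit_circle t) ^ d)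
      = (deriv ^^ d) g 0 / fact d"
proof -
  let ?f = "\<lambda>t. g (of_real r * unit_circle t) / (of_real r * unit_circle t) ^ d"
  have in_S: "of_real r * unit_circle t \<in> S" for t
    using S(2) r by (auto simp: subset_eq norm_mult)
  have cont: "continuous_on UNIV ?f"
    using r in_S by (intro continuous_intros continuous_on_compose2[OF holomorphic_on_imp_continuous_on[OF g]]) auto
  have "((\<lambda>u. g u / (u - 0) ^ Suc d) has_contour_integral (2 * pi * \<i>) / fact d * (deriv ^^ d) g 0) (circlepath 0 r)"
  proof (rule Cauchy_has_contour_integral_higher_derivative_circlepath)
    show "continuous_on (cball 0 r) g" using g S(2) holomorphic_on_imp_continuous_on holomorphic_on_subset by blast
    show "g holomorphic_on ball 0 r" using g S(2) holomorphic_on_subset ball_subset_cball by blast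
  qed (use r in simp)
  then have "((\<lambda>x. g (circlepath 0 r x) / circlepath 0 r x ^ Suc d * vector_derivative (circlepath 0 r) (at x within {0..1}))
     has_integral (2 * pi * \<i>) / fact d * (deriv ^^ d) g 0) {0..1}"
    by (simp add: has_contour_integral_def)
  then have "((\<lambda>t. (2 * pi * \<i>) * ?f t) has_integral (2 * pi * \<i>) / fact d * (deriv ^^ d) g 0) {0..1}"
  proof (rule has_integral_eq[rotated])
    fix t :: real assume t: "t \<in> {0..1}"
    have c: "circlepath 0 r t = of_real r * unit_circle t"
      by (simp add: circlepath unit_circle_def mult_ac)
    have vd: "vector_derivative (circlepath 0 r) (at t within {0..1}) = 2 * pi * \<i> * (of_real r * unit_circle t)"
      using t by (simp add: vector_derivative_circlepath01 unit_circle_def mult_ac)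
    show "g (circlepath 0 r t) / circlepath 0 r t ^ Suc d * vector_derivative (circlepath 0 r) (at t within {0..1})
        = (2 * pi * \<i>) * ?f t"
      unfolding c vd using r by (simp add: field_simps)
  qed
  from has_integral_mult_right[OF this, of "1 / (2 * pi * \<i>)"]
  have hk: "(?f has_integral (deriv ^^ d) g 0 / fact d) {0..1}"
    by (simp add: mult.assoc[symmetric] divide_simps)
  have "integral\<^sup>L circle_measure ?f = (LINT x:{0..1}|lborel. ?f x)"
    by (rule integral_circle_measure) (rule borel_measurable_continuous_onI[OF cont])
  also have "\<dots> = integral {0..1} ?f"
    by (rule set_borel_integral_eq_integral(2))
       (use borel_integrable_compact[of "{0..1::real}" ?f] continuous_on_subset[OF cont] in \<open>auto simp: set_integrable_def\<close>)
  also have "\<dots> = (deriv ^^ d) g 0 / fact d" using hk by (rule integral_unique)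
  finally show ?thesis .
qed

lemma circle_mean:
  assumes "g holomorphic_on S" "open S" "cball 0 r \<subseteq> S" "r \<ge> 0"
  shows "integral\<^sup>L circle_measure (\<lambda>t. g (of_real r * unit_circle t)) = g 0"
proof (cases "r = 0")
  case True
  then show ?thesis by (simp only: of_real_0 mult_zero_left circle_integral_const)
next
  case False
  then show ?thesis using circle_coefficient[OF assms(1-3), of 0] assms(4) by simp
qed

section \<open>Partial derivatives, identity theorem, locally uniform limits\<close>

definition partial :: "'n::finite \<Rightarrow> (complex^'n \<Rightarrow> complex) \<Rightarrow> complex^'n \<Rightarrow> complex" where
  "partial i f z = deriv (\<lambda>t. f (z + t *s axis i 1)) 0"

lemma partial_eq:
  assumes "(f has_derivative L) (at z)" "complex_linear L"
  shows "partial i f z = L (axis i 1)"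
  unfolding partial_def by (rule DERIV_imp_deriv, rule hol_line_deriv) (use assms in auto)

lemma hol_has_derivative:
  assumes "holomorphic_fun_on f S" "open S" "z \<in> S"
  shows "(f has_derivative (\<lambda>v. \<Sum>i\<in>UNIV. v $ i * partial i f z)) (at z)"
proof -
  obtain L where L: "(f has_derivative L) (at z)" "complex_linear L"
    using assms hol_iff_complex_linear by meson
  show ?thesis using has_derivative_complex_linear_eq[OF L] partial_eq[OF L] by simp
qed

lemma line_in_cball:
  fixes z :: "complex^'n::finite"
  assumes "norm v \<le> 1" "t \<in> cball 0 r"
  shows "z + t *s v \<in> cball z r"
proof -
  have "norm t * norm v \<le> r * 1" using assms by (intro mult_mono) (auto intro: order_trans[OF norm_ge_zero])
  then show ?thesis by (simp add: dist_norm)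
qed

lemma partial_circle:
  fixes f :: "complex^'n::finite \<Rightarrow> complex"
  assumes "holomorphic_fun_on f S" "open S" "cball z r \<subseteq> S" "r > 0"
  shows "partial i f z = integral\<^sup>L circle_measure
     (\<lambda>t. f (z + (of_real r * unit_circle t) *s axis i 1) / (of_real r * unit_circle t))"
proof -
  have "cball 0 r \<subseteq> {t. z + t *s axis i 1 \<in> S}"
    using line_in_cball[of "axis i 1" _ r z] assms(3) by (auto simp: subset_eq)
  from circle_coefficient[OF hol_line[OF assms(2,1)] open_line_preimage[OF assms(2)] this assms(4), of 1]
  show ?thesis by (simp add: partial_def)
qed

lemma hol_bounded_cball:
  assumes "holomorphic_fun_on f S" "cball z r \<subseteq> S"
  shows "\<exists>B. \<forall>x\<in>cball z r. norm (f x) \<le> B"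
proof -
  have "compact (f ` cball z r)"
    using hol_continuous[OF assms(1)] assms(2) by (intro compact_continuous_image) (auto intro: continuous_on_subset)
  then show ?thesis unfolding compact_eq_bounded_closed bounded_iff by blast
qed

lemma circle_shift_in_cball:
  fixes z :: "complex^'n::finite"
  assumes "y \<in> cball z s" "r \<ge> 0" "s + r \<le> R"
  shows "y + (of_real r * unit_circle t) *s axis i 1 \<in> cball z R"
proof -
  have "norm ((of_real r * unit_circle t) *s axis i 1 :: complex^'n) \<le> r"
    using assms by (simp add: norm_mult)
  then have "dist y (y + (of_real r * unit_circle t) *s axis i 1) \<le> r" by (simp add: dist_norm)
  then show ?thesis using assms dist_triangle[of z "y + (of_real r * unit_circle t) *s axis i 1" y] by auto
qed

lemma hol_translate:
  assumes "open S" "holomorphic_fun_on f S" "open T" "\<And>z. z \<in> T \<Longrightarrow> z + a \<in> S"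
  shows "holomorphic_fun_on (\<lambda>z. f (z + a)) T"
  using assms by (intro hol_compose[OF assms(1,3,2)]) (auto intro!: hol_add hol_component hol_const)

text \<open>On a circle of fixed radius Cauchy's formula expresses the partial derivative by values
  of \<open>f\<close>, with the centre as a holomorphic parameter of the integral.\<close>

lemma hol_partial:
  fixes f :: "complex^'n::finite \<Rightarrow> complex"
  assumes f: "holomorphic_fun_on f S" and S: "open S"
  shows "holomorphic_fun_on (partial i f) S"
proof (rule hol_locally[OF S])
  fix z assume "z \<in> S"
  then obtain e where e: "e > 0" "cball z e \<subseteq> S" using S open_contains_cball by blast
  \<comment> \<open>Centres move by at most \<open>r\<close> and the circle adds another
    \<open>r\<close>, so all points remain in \<open>cball z e\<close>.\<close>
  define r where "r = e / 2"
  have r: "r > 0" using e by (simp add: r_def)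
  have in_e: "y + (of_real r * unit_circle t) *s axis i 1 \<in> cball z e" if "y \<in> ball z r" for y t
    using that r by (intro circle_shift_in_cball[of y z r]) (auto simp: r_def)
  obtain B where B: "\<And>x. x \<in> cball z e \<Longrightarrow> norm (f x) \<le> B"
    using hol_bounded_cball[OF f e(2)] by blast
  let ?F = "\<lambda>y t. f (y + (of_real r * unit_circle t) *s axis i 1) / (of_real r * unit_circle t)"
  have "holomorphic_fun_on (\<lambda>y. integral\<^sup>L circle_measure (?F y)) (ball z r)"
  proof (rule hol_lebesgue_integral[OF open_ball])
    show "holomorphic_fun_on (\<lambda>y. ?F y t) (ball z r)" for t
    proof -
      have "holomorphic_fun_on (\<lambda>y. f (y + (of_real r * unit_circle t) *s axis i 1)) (ball z r)"
        using in_e e(2) by (intro hol_translate[OF S f open_ball]) blast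
      then show ?thesis
        using r by (intro hol_divide hol_const) auto
    qed
    show "?F y \<in> borel_measurable circle_measure" if "y \<in> ball z r" for y
    proof (rule continuous_circle_measurable)
      show "continuous_on UNIV (?F y)"
        using in_e[OF that] e(2) r
        by (intro continuous_intros continuous_on_compose2[OF hol_continuous[OF f]]) auto
    qed
    fix y assume y: "y \<in> ball z r"
    have "ball y (r - dist z y) \<subseteq> ball z r"
      using dist_triangle[of z _ y] by (auto simp: subset_eq) (metis add.commute less_diff_eq order_le_less_trans dist_triangle)
    moreover have "norm (?F x t) \<le> B / r" if "x \<in> ball z r" for x t
      using B[OF in_e[OF that]] r by (simp add: norm_divide norm_mult divide_right_mono)
    moreover have "integrable circle_measure (\<lambda>_. B / r)"
      using finite_measure.integrable_const[OF finite_measure_circle] .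
    ultimately show "\<exists>d>0. \<exists>Ba. ball y d \<subseteq> ball z r \<and> integrable circle_measure Ba \<and>
        (\<forall>x\<in>ball y d. \<forall>t\<in>space circle_measure. norm (?F x t) \<le> Ba t)"
      using y by (intro exI[of _ "r - dist z y"] conjI exI[of _ "\<lambda>_. B / r"]) auto
  qed
  moreover have "partial i f y = integral\<^sup>L circle_measure (?F y)" if y: "y \<in> ball z r" for y
  proof (rule partial_circle[OF f S _ r])
    have "cball y r \<subseteq> cball z e"
    proof
      fix x assume "x \<in> cball y r"
      then show "x \<in> cball z e" using y dist_triangle[of z x y] by (auto simp: r_def)
    qed
    then show "cball y r \<subseteq> S" using e(2) by blast
  qed
  ultimately have "holomorphic_fun_on (partial i f) (ball z r)"
    using hol_transform[OF open_ball, of "\<lambda>y. integral\<^sup>L circle_measure (?F y)" z r "partial i f"] by presburger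
  then show "\<exists>T. open T \<and> z \<in> T \<and> holomorphic_fun_on (partial i f) T"
    using r by (intro exI[of _ "ball z r"]) auto
qed

text \<open>Both mixed derivatives are the same double circle average, integrated in the two
  possible orders.\<close>

lemma partial_commute:
  fixes f :: "complex^'n::finite \<Rightarrow> complex"
  assumes f: "holomorphic_fun_on f S" and S: "open S" and z: "z \<in> S"
  shows "partial i (partial k f) z = partial k (partial i f) z"
proof -
  obtain e where e: "e > 0" "cball z e \<subseteq> S" using S z open_contains_cball by blast
  define r where "r = e / 2"
  have r: "r > 0" using e by (simp add: r_def)
  define c where "c = (\<lambda>t. of_real r * unit_circle t)"
  have cb: "cball (z + c t *s axis i 1) r \<subseteq> S" for t i
  proof
    fix x assume x: "x \<in> cball (z + c t *s axis i 1) r"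
    have "z + c t *s axis i 1 \<in> cball z r"
      unfolding c_def using r by (intro circle_shift_in_cball[of z z 0]) auto
    then have "x \<in> cball z e" using x dist_triangle[of z x "z + c t *s axis i 1"] by (auto simp: r_def)
    then show "x \<in> S" using e by blast
  qed
  have zr: "cball z r \<subseteq> S" using e by (auto simp: r_def)
  have rep: "partial i (partial k f) z = (\<integral>s. (\<integral>t. f (z + c s *s axis i 1 + c t *s axis k 1) / (c s * c t) \<partial>circle_measure) \<partial>circle_measure)" for i k
  proof -
    have "partial i (partial k f) z = (\<integral>s. partial k f (z + c s *s axis i 1) / c s \<partial>circle_measure)"
      using partial_circle[OF hol_partial[OF f S] S zr r] by (simp add: c_def)
    also have "\<dots> = (\<integral>s. (\<integral>t. f (z + c s *s axis i 1 + c t *s axis k 1) / (c s * c t) \<partial>circle_measure) \<partial>circle_measure)"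
    proof (rule Bochner_Integration.integral_cong[OF refl])
      fix s
      have "partial k f (z + c s *s axis i 1) = (\<integral>t. f (z + c s *s axis i 1 + c t *s axis k 1) / c t \<partial>circle_measure)"
        using partial_circle[OF f S cb r] by (simp add: c_def)
      then show "partial k f (z + c s *s axis i 1) / c s = (\<integral>t. f (z + c s *s axis i 1 + c t *s axis k 1) / (c s * c t) \<partial>circle_measure)"
        by (simp add: field_simps flip: integral_divide_zero)
    qed
    finally show ?thesis .
  qed
  interpret C: finite_measure circle_measure by (rule finite_measure_circle)
  interpret CC: pair_sigma_finite circle_measure circle_measure ..
  let ?G = "\<lambda>(s,t). f (z + c s *s axis i 1 + c t *s axis k 1) / (c s * c t)"
  have in_S: "z + c s *s axis i 1 + c t *s axis k 1 \<in> cball z e" for s t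
  proof -
    have 1: "z + c s *s axis i 1 \<in> cball z r"
      unfolding c_def using r by (intro circle_shift_in_cball[of z z 0]) auto
    show ?thesis
      unfolding c_def by (rule circle_shift_in_cball[OF 1[unfolded c_def]]) (use r in \<open>auto simp: r_def\<close>)
  qed
  obtain B where B: "\<And>x. x \<in> cball z e \<Longrightarrow> norm (f x) \<le> B"
    using hol_bounded_cball[OF f e(2)] by blast
  have "continuous_on UNIV ?G"
    unfolding case_prod_beta c_def using in_S e(2) r
    by (intro continuous_intros continuous_on_compose2[OF hol_continuous[OF f]]) (auto simp: c_def)
  then have "?G \<in> borel_measurable borel" by (rule borel_measurable_continuous_onI)
  then have meas: "?G \<in> borel_measurable (circle_measure \<Otimes>\<^sub>M circle_measure)"
    by (simp add: borel_prod[symmetric] cong: measurable_cong_sets sets_pair_measure_cong)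
  have "integrable (circle_measure \<Otimes>\<^sub>M circle_measure) ?G"
  proof (rule finite_measure.integrable_const_bound[OF _ _ meas, of "B / (r * r)"])
    show "finite_measure (circle_measure \<Otimes>\<^sub>M circle_measure)"
      by (rule finite_measure_pair_measure) (rule finite_measure_circle)+
    show "AE x in circle_measure \<Otimes>\<^sub>M circle_measure. norm (?G x) \<le> B / (r * r)"
      using B[OF in_S] r by (intro AE_I2) (auto simp: c_def norm_divide norm_mult divide_right_mono)
  qed
  from CC.Fubini_integral[OF this]
  show ?thesis unfolding rep by (simp add: add_ac mult_ac)
qed

section \<open>The identity theorem and locally uniform limits\<close>

lemma connected_line_ball:
  fixes p :: "complex^'n::finite"
  shows "connected {t. z + t *s v \<in> ball p r}"
proof -
  have "convex {t. z + t *s v \<in> ball p r}"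
    unfolding convex_def
  proof safe
    fix s t :: complex and a b :: real
    assume *: "z + s *s v \<in> ball p r" "z + t *s v \<in> ball p r" "0 \<le> a" "0 \<le> b" "a + b = 1"
    have "a *\<^sub>R (z + s *s v) + b *\<^sub>R (z + t *s v) \<in> ball p r"
      using convex_ball[of p r] * unfolding convex_def by blast
    also have "a *\<^sub>R (z + s *s v) + b *\<^sub>R (z + t *s v) = (a + b) *\<^sub>R z + (a *\<^sub>R s + b *\<^sub>R t) *s v"
      by (simp add: vec_eq_iff algebra_simps scaleR_conv_of_real[where 'a = complex])
    finally show "z + (a *\<^sub>R s + b *\<^sub>R t) *s v \<in> ball p r" using * by simp
  qed
  then show ?thesis by (rule convex_connected)
qed

text \<open>The complex line through \<open>q\<close> and \<open>x\<close> meets the ball in a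
  convex set, where the one-variable identity theorem applies.\<close>

lemma hol_zero_ball:
  fixes f :: "complex^'n::finite \<Rightarrow> complex"
  assumes f: "holomorphic_fun_on f (ball p r)" and T: "open T" "q \<in> T" "T \<subseteq> ball p r"
    and zero: "\<And>z. z \<in> T \<Longrightarrow> f z = 0" and x: "x \<in> ball p r"
  shows "f x = 0"
proof -
  define v where "v = x - q"
  define A where "A = {t. q + t *s v \<in> ball p r}"
  have A: "open A" unfolding A_def by (rule open_line_preimage[OF open_ball])
  have conn: "connected A" unfolding A_def by (rule connected_line_ball)
  have "f (q + 1 *s v) = 0"
  proof (rule analytic_continuation_open[of "{t. q + t *s v \<in> T}" A "\<lambda>t. f (q + t *s v)" "\<lambda>_. 0"])
    show "open {t. q + t *s v \<in> T}" by (rule open_line_preimage[OF T(1)])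
    have "0 \<in> {t. q + t *s v \<in> T}" using T by simp
    then show "{t. q + t *s v \<in> T} \<noteq> {}" by blast
    show "(\<lambda>t. f (q + t *s v)) holomorphic_on A"
      unfolding A_def by (rule hol_line[OF open_ball f])
    show "1 \<in> A" using x by (simp add: A_def v_def)
  qed (use A conn T zero in \<open>auto simp: A_def\<close>)
  then show ?thesis by (simp add: v_def)
qed

text \<open>The interior of the zero set is closed in \<open>S\<close>: a ball around a limit point
  meets it in an open set, and \<open>hol_zero_ball\<close> spreads the zeros over that
  ball.\<close>

lemma hol_identity_zero:
  fixes f :: "complex^'n::finite \<Rightarrow> complex"
  assumes f: "holomorphic_fun_on f S" and S: "open S" "connected S"
    and T: "open T" "T \<noteq> {}" "T \<subseteq> S" and zero: "\<And>z. z \<in> T \<Longrightarrow> f z = 0" and x: "x \<in> S"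
  shows "f x = 0"
proof -
  define Z where "Z = interior {z \<in> S. f z = 0}"
  have "Z \<subseteq> S" using interior_subset by (auto simp: Z_def)
  have "T \<subseteq> Z" unfolding Z_def using T zero by (intro interior_maximal) auto
  have "closedin (top_of_set S) Z"
    unfolding closedin_limpt
  proof (intro conjI allI impI)
    fix p assume p: "p islimpt Z \<and> p \<in> S"
    obtain r where r: "r > 0" "ball p r \<subseteq> S" using p S(1) open_contains_ball by blast
    obtain q where q: "q \<in> Z" "q \<in> ball p r" using p r(1) unfolding islimpt_approachable
      by (metis dist_commute mem_ball)
    have "f y = 0" if "y \<in> ball p r" for y
    proof (rule hol_zero_ball[OF hol_subset[OF f r(2)], of "Z \<inter> ball p r" q])
      show "open (Z \<inter> ball p r)" by (auto simp: Z_def)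
      show "f z = 0" if "z \<in> Z \<inter> ball p r" for z
        using that interior_subset by (auto simp: Z_def)
    qed (use q that in auto)
    then have "ball p r \<subseteq> Z" unfolding Z_def using r by (intro interior_maximal) auto
    then show "p \<in> Z" using r by auto
  qed (rule \<open>Z \<subseteq> S\<close>)
  moreover have "openin (top_of_set S) Z" using \<open>Z \<subseteq> S\<close> by (simp add: Z_def open_subset)
  ultimately have "Z = S" using S(2) \<open>T \<subseteq> Z\<close> T(2) unfolding connected_clopen by blast
  then show ?thesis using x interior_subset by (auto simp: Z_def)
qed

lemma hol_identity:
  fixes f g :: "complex^'n::finite \<Rightarrow> complex"
  assumes "holomorphic_fun_on f S" "holomorphic_fun_on g S" and S: "open S" "connected S"
    and T: "open T" "T \<noteq> {}" "T \<subseteq> S" and eq: "\<And>z. z \<in> T \<Longrightarrow> f z = g z" and x: "x \<in> S"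
  shows "f x = g x"
  using hol_identity_zero[OF hol_diff[OF S(1) assms(1,2)] S T _ x] eq by simp

text \<open>By Cauchy's estimate the derivatives form a locally uniform Cauchy sequence as well, so
  the limit is differentiable and its derivative is a limit of complex linear maps.\<close>

lemma hol_uniform_limit:
  fixes h :: "nat \<Rightarrow> complex^'n::finite \<Rightarrow> complex"
  assumes S: "open S" and h: "\<And>n. holomorphic_fun_on (h n) S"
    and cauchy: "\<And>z. z \<in> S \<Longrightarrow> \<exists>r>0. ball z r \<subseteq> S \<and>
       (\<forall>e>0. \<exists>N. \<forall>m\<ge>N. \<forall>n\<ge>N. \<forall>x\<in>ball z r. norm (h m x - h n x) \<le> e)"
  shows "\<exists>g. holomorphic_fun_on g S \<and> (\<forall>z\<in>S. (\<lambda>n. h n z) \<longlonglongrightarrow> g z)"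
proof -
  define g where "g = (\<lambda>z. lim (\<lambda>n. h n z))"
  have conv: "(\<lambda>n. h n z) \<longlonglongrightarrow> g z" if z: "z \<in> S" for z
  proof -
    obtain r where "r > 0" and c: "\<And>e. e > 0 \<Longrightarrow> \<exists>N. \<forall>m\<ge>N. \<forall>n\<ge>N. \<forall>x\<in>ball z r. norm (h m x - h n x) \<le> e"
      using cauchy[OF z] by blast
    have "Cauchy (\<lambda>n. h n z)"
    proof (rule CauchyI)
      fix e :: real assume "e > 0"
      then obtain N where "\<forall>m\<ge>N. \<forall>n\<ge>N. \<forall>x\<in>ball z r. norm (h m x - h n x) \<le> e/2" using c[of "e/2"] by auto
      then have "norm (h m z - h n z) < e" if "m \<ge> N" "n \<ge> N" for m n
        using \<open>r > 0\<close> \<open>e > 0\<close> that by (simp add: le_less_trans[of _ "e/2" e])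
      then show "\<exists>M. \<forall>m\<ge>M. \<forall>n\<ge>M. norm (h m z - h n z) < e" by blast
    qed
    then show ?thesis unfolding g_def by (simp only: Cauchy_convergent_iff convergent_LIMSEQ_iff)
  qed
  have "holomorphic_fun_on g S"
    unfolding hol_iff_complex_linear[OF S]
  proof
    fix z assume z: "z \<in> S"
    obtain r where r: "r > 0" "ball z r \<subseteq> S"
      and c: "\<And>e. e > 0 \<Longrightarrow> \<exists>N. \<forall>m\<ge>N. \<forall>n\<ge>N. \<forall>x\<in>ball z r. norm (h m x - h n x) \<le> e"
      using cauchy[OF z] by blast
    define L where "L = (\<lambda>n x v. \<Sum>i\<in>UNIV. v $ i * partial i (h n) x)"
    have L: "(h n has_derivative L n x) (at x)" if "x \<in> S" for n x
      unfolding L_def by (rule hol_has_derivative[OF h S that])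
    have Lc: "complex_linear (L n x)" for n x unfolding L_def by (rule complex_linear_sum_form)
    define B where "B = ball z (r/2)"
    have BS: "B \<subseteq> ball z r" using r by (auto simp: B_def)
    have Lcauchy: "\<exists>N. \<forall>m\<ge>N. \<forall>n\<ge>N. \<forall>x\<in>B. \<forall>v. norm (L m x v - L n x v) \<le> e * norm v" if e: "e > 0" for e
    proof -
      \<comment> \<open>The tolerance \<open>e * r / 4\<close> becomes exactly \<open>e\<close>
        under \<open>cauchy_estimate\<close> on balls of radius \<open>r / 2\<close>.\<close>
      obtain N where N: "\<And>m n x. m \<ge> N \<Longrightarrow> n \<ge> N \<Longrightarrow> x \<in> ball z r \<Longrightarrow> norm (h m x - h n x) \<le> e * r / 4"
        using c[of "e * r / 4"] mult_pos_pos[OF e r(1)] by (metis divide_pos_pos zero_less_numeral)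
      have "norm (L m x v - L n x v) \<le> e * norm v" if "m \<ge> N" "n \<ge> N" "x \<in> B" for m n x v
      proof -
        have sub: "ball x (r/2) \<subseteq> ball z r"
        proof
          fix y assume "y \<in> ball x (r/2)"
          then show "y \<in> ball z r" using that dist_triangle[of z y x] by (auto simp: B_def)
        qed
        have xS: "x \<in> S" using that BS r by blast
        have "norm ((\<lambda>v. L m x v - L n x v) v) \<le> 2 * (e * r / 4) / (r / 2) * norm v"
        proof (rule cauchy_estimate[of "\<lambda>y. h m y - h n y"])
          show "holomorphic_fun_on (\<lambda>y. h m y - h n y) (ball x (r/2))"
            using h sub r by (intro hol_diff) (auto intro: hol_subset)
          show "((\<lambda>y. h m y - h n y) has_derivative (\<lambda>v. L m x v - L n x v)) (at x)"
            using L[OF xS] by (intro has_derivative_diff)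
          show "complex_linear (\<lambda>v. L m x v - L n x v)" using Lc[of m x] Lc[of n x] by (simp add: complex_linear_def algebra_simps)
        qed (use r N that sub in auto)
        also have "2 * (e * r / 4) / (r / 2) = e" using r by simp
        finally show ?thesis .
      qed
      then show ?thesis by blast
    qed
    define G where "G = (\<lambda>x v. lim (\<lambda>n. L n x v))"
    have Gconv: "(\<lambda>n. L n x v) \<longlonglongrightarrow> G x v" if x: "x \<in> B" for x v
    proof -
      have "Cauchy (\<lambda>n. L n x v)"
      proof (rule CauchyI)
        fix e :: real assume e: "e > 0"
        define e' where "e' = e / (2 * (norm v + 1))"
        have "norm v + 1 > 0" by (simp add: add_nonneg_pos)
        then have e': "e' > 0" "e' * norm v < e"
          using e by (auto simp: e'_def divide_less_eq)
        obtain N where "\<forall>m\<ge>N. \<forall>n\<ge>N. \<forall>x\<in>B. \<forall>v. norm (L m x v - L n x v) \<le> e' * norm v"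
          using Lcauchy[OF e'(1)] by blast
        then show "\<exists>M. \<forall>m\<ge>M. \<forall>n\<ge>M. norm (L m x v - L n x v) < e"
          using e'(2) x by (meson le_less_trans)
      qed
      then show ?thesis unfolding G_def by (simp only: Cauchy_convergent_iff convergent_LIMSEQ_iff)
    qed
    have Gu: "\<forall>\<^sub>F n in sequentially. \<forall>x\<in>B. \<forall>v. norm (L n x v - G x v) \<le> e * norm v" if e: "e > 0" for e
    proof -
      obtain N where N: "\<And>m n x v. m \<ge> N \<Longrightarrow> n \<ge> N \<Longrightarrow> x \<in> B \<Longrightarrow> norm (L m x v - L n x v) \<le> e * norm v"
        using Lcauchy[OF e] by blast
      show ?thesis
      proof (rule eventually_sequentiallyI[of N], intro ballI allI)
        fix n x v assume "n \<ge> N" "x \<in> B"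
        show "norm (L n x v - G x v) \<le> e * norm v"
          by (rule tendsto_upperbound[OF tendsto_norm[OF tendsto_diff[OF tendsto_const Gconv[OF \<open>x \<in> B\<close>]]]])
             (use N \<open>n \<ge> N\<close> \<open>x \<in> B\<close> in \<open>auto intro!: eventually_sequentiallyI[of N]\<close>)
      qed
    qed
    have zB: "z \<in> B" using r by (simp add: B_def)
    obtain k where k: "\<And>x. x \<in> B \<Longrightarrow> (\<lambda>n. h n x) \<longlonglongrightarrow> k x" "\<And>x. x \<in> B \<Longrightarrow> (k has_derivative G x) (at x within B)"
    proof -
      have "\<exists>k. \<forall>x\<in>B. (\<lambda>n. h n x) \<longlonglongrightarrow> k x \<and> (k has_derivative G x) (at x within B)"
      proof (rule has_derivative_sequence[where f' = L and f = h])
        show "(h n has_derivative L n x) (at x within B)" if "x \<in> B" for n x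
          by (rule has_derivative_at_withinI, rule L) (use that BS r in blast)
        show "(\<lambda>n. h n z) \<longlonglongrightarrow> g z" by (rule conv[OF z])
      qed (use Gu zB in \<open>auto simp: B_def\<close>)
      then obtain k where "\<forall>x\<in>B. (\<lambda>n. h n x) \<longlonglongrightarrow> k x \<and> (k has_derivative G x) (at x within B)" ..
      then show ?thesis by (intro that[of k]) auto
    qed
    have kg: "k x = g x" if "x \<in> B" for x
      using k(1)[OF that] conv that BS r by (meson LIMSEQ_unique subsetD)
    have "(k has_derivative G z) (at z)"
      using k(2)[OF zB] at_within_open[OF zB] by (simp add: B_def)
    then have "(g has_derivative G z) (at z)"
      by (rule has_derivative_transform_within_open[of _ _ _ _ B]) (use zB kg in \<open>auto simp: B_def\<close>)
    moreover have "complex_linear (G z)"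
      unfolding complex_linear_def
    proof (intro conjI allI)
      fix a b
      have "(\<lambda>n. L n z a + L n z b) \<longlonglongrightarrow> G z a + G z b" by (intro tendsto_add Gconv zB)
      moreover have "(\<lambda>n. L n z (a + b)) = (\<lambda>n. L n z a + L n z b)" using Lc by (auto simp: complex_linear_def)
      ultimately show "G z (a + b) = G z a + G z b" using Gconv[OF zB, of "a+b"] LIMSEQ_unique by metis
    next
      fix c a
      have "(\<lambda>n. c * L n z a) \<longlonglongrightarrow> c * G z a" by (intro tendsto_mult tendsto_const Gconv zB)
      moreover have "(\<lambda>n. L n z (c *s a)) = (\<lambda>n. c * L n z a)" using Lc by (auto simp: complex_linear_def)
      ultimately show "G z (c *s a) = c * G z a" using Gconv[OF zB, of "c *s a"] LIMSEQ_unique by metis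
    qed
    ultimately show "\<exists>L. (g has_derivative L) (at z) \<and> complex_linear L" by blast
  qed
  then show ?thesis using conv by blast
qed

section \<open>Invariance of Lebesgue measure and mean values\<close>

lemma nn_integral_translate:
  fixes f :: "'a::euclidean_space \<Rightarrow> ennreal"
  assumes [measurable]: "f \<in> borel_measurable borel"
  shows "(\<integral>\<^sup>+x. f (a + x) \<partial>lborel) = (\<integral>\<^sup>+x. f x \<partial>lborel)"
proof -
  have "(\<integral>\<^sup>+x. f x \<partial>lborel) = (\<integral>\<^sup>+x. f x \<partial>distr lborel borel ((+) a))"
    by (simp only: lborel_distr_plus)
  also have "\<dots> = (\<integral>\<^sup>+x. f (a + x) \<partial>lborel)" by (subst nn_integral_distr) auto
  finally show ?thesis by simp
qed

lemma lborel_distr_reflect: "distr lborel borel uminus = (lborel :: 'a::euclidean_space measure)"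
proof -
  have "lborel = density (distr lborel borel (\<lambda>x::'a. 0 + (-1) *\<^sub>R x)) (\<lambda>_. \<bar>-1::real\<bar>^DIM('a))"
    by (rule lborel_affine) simp
  also have "\<dots> = distr lborel borel uminus" by (simp add: density_1)
  finally show ?thesis by simp
qed

lemma integral_translate:
  fixes f :: "'a::euclidean_space \<Rightarrow> complex"
  assumes [measurable]: "f \<in> borel_measurable borel"
  shows "(\<integral>x. f (a + x) \<partial>lborel) = (\<integral>x. f x \<partial>lborel)"
proof -
  have "(\<integral>x. f x \<partial>lborel) = (\<integral>x. f x \<partial>distr lborel borel ((+) a))"
    by (simp only: lborel_distr_plus)
  also have "\<dots> = (\<integral>x. f (a + x) \<partial>lborel)" by (subst integral_distr) auto
  finally show ?thesis by simp
qed

lemma integral_reflect: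
  fixes f :: "'a::euclidean_space \<Rightarrow> complex"
  assumes [measurable]: "f \<in> borel_measurable borel"
  shows "(\<integral>x. f (- x) \<partial>lborel) = (\<integral>x. f x \<partial>lborel)"
proof -
  have "(\<integral>x. f x \<partial>lborel) = (\<integral>x. f x \<partial>distr lborel borel uminus)"
    by (simp only: lborel_distr_reflect)
  also have "\<dots> = (\<integral>x. f (- x) \<partial>lborel)" by (subst integral_distr) auto
  finally show ?thesis by simp
qed

lemma emeasure_cball_pos_finite:
  assumes "r > 0"
  shows "0 < emeasure lborel (cball (a::'a::euclidean_space) r)" "emeasure lborel (cball a r) < \<infinity>"
  using assms by (auto simp: emeasure_cball intro!: mult_pos_pos)

text \<open>As in the proof of uniqueness of Haar measure, the integral of \<open>f \<circ> T\<close> is compared with that of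
  \<open>f\<close> by convolving with the indicator of the unit ball, which \<open>T\<close> preserves.\<close>

lemma nn_integral_isometry:
  fixes f :: "'a::euclidean_space \<Rightarrow> ennreal" and T :: "'a \<Rightarrow> 'a"
  assumes f[measurable]: "f \<in> borel_measurable borel" and T: "linear T" and iso: "\<And>x. norm (T x) = norm x"
  shows "(\<integral>\<^sup>+x. f (T x) \<partial>lborel) = (\<integral>\<^sup>+x. f x \<partial>lborel)"
proof -
  have "bounded_linear T" using T linear_conv_bounded_linear by blast
  then have contT: "continuous_on UNIV T" by (simp add: linear_continuous_on)
  then have [measurable]: "T \<in> borel_measurable borel" by (rule borel_measurable_continuous_onI)
  have "inj T" using T iso by (metis linear_injective_0 norm_eq_zero)
  then have "surj T" using T linear_injective_imp_surjective by blast
  define g :: "'a \<Rightarrow> ennreal" where "g = indicator (cball 0 1)"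
  have [measurable]: "g \<in> borel_measurable borel"
    unfolding g_def by (intro borel_measurable_indicator) auto
  have grad: "g x = g y" if "norm x = norm y" for x y using that by (simp add: g_def indicator_def)
  let ?I = "\<integral>\<^sup>+x. g x \<partial>lborel"
  have "?I = emeasure lborel (cball (0::'a) 1)" by (simp add: g_def)
  then have I: "?I \<noteq> 0" "?I \<noteq> \<infinity>" using emeasure_cball_pos_finite[of 1 "0::'a"] by auto
  have "(\<integral>\<^sup>+x. f (T x) \<partial>lborel) * ?I = (\<integral>\<^sup>+y. (\<integral>\<^sup>+x. f (T x) * g y \<partial>lborel) \<partial>lborel)"
    by (simp add: nn_integral_multc nn_integral_cmult)
  \<comment> \<open>For fixed \<open>y = T a\<close>, translating \<open>x\<close> by
    \<open>a\<close> introduces the shift by \<open>y\<close> inside \<open>f\<close>.\<close>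
  also have "\<dots> = (\<integral>\<^sup>+y. (\<integral>\<^sup>+x. f (T x + y) * g y \<partial>lborel) \<partial>lborel)"
  proof (rule nn_integral_cong)
    fix y
    obtain a where a: "T a = y" using \<open>surj T\<close> by (metis surjD)
    have "(\<integral>\<^sup>+x. f (T (a + x)) * g y \<partial>lborel) = (\<integral>\<^sup>+x. f (T x) * g y \<partial>lborel)"
      by (rule nn_integral_translate[of "\<lambda>x. f (T x) * g y"]) simp
    then show "(\<integral>\<^sup>+x. f (T x) * g y \<partial>lborel) = (\<integral>\<^sup>+x. f (T x + y) * g y \<partial>lborel)"
      using T a by (simp add: linear_add add.commute)
  qed
  also have "\<dots> = (\<integral>\<^sup>+x. (\<integral>\<^sup>+y. f (T x + y) * g y \<partial>lborel) \<partial>lborel)"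
    by (rule lborel_pair.Fubini') simp
  also have "\<dots> = (\<integral>\<^sup>+x. (\<integral>\<^sup>+y. f y * g (y - T x) \<partial>lborel) \<partial>lborel)"
  proof (rule nn_integral_cong)
    fix x
    have "(\<integral>\<^sup>+y. f (T x + y) * g ((T x + y) - T x) \<partial>lborel) = (\<integral>\<^sup>+y. f y * g (y - T x) \<partial>lborel)"
      by (rule nn_integral_translate[of "\<lambda>y. f y * g (y - T x)"]) simp
    then show "(\<integral>\<^sup>+y. f (T x + y) * g y \<partial>lborel) = (\<integral>\<^sup>+y. f y * g (y - T x) \<partial>lborel)" by simp
  qed
  also have "\<dots> = (\<integral>\<^sup>+y. (\<integral>\<^sup>+x. f y * g (y - T x) \<partial>lborel) \<partial>lborel)"
    by (rule lborel_pair.Fubini') simp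
  also have "\<dots> = (\<integral>\<^sup>+y. f y * ?I \<partial>lborel)"
  proof (rule nn_integral_cong)
    fix y
    obtain a where a: "T a = y" using \<open>surj T\<close> by (metis surjD)
    \<comment> \<open>Here the isometry disappears: \<open>g\<close> is radial and
      \<open>y - T x = T (a - x)\<close>.\<close>
    have "g (y - T x) = g ((- a) + x)" for x
    proof (rule grad)
      have "y - T x = T (a - x)" using T a by (simp add: linear_diff)
      then show "norm (y - T x) = norm ((- a) + x)" using iso by (simp add: norm_minus_commute)
    qed
    then have "(\<integral>\<^sup>+x. f y * g (y - T x) \<partial>lborel) = f y * (\<integral>\<^sup>+x. g ((- a) + x) \<partial>lborel)"
      by (simp add: nn_integral_cmult)
    then show "(\<integral>\<^sup>+x. f y * g (y - T x) \<partial>lborel) = f y * ?I"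
      using nn_integral_translate[of g "- a"] by simp
  qed
  also have "\<dots> = (\<integral>\<^sup>+x. f x \<partial>lborel) * ?I" by (simp add: nn_integral_multc)
  finally show ?thesis using I by (metis ennreal_mult_divide_eq infinity_ennreal_def)
qed

lemma lborel_distr_isometry:
  fixes T :: "'a::euclidean_space \<Rightarrow> 'a"
  assumes T: "linear T" and iso: "\<And>x. norm (T x) = norm x"
  shows "distr lborel borel T = lborel"
proof -
  have "bounded_linear T" using T linear_conv_bounded_linear by blast
  then have "continuous_on UNIV T" by (simp add: linear_continuous_on)
  then have [measurable]: "T \<in> borel_measurable borel" by (rule borel_measurable_continuous_onI)
  show ?thesis
  proof (rule measure_eqI)
    fix A assume "A \<in> sets (distr lborel borel T)"
    then have A[measurable]: "A \<in> sets borel" by simp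
    have "emeasure (distr lborel borel T) A = (\<integral>\<^sup>+x. indicator A x \<partial>distr lborel borel T)" by simp
    also have "\<dots> = (\<integral>\<^sup>+x. indicator A (T x) \<partial>lborel)" by (rule nn_integral_distr) auto
    also have "\<dots> = (\<integral>\<^sup>+x. indicator A x \<partial>lborel)" by (rule nn_integral_isometry[OF _ T iso]) simp
    finally show "emeasure (distr lborel borel T) A = emeasure lborel A" by simp
  qed simp
qed

lemma integral_isometry:
  fixes f :: "'a::euclidean_space \<Rightarrow> complex" and T :: "'a \<Rightarrow> 'a"
  assumes [measurable]: "f \<in> borel_measurable borel" and T: "linear T" and iso: "\<And>x. norm (T x) = norm x"
  shows "(\<integral>x. f (T x) \<partial>lborel) = (\<integral>x. f x \<partial>lborel)"
proof -
  have "bounded_linear T" using T linear_conv_bounded_linear by blast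
  then have "continuous_on UNIV T" by (simp add: linear_continuous_on)
  then have [measurable]: "T \<in> borel_measurable borel" by (rule borel_measurable_continuous_onI)
  have "(\<integral>x. f x \<partial>lborel) = (\<integral>x. f x \<partial>distr lborel borel T)"
    by (simp only: lborel_distr_isometry[OF T iso])
  also have "\<dots> = (\<integral>x. f (T x) \<partial>lborel)" by (subst integral_distr) auto
  finally show ?thesis by simp
qed

text \<open>Diagonal matrices: both scalar rotations and the weighted circle action are of this
  form, and with unimodular entries they preserve Lebesgue measure.\<close>

definition dscale :: "('n \<Rightarrow> complex) \<Rightarrow> complex^'n \<Rightarrow> complex^'n::finite" where
  "dscale c x = (\<chi> j. c j * x $ j)"

lemma dscale_nth [simp]: "dscale c x $ j = c j * x $ j" by (simp add: dscale_def)

lemma linear_dscale: "linear (dscale c)"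
  by (rule linearI) (auto simp: vec_eq_iff algebra_simps)

lemma norm_dscale: "(\<And>j. norm (c j) = 1) \<Longrightarrow> norm (dscale c x) = norm x"
  by (simp add: norm_vec_def norm_mult)

lemma vector_scale_eq_dscale: "(c *s x) = dscale (\<lambda>_. c) (x :: complex^'n::finite)"
  by (simp add: vec_eq_iff)

lemma indicator_times_measurable:
  fixes f :: "'a::topological_space \<Rightarrow> complex"
  assumes "open A" "continuous_on A f"
  shows "(\<lambda>x. indicator A x *\<^sub>R f x) \<in> borel_measurable borel"
  using assms by (intro borel_measurable_continuous_on_indicator) auto

lemma integrable_continuous_bounded_support:
  fixes f :: "'a::euclidean_space \<Rightarrow> complex"
  assumes "continuous_on UNIV f" "\<And>x. norm x > R \<Longrightarrow> f x = 0"
  shows "integrable lborel f"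
proof -
  have "integrable lborel (\<lambda>x. indicator (cball 0 R) x *\<^sub>R f x)"
    using assms(1) by (intro borel_integrable_compact) (auto intro: continuous_on_subset)
  moreover have "(\<lambda>x. indicator (cball 0 R) x *\<^sub>R f x) = f"
    using assms(2) by (auto simp: indicator_def fun_eq_iff not_le)
  ultimately show ?thesis by simp
qed

text \<open>The integral of a translate of \<open>\<Phi>\<close> does not depend on the translation;
  differentiating this constant under the integral sign gives the claim.\<close>

lemma integral_derivative_bounded_support:
  fixes \<Phi> :: "'a::euclidean_space \<Rightarrow> complex"
  assumes d: "\<And>x. (\<Phi> has_derivative \<Phi>' x) (at x)" and bd: "\<And>x v. norm (\<Phi>' x v) \<le> B * norm v"
    and supp: "\<And>x. norm x > R \<Longrightarrow> \<Phi> x = 0"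
  shows "integrable lborel (\<lambda>x. \<Phi>' x v)" "(\<integral>x. \<Phi>' x v \<partial>lborel) = 0"
proof -
  have cont: "continuous_on UNIV \<Phi>"
    by (intro continuous_at_imp_continuous_on ballI has_derivative_continuous[OF d])
  define F where "F = (\<lambda>(z::'a) x. \<Phi> (z + x))"
  have B0: "B \<ge> 0"
  proof -
    obtain b :: 'a where "b \<in> Basis" using nonempty_Basis by blast
    then have "norm b = 1" by simp
    then show ?thesis using bd[of 0 b] order_trans[OF norm_ge_zero[of "\<Phi>' 0 b"]] by simp
  qed
  have eq: "(\<integral>x. F z x \<partial>lborel) = (\<integral>x. \<Phi> x \<partial>lborel)" for z
    unfolding F_def by (rule integral_translate) (rule borel_measurable_continuous_onI[OF cont])
  have int: "integrable lborel (F (0 + v))" if "v \<in> ball 0 1" for v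
  proof (rule integrable_continuous_bounded_support[of _ "R + 1"])
    show "continuous_on UNIV (F (0 + v))"
      unfolding F_def by (intro continuous_intros continuous_on_compose2[OF cont]) auto
    fix x :: 'a assume "norm x > R + 1"
    moreover have "norm v < 1" using that by simp
    ultimately have "norm (v + x) > R" using norm_triangle_ineq2[of x "- v"] by (simp add: add.commute)
    then show "F (0 + v) x = 0" using supp by (simp add: F_def)
  qed
  have der: "((\<lambda>z. F z x) has_derivative \<Phi>' x) (at 0)" for x
  proof -
    have "((\<lambda>z. z + x) has_derivative (\<lambda>v. v)) (at 0)" by (auto intro!: derivative_eq_intros)
    then show ?thesis
      unfolding F_def using has_derivative_compose[of "\<lambda>z. z + x" "\<lambda>v. v" 0 UNIV \<Phi> "\<Phi>' x"] d[of x] by simp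
  qed
  \<comment> \<open>Shifts by less than 1 keep the support within radius \<open>R + 1\<close>, so
    the Lipschitz bound may be cut off there and becomes integrable.\<close>
  have lip: "norm (F (0 + v) x - F 0 x) \<le> (B * indicator (cball 0 (R + 1)) x) * norm v" if v: "v \<in> ball 0 1" for x v
  proof (cases "x \<in> cball 0 (R + 1)")
    case True
    have "norm (\<Phi> (v + x) - \<Phi> x) \<le> B * norm (v + x - x)"
    proof (rule differentiable_bound[of UNIV \<Phi> \<Phi>'])
      show "onorm (\<Phi>' y) \<le> B" for y using bd B0 by (intro onorm_bound) auto
    qed (use d in auto)
    then show ?thesis using True by (simp add: F_def)
  next
    case False
    then have "norm x > R + 1" by simp
    moreover have "norm v < 1" using v by simp
    ultimately have "norm (v + x) > R" "norm x > R" using norm_triangle_ineq2[of x "- v"] by (simp_all add: add.commute)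
    then show ?thesis using supp by (simp add: F_def B0)
  qed
  have Bint: "integrable lborel (\<lambda>x::'a. B * indicator (cball 0 (R + 1)) x)"
    using emeasure_bounded_finite[of "cball (0::'a) (R+1)"] by (intro integrable_mult_right integrable_real_indicator) auto
  note D = derivative_lebesgue_integral[of 1 lborel F 0 \<Phi>' "\<lambda>x. B * indicator (cball 0 (R + 1)) x"]
  show "integrable lborel (\<lambda>x. \<Phi>' x v)"
    by (rule D(1)) (use int der lip Bint in auto)
  have "((\<lambda>z. \<integral>x. F z x \<partial>lborel) has_derivative (\<lambda>v. \<integral>x. \<Phi>' x v \<partial>lborel)) (at 0)"
    by (rule D(2)) (use int der lip Bint in auto)
  then have "((\<lambda>z::'a. \<integral>x. \<Phi> x \<partial>lborel) has_derivative (\<lambda>v. \<integral>x. \<Phi>' x v \<partial>lborel)) (at 0)"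
    unfolding eq .
  moreover have "((\<lambda>z::'a. \<integral>x. \<Phi> x \<partial>lborel) has_derivative (\<lambda>v. 0)) (at 0)"
    by (rule has_derivative_const)
  ultimately have "(\<lambda>v. \<integral>x. \<Phi>' x v \<partial>lborel) = (\<lambda>v. 0)" by (rule has_derivative_unique)
  then show "(\<integral>x. \<Phi>' x v \<partial>lborel) = 0" by metis
qed

section \<open>Radial bump functions and the mean value property\<close>

definition bump0 :: "real \<Rightarrow> 'a::euclidean_space \<Rightarrow> real" where
  "bump0 e x = (max 0 (e\<^sup>2 - x \<bullet> x))\<^sup>2"

definition bump :: "real \<Rightarrow> 'a::euclidean_space \<Rightarrow> real" where
  "bump e x = bump0 e x / integral\<^sup>L lborel (bump0 e :: 'a \<Rightarrow> real)"

definition bump_deriv :: "real \<Rightarrow> 'a::euclidean_space \<Rightarrow> 'a \<Rightarrow> real" where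
  "bump_deriv e x v = - 4 * max 0 (e\<^sup>2 - x \<bullet> x) * (x \<bullet> v) / integral\<^sup>L lborel (bump0 e :: 'a \<Rightarrow> real)"

text \<open>Squaring removes the corner of the truncation at 0. The bumps are thereby continuously
  differentiable, which is all the smoothness that one integration by parts consumes.\<close>

lemma max_square_deriv: "((\<lambda>s::real. (max 0 s)\<^sup>2) has_field_derivative 2 * max 0 s) (at s)"
proof -
  consider "s > 0" | "s < 0" | "s = 0" by linarith
  then show ?thesis
  proof cases
    case 1
    have "((\<lambda>s::real. s\<^sup>2) has_field_derivative 2 * s) (at s)" by (auto intro!: derivative_eq_intros)
    then have "((\<lambda>s::real. (max 0 s)\<^sup>2) has_field_derivative 2 * s) (at s)"
      by (rule has_field_derivative_transform_within_open[of _ _ _ "{0<..}"]) (use 1 in auto)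
    then show ?thesis using 1 by simp
  next
    case 2
    have "((\<lambda>s::real. 0) has_field_derivative 0) (at s)" by simp
    then have "((\<lambda>s::real. (max 0 s)\<^sup>2) has_field_derivative 0) (at s)"
      by (rule has_field_derivative_transform_within_open[of _ _ _ "{..<0}"]) (use 2 in auto)
    then show ?thesis using 2 by simp
  next
    case 3
    have "(\<lambda>h::real. (max 0 h)\<^sup>2 / h) \<midarrow>0\<rightarrow> 0"
    proof (rule Lim_null_comparison)
      show "\<forall>\<^sub>F h in at (0::real). norm ((max 0 h)\<^sup>2 / h) \<le> \<bar>h\<bar>"
        by (rule always_eventually) (auto simp: power2_eq_square max_def)
      show "(\<lambda>h::real. \<bar>h\<bar>) \<midarrow>0\<rightarrow> 0" by (auto intro!: tendsto_eq_intros)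
    qed
    then show ?thesis using 3 by (simp add: DERIV_def)
  qed
qed

context
  fixes e :: real assumes e: "e > 0"
begin

lemma continuous_bump0: "continuous_on S (bump0 e)"
  unfolding bump0_def by (intro continuous_intros)

lemma bump0_zero: "e \<le> norm x \<Longrightarrow> bump0 e x = 0"
proof -
  assume "e \<le> norm x"
  then have "e\<^sup>2 \<le> x \<bullet> x" using e by (simp add: dot_square_norm power_mono)
  then show ?thesis by (simp add: bump0_def)
qed

lemma bump0_bounds: "0 \<le> bump0 e x" "bump0 e x \<le> e ^ 4"
proof -
  have "max 0 (e\<^sup>2 - x \<bullet> x) \<le> e\<^sup>2" by simp
  then have "(max 0 (e\<^sup>2 - x \<bullet> x))\<^sup>2 \<le> (e\<^sup>2)\<^sup>2" by (intro power_mono) auto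
  then show "0 \<le> bump0 e x" "bump0 e x \<le> e ^ 4" by (simp_all add: bump0_def)
qed

lemma integrable_bump0: "integrable lborel (bump0 e :: 'a::euclidean_space \<Rightarrow> real)"
proof -
  have "integrable lborel (\<lambda>x::'a. indicator (cball 0 e) x *\<^sub>R bump0 e x)"
    by (intro borel_integrable_compact continuous_bump0) auto
  moreover have "(\<lambda>x::'a. indicator (cball 0 e) x *\<^sub>R bump0 e x) = bump0 e"
    by (auto simp: indicator_def fun_eq_iff not_le bump0_zero)
  ultimately show ?thesis by simp
qed

lemma integral_bump0_pos: "0 < integral\<^sup>L lborel (bump0 e :: 'a::euclidean_space \<Rightarrow> real)"
proof -
  have fin: "emeasure lborel (cball (0::'a) (e/2)) < \<infinity>" using e by (intro emeasure_cball_pos_finite) simp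
  \<comment> \<open>On the ball of half the radius \<open>e\<^sup>2 - x \<bullet> x\<close> is at
    least \<open>e\<^sup>2 - (e/2)\<^sup>2\<close>, which is
    \<open>3 * e\<^sup>2 / 4\<close>.\<close>
  have "(3 * e\<^sup>2 / 4)\<^sup>2 * indicator (cball 0 (e/2)) x \<le> bump0 e x" for x :: 'a
  proof (cases "x \<in> cball 0 (e/2)")
    case True
    then have "x \<bullet> x \<le> (e/2)\<^sup>2" by (simp add: dot_square_norm power_mono)
    then have "3 * e\<^sup>2 / 4 \<le> e\<^sup>2 - x \<bullet> x" by (simp add: power_divide)
    then have "3 * e\<^sup>2 / 4 \<le> max 0 (e\<^sup>2 - x \<bullet> x)" by (simp add: le_max_iff_disj)
    then have "(3 * e\<^sup>2 / 4)\<^sup>2 \<le> (max 0 (e\<^sup>2 - x \<bullet> x))\<^sup>2" by (intro power_mono) auto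
    then show ?thesis using True by (simp add: bump0_def)
  qed (auto simp: bump0_bounds)
  then have "(\<integral>x. (3 * e\<^sup>2 / 4)\<^sup>2 * indicator (cball (0::'a) (e/2)) x \<partial>lborel) \<le> integral\<^sup>L lborel (bump0 e :: 'a \<Rightarrow> real)"
    using fin by (intro integral_mono integrable_bump0 integrable_mult_right integrable_real_indicator) auto
  moreover have "(\<integral>x. (3 * e\<^sup>2 / 4)\<^sup>2 * indicator (cball (0::'a) (e/2)) x \<partial>lborel) = (3 * e\<^sup>2 / 4)\<^sup>2 * measure lborel (cball (0::'a) (e/2))"
    by simp
  moreover have "measure lborel (cball (0::'a) (e/2)) > 0"
    using emeasure_cball_pos_finite[of "e/2" "0::'a"] e by (simp add: measure_def enn2real_positive_iff)
  ultimately show ?thesis using e by (smt (verit) zero_less_power mult_pos_pos divide_pos_pos)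
qed

lemma bump_nonneg: "0 \<le> bump e x"
  unfolding bump_def using bump0_bounds integral_bump0_pos by (intro divide_nonneg_pos)

lemma bump_zero: "e \<le> norm x \<Longrightarrow> bump e x = 0"
  unfolding bump_def by (simp add: bump0_zero)

lemma bump_bound: "\<exists>B>0. \<forall>x::'a::euclidean_space. bump e x \<le> B"
  using bump0_bounds integral_bump0_pos[where 'a='a] e unfolding bump_def
  by (intro exI[of _ "e^4 / integral\<^sup>L lborel (bump0 e :: 'a \<Rightarrow> real)"]) (auto intro!: divide_right_mono)

lemma continuous_bump: "continuous_on S f \<Longrightarrow> continuous_on S (\<lambda>x. bump e (f x))"
  unfolding bump_def
  by (intro continuous_on_divide continuous_on_const continuous_on_compose2[OF continuous_bump0[of UNIV]])
     (auto simp: less_imp_neq[OF integral_bump0_pos, symmetric])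

lemma bump_measurable [measurable]: "bump e \<in> borel_measurable borel"
  by (rule borel_measurable_continuous_onI, rule continuous_bump, rule continuous_on_id)

lemma integrable_bump: "integrable lborel (bump e :: 'a::euclidean_space \<Rightarrow> real)"
  unfolding bump_def by (intro integrable_divide_zero integrable_bump0)

lemma integral_bump: "integral\<^sup>L lborel (bump e :: 'a::euclidean_space \<Rightarrow> real) = 1"
  unfolding bump_def using integral_bump0_pos[where 'a='a] by simp

lemma bump_radial: "norm (x :: 'a::euclidean_space) = norm (y :: 'a) \<Longrightarrow> bump e x = bump e y"
  unfolding bump_def by (simp add: bump0_def[of e x] bump0_def[of e y] dot_square_norm)

lemma bump_has_derivative: "(bump e has_derivative bump_deriv e x) (at x)"
proof -
  have "((\<lambda>x. e\<^sup>2 - x \<bullet> x) has_derivative (\<lambda>v. - (2 * (x \<bullet> v)))) (at x)"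
    by (auto intro!: derivative_eq_intros simp: inner_commute)
  from has_derivative_compose[OF this max_square_deriv[unfolded has_field_derivative_def]]
  have "(bump0 e has_derivative (\<lambda>v. 2 * max 0 (e\<^sup>2 - x \<bullet> x) * (- (2 * (x \<bullet> v))))) (at x)"
    by (simp add: bump0_def[abs_def])
  then have "((\<lambda>x. bump0 e x / integral\<^sup>L lborel (bump0 e :: 'a \<Rightarrow> real)) has_derivative
     (\<lambda>v. 2 * max 0 (e\<^sup>2 - x \<bullet> x) * (- (2 * (x \<bullet> v))) / integral\<^sup>L lborel (bump0 e :: 'a \<Rightarrow> real))) (at x)"
    by (rule bounded_linear.has_derivative[OF bounded_linear_divide])
  then show ?thesis
    by (simp add: bump_def[abs_def] bump_deriv_def[abs_def] mult.assoc)
qed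

lemma bump_deriv_bound: "\<exists>B>0. \<forall>(x::'a::euclidean_space) v. \<bar>bump_deriv e x v\<bar> \<le> B * norm v"
proof -
  let ?I = "integral\<^sup>L lborel (bump0 e :: 'a \<Rightarrow> real)"
  have I: "?I > 0" by (rule integral_bump0_pos)
  have "\<bar>bump_deriv e x v\<bar> \<le> (4 * e\<^sup>2 * e / ?I) * norm v" for x v :: 'a
  proof (cases "norm x \<le> e")
    case True
    have "\<bar>x \<bullet> v\<bar> \<le> norm x * norm v" by (rule Cauchy_Schwarz_ineq2)
    also have "\<dots> \<le> e * norm v" using True by (intro mult_right_mono) auto
    finally have "\<bar>4 * max 0 (e\<^sup>2 - x \<bullet> x)\<bar> * \<bar>x \<bullet> v\<bar> \<le> (4 * e\<^sup>2) * (e * norm v)"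
      by (intro mult_mono) auto
    then have "\<bar>- 4 * max 0 (e\<^sup>2 - x \<bullet> x) * (x \<bullet> v)\<bar> \<le> 4 * e\<^sup>2 * e * norm v"
      by (simp add: abs_mult mult_ac)
    then have "\<bar>- 4 * max 0 (e\<^sup>2 - x \<bullet> x) * (x \<bullet> v)\<bar> / ?I \<le> 4 * e\<^sup>2 * e * norm v / ?I"
      using I by (intro divide_right_mono) auto
    then show ?thesis using I by (simp add: bump_deriv_def abs_divide)
  next
    case False
    then have "e\<^sup>2 \<le> x \<bullet> x" using e by (simp add: dot_square_norm power_mono)
    then show ?thesis using I e by (simp add: bump_deriv_def)
  qed
  then show ?thesis using I e by (intro exI[of _ "4 * e\<^sup>2 * e / ?I"]) auto
qed

lemma continuous_bump_deriv: "continuous_on S f \<Longrightarrow> continuous_on S (\<lambda>x. bump_deriv e (f x) v)"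
  unfolding bump_deriv_def
  by (intro continuous_intros) (auto simp: less_imp_neq[OF integral_bump0_pos, symmetric])

text \<open>Lebesgue measure and the bump are invariant under multiplication by unimodular scalars.
  Averaging over these first, the one-variable mean value property on each complex line through
  \<open>w\<close> replaces \<open>h\<close> by \<open>h w\<close>; the bump has integral 1.\<close>

lemma hol_mean_value:
  fixes h :: "complex^'n::finite \<Rightarrow> complex"
  assumes h: "holomorphic_fun_on h S" and S: "open S" "cball w e \<subseteq> S"
  shows "(\<integral>x. indicator (ball 0 e) x *\<^sub>R (h (w + x) * of_real (bump e x)) \<partial>lborel) = h w"
proof -
  define k where "k = (\<lambda>x. indicator (ball 0 e) x *\<^sub>R (h (w + x) * of_real (bump e x)))"
  let ?k = "\<lambda>t x. indicator (ball 0 e) x *\<^sub>R (h (w + unit_circle t *s x) * of_real (bump e x))"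
  have inS: "w + unit_circle t *s x \<in> cball w e" if "x \<in> ball 0 e" for t x
    using that by (simp add: dist_norm)
  have inS0: "w + x \<in> S" if "x \<in> ball 0 e" for x
    using that S by (auto simp: subset_eq dist_norm)
  have kmeas: "k \<in> borel_measurable borel"
    unfolding k_def using inS0
    by (intro indicator_times_measurable) (auto intro!: continuous_intros continuous_bump continuous_on_compose2[OF hol_continuous[OF h]])
  obtain B where B: "\<And>x. x \<in> cball w e \<Longrightarrow> norm (h x) \<le> B"
    using hol_bounded_cball[OF h S(2)] by blast
  have B0: "B \<ge> 0" using B[of w] e norm_ge_zero[of "h w"] by (metis centre_in_cball less_imp_le order_trans)
  have rot: "(\<integral>x. ?k t x \<partial>lborel) = (\<integral>x. k x \<partial>lborel)" for t
  proof -
    have "(\<integral>x. k (dscale (\<lambda>_. unit_circle t) x) \<partial>lborel) = (\<integral>x. k x \<partial>lborel)"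
      by (rule integral_isometry[OF kmeas linear_dscale norm_dscale]) simp
    moreover have "k (dscale (\<lambda>_. unit_circle t) x) = ?k t x" for x
    proof -
      have "norm (unit_circle t *s x) = norm x" by simp
      then have "bump e (unit_circle t *s x) = bump e x" by (rule bump_radial)
      then show ?thesis unfolding k_def vector_scale_eq_dscale[symmetric] by (simp add: indicator_def)
    qed
    ultimately show ?thesis by simp
  qed
  interpret C: finite_measure circle_measure by (rule finite_measure_circle)
  interpret P: pair_sigma_finite circle_measure "lborel :: (complex^'n) measure" ..
  have meas: "(\<lambda>(t,x). ?k t x) \<in> borel_measurable (circle_measure \<Otimes>\<^sub>M lborel)"
  proof -
    have "(\<lambda>p. indicator (UNIV \<times> ball 0 e) p *\<^sub>R (h (w + unit_circle (fst p) *s snd p) * of_real (bump e (snd p))))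
        \<in> borel_measurable (borel :: (real \<times> (complex^'n)) measure)"
      using inS S(2)
      by (intro indicator_times_measurable)
         (auto intro!: open_Times continuous_intros continuous_bump continuous_on_compose2[OF hol_continuous[OF h]])
    moreover have "(\<lambda>p. indicator (UNIV \<times> ball 0 e) p *\<^sub>R (h (w + unit_circle (fst p) *s snd p) * of_real (bump e (snd p))))
       = (\<lambda>(t,x). ?k t x)"
      by (auto simp: indicator_def fun_eq_iff)
    ultimately show ?thesis
      by (simp add: borel_prod[symmetric] cong: measurable_cong_sets sets_pair_measure_cong)
  qed
  have kb: "norm (?k t x) \<le> B * bump e x" for t x
    using B[OF inS] B0 by (auto simp: indicator_def norm_mult bump_nonneg intro!: mult_right_mono)
  have int: "integrable (circle_measure \<Otimes>\<^sub>M lborel) (\<lambda>(t,x). ?k t x)"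
  proof (rule P.Fubini_integrable[OF meas])
    have kt: "integrable lborel (?k t)" for t
    proof (rule Bochner_Integration.integrable_bound[of _ "\<lambda>x. B * bump e x"])
      show "integrable lborel (\<lambda>x::complex^'n. B * bump e x)" by (intro integrable_mult_right integrable_bump)
      show "?k t \<in> borel_measurable lborel"
        using measurable_compose[OF measurable_Pair1'[of t circle_measure lborel] meas] by simp
    qed (use kb B0 in \<open>auto simp: abs_mult bump_nonneg\<close>)
    show "AE t in circle_measure. integrable lborel (\<lambda>x. case (t, x) of (t, x) \<Rightarrow> ?k t x)" using kt by simp
    have nm: "norm (\<integral>x. norm (?k t x) \<partial>lborel) \<le> B" for t
    proof -
      have "(\<integral>x. norm (?k t x) \<partial>lborel) \<le> (\<integral>x. B * bump e x \<partial>(lborel :: (complex^'n) measure))"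
        by (intro integral_mono integrable_norm kt integrable_mult_right integrable_bump kb)
      also have "\<dots> = B" using integral_bump[where 'a="complex^'n"] by simp
      finally show ?thesis by (simp add: integral_nonneg)
    qed
    have "integrable circle_measure (\<lambda>t. \<integral>x. norm (?k t x) \<partial>lborel)"
    proof (rule C.integrable_const_bound[of _ B])
      have "(\<lambda>t. \<integral>x. norm (case (t,x) of (t,x) \<Rightarrow> ?k t x) \<partial>lborel) \<in> borel_measurable circle_measure"
        using lborel.borel_measurable_lebesgue_integral[of "\<lambda>t x. norm (case (t,x) of (t,x) \<Rightarrow> ?k t x)" circle_measure]
          measurable_compose[OF meas borel_measurable_norm] by (simp add: case_prod_beta')
      then show "(\<lambda>t. \<integral>x. norm (?k t x) \<partial>lborel) \<in> borel_measurable circle_measure" by simp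
    qed (use nm in auto)
    then show "integrable circle_measure (\<lambda>t. \<integral>x. norm (case (t, x) of (t, x) \<Rightarrow> ?k t x) \<partial>lborel)" by simp
  qed
  have "(\<integral>x. k x \<partial>lborel) = (\<integral>t. (\<integral>x. k x \<partial>lborel) \<partial>circle_measure)"
    by (simp only: circle_integral_const)
  also have "\<dots> = (\<integral>t. (\<integral>x. ?k t x \<partial>lborel) \<partial>circle_measure)" by (simp only: rot)
  also have "\<dots> = (\<integral>x. (\<integral>t. ?k t x \<partial>circle_measure) \<partial>lborel)"
    using P.Fubini_integral[OF int] by simp
  also have "\<dots> = (\<integral>x. h w * of_real (bump e x) \<partial>(lborel :: (complex^'n) measure))"
  proof (rule Bochner_Integration.integral_cong[OF refl])
    fix x :: "complex^'n"
    show "(\<integral>t. ?k t x \<partial>circle_measure) = h w * of_real (bump e x)"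
    proof (cases "x \<in> ball 0 e")
      case True
      have "integral\<^sup>L circle_measure (\<lambda>t. h (w + (of_real 1 * unit_circle t) *s x)) = h (w + 0 *s x)"
      proof (rule circle_mean[OF hol_line[OF S(1) h] open_line_preimage[OF S(1)]])
        show "cball 0 1 \<subseteq> {t. w + t *s x \<in> S}"
        proof
          fix t :: complex assume "t \<in> cball 0 1"
          then have "norm t * norm x \<le> 1 * e" using True by (intro mult_mono) auto
          then have "w + t *s x \<in> cball w e" by (simp add: dist_norm)
          then show "t \<in> {t. w + t *s x \<in> S}" using S by blast
        qed
      qed simp
      then show ?thesis using True by simp
    next
      case False
      then show ?thesis using bump_zero[of x] by simp
    qed
  qed
  also have "\<dots> = h w * (\<integral>x. complex_of_real (bump e x) \<partial>(lborel :: (complex^'n) measure))" by simp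
  also have "\<dots> = h w"
    unfolding integral_of_real by (simp add: integral_bump)
  finally show ?thesis by (simp add: k_def)
qed

end

section \<open>Jacobian determinants and the Piola identity\<close>

text \<open>Cofactors without minors: replacing row \<open>j\<close> by a unit vector gives the
  signed minor while all indices stay in the type \<open>'n\<close>.\<close>

definition adjugate :: "'a::comm_ring_1^'n^'n \<Rightarrow> 'a^'n^'n::finite" where
  "adjugate A = (\<chi> i j. det (\<chi> k. if k = j then axis i 1 else A $ k))"

lemma det_row_expand:
  fixes A :: "'a::comm_ring_1^'n^'n::finite"
  shows "det (\<chi> l. if l = j then v else A $ l) = (\<Sum>k\<in>UNIV. v $ k * det (\<chi> l. if l = j then axis k 1 else A $ l))"
proof -
  have v: "(\<Sum>k\<in>UNIV. v $ k *s axis k 1) = v" by (rule basis_expansion)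
  have "det (\<chi> l. if l = j then v else A $ l) = det (\<chi> l. if l = j then (\<Sum>k\<in>UNIV. v $ k *s axis k 1) else A $ l)"
    by (simp only: v)
  also have "\<dots> = (\<Sum>k\<in>UNIV. det (\<chi> l. if l = j then v $ k *s axis k 1 else A $ l))"
    by (rule det_linear_row_sum[OF finite])
  also have "\<dots> = (\<Sum>k\<in>UNIV. v $ k * det (\<chi> l. if l = j then axis k 1 else A $ l))"
    by (simp only: det_row_mul)
  finally show ?thesis .
qed

text \<open>The sum is the expansion of the determinant in which row \<open>j\<close> is replaced by
  row \<open>i\<close>; unless \<open>i = j\<close> this has two equal rows.\<close>

lemma mult_adjugate:
  fixes A :: "'a::comm_ring_1^'n^'n::finite"
  shows "(\<Sum>k\<in>UNIV. A $ i $ k * adjugate A $ k $ j) = (if i = j then det A else 0)"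
proof -
  have "(\<Sum>k\<in>UNIV. A $ i $ k * adjugate A $ k $ j) = det (\<chi> l. if l = j then A $ i else A $ l)"
    unfolding adjugate_def det_row_expand[of j "A $ i" A] by simp
  also have "\<dots> = (if i = j then det A else 0)"
  proof (cases "i = j")
    case True
    then have "(\<chi> l. if l = j then A $ i else A $ l) = A" by (simp add: vec_eq_iff)
    then show ?thesis using True by simp
  next
    case False
    then show ?thesis
      by (auto intro!: det_identical_rows[of i j] simp: row_def)
  qed
  finally show ?thesis .
qed

lemma has_derivative_det:
  fixes M :: "'b::real_normed_vector \<Rightarrow> complex^'n^'n::finite"
  assumes "\<And>l k. ((\<lambda>z. M z $ l $ k) has_derivative M' l k) (at z)"
  shows "((\<lambda>z. det (M z)) has_derivative
     (\<lambda>v. \<Sum>l\<in>UNIV. det (\<chi> i. if i = l then (\<chi> k. M' l k v) else M z $ i))) (at z)"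
proof -
  have eq: "(\<Sum>l\<in>UNIV. det (\<chi> i. if i = l then (\<chi> k. M' l k v) else M z $ i)) =
     (\<Sum>p | p permutes UNIV. of_int (sign p) * (\<Sum>l\<in>UNIV. M' l (p l) v * (\<Prod>j\<in>UNIV - {l}. M z $ j $ p j)))" for v
  proof -
    have "(\<Prod>i\<in>UNIV. (\<chi> i. if i = l then (\<chi> k. M' l k v) else M z $ i) $ i $ p i) =
       M' l (p l) v * (\<Prod>j\<in>UNIV - {l}. M z $ j $ p j)" for l and p :: "'n \<Rightarrow> 'n"
    proof -
      have "(\<Prod>i\<in>UNIV. (\<chi> i. if i = l then (\<chi> k. M' l k v) else M z $ i) $ i $ p i) =
        (\<chi> i. if i = l then (\<chi> k. M' l k v) else M z $ i) $ l $ p l *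
        (\<Prod>i\<in>UNIV - {l}. (\<chi> i. if i = l then (\<chi> k. M' l k v) else M z $ i) $ i $ p i)"
        by (rule prod.remove) auto
      also have "(\<Prod>i\<in>UNIV - {l}. (\<chi> i. if i = l then (\<chi> k. M' l k v) else M z $ i) $ i $ p i) =
         (\<Prod>j\<in>UNIV - {l}. M z $ j $ p j)"
        by (rule prod.cong) auto
      finally show ?thesis by simp
    qed
    then show ?thesis
      unfolding det_def by (subst sum.swap) (simp add: sum_distrib_left)
  qed
  have "((\<lambda>z. \<Sum>p | p permutes (UNIV::'n set). of_int (sign p) * (\<Prod>i\<in>UNIV. M z $ i $ p i)) has_derivative
    (\<lambda>v. \<Sum>p | p permutes (UNIV::'n set). of_int (sign p) * (\<Sum>l\<in>UNIV. M' l (p l) v * (\<Prod>j\<in>UNIV - {l}. M z $ j $ p j)))) (at z)"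
    by (intro has_derivative_sum has_derivative_mult_right has_derivative_prod assms)
  then show ?thesis unfolding eq unfolding det_def .
qed

text \<open>The derivative \<open>L\<close> may come from real calculus rules; uniqueness of
  derivatives makes it complex linear.\<close>

lemma partial_of_derivative:
  assumes g: "holomorphic_fun_on g S" "open S" "z \<in> S" and L: "(g has_derivative L) (at z)"
  shows "partial i g z = L (axis i 1)"
proof -
  have "L = (\<lambda>v. \<Sum>i\<in>UNIV. v $ i * partial i g z)"
    using has_derivative_unique[OF L hol_has_derivative[OF g]] .
  then have "complex_linear L" using complex_linear_sum_form[of "\<lambda>i. partial i g z"] by simp
  then show ?thesis using partial_eq[OF L] by simp
qed

lemma hol_det:
  fixes M :: "complex^'m::finite \<Rightarrow> complex^'n^'n::finite"
  assumes "open S" "\<And>l k. holomorphic_fun_on (\<lambda>z. M z $ l $ k) S"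
  shows "holomorphic_fun_on (\<lambda>z. det (M z)) S"
  unfolding det_def by (intro hol_sum hol_mult hol_const hol_prod assms)

definition cjacobian :: "(complex^'n \<Rightarrow> complex^'n) \<Rightarrow> complex^'n \<Rightarrow> complex^'n^'n::finite" where
  "cjacobian f z = (\<chi> l k. partial k (\<lambda>z. f z $ l) z)"

lemma hol_jacobian:
  assumes "holomorphic_map_on f S" "open S"
  shows "holomorphic_fun_on (\<lambda>z. cjacobian f z $ l $ k) S"
  using assms hol_map_components[OF assms(2)] by (auto simp: cjacobian_def intro!: hol_partial)

lemma hol_jacobian_det:
  assumes "holomorphic_map_on f S" "open S"
  shows "holomorphic_fun_on (\<lambda>z. det (cjacobian f z)) S"
  using assms by (intro hol_det hol_jacobian)

lemma hol_adjugate_jacobian: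
  assumes "holomorphic_map_on f S" "open S"
  shows "holomorphic_fun_on (\<lambda>z. adjugate (cjacobian f z) $ i $ j) S"
proof -
  have "holomorphic_fun_on (\<lambda>z. det (\<chi> k. if k = j then axis i 1 else cjacobian f z $ k)) S"
  proof (rule hol_det[OF assms(2)])
    show "holomorphic_fun_on (\<lambda>z. (\<chi> k. if k = j then axis i 1 else cjacobian f z $ k) $ l $ k) S" for l k
      using hol_jacobian[OF assms] hol_const[OF assms(2)] by (cases "l = j") auto
  qed
  then show ?thesis by (simp add: adjugate_def)
qed

lemma jacobian_has_derivative:
  assumes "holomorphic_map_on f S" "open S" "z \<in> S"
  shows "(f has_derivative (\<lambda>v. cjacobian f z *v v)) (at z)"
proof -
  have "((\<lambda>z. f z $ l) has_derivative (\<lambda>v. \<Sum>i\<in>UNIV. v $ i * partial i (\<lambda>z. f z $ l) z)) (at z)" for l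
    using assms hol_map_components by (intro hol_has_derivative) auto
  from has_derivative_vec_complex[of "\<lambda>l z. f z $ l", OF this]
  have "(f has_derivative (\<lambda>v. \<chi> l. \<Sum>i\<in>UNIV. v $ i * partial i (\<lambda>z. f z $ l) z)) (at z)" by simp
  moreover have "(\<lambda>v. \<chi> l. \<Sum>i\<in>UNIV. v $ i * partial i (\<lambda>z. f z $ l) z) = (\<lambda>v. cjacobian f z *v v)"
    by (simp add: fun_eq_iff vec_eq_iff cjacobian_def matrix_vector_mult_def mult.commute)
  ultimately show ?thesis by simp
qed

text \<open>The second derivatives of \<open>f\<close> are symmetric in the indices \<open>i\<close>, \<open>k\<close> in which the remaining
  determinants are antisymmetric.\<close>

lemma piola_identity:
  fixes f :: "complex^'n::finite \<Rightarrow> complex^'n"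
  assumes f: "holomorphic_map_on f S" and S: "open S" and z: "z \<in> S"
  shows "(\<Sum>i\<in>UNIV. partial i (\<lambda>z. adjugate (cjacobian f z) $ i $ j) z) = 0"
proof -
  let ?J = "cjacobian f"
  define H where "H = (\<lambda>l i k. partial i (partial k (\<lambda>z. f z $ l)) z)"
  have Hsym: "H l i k = H l k i" for l i k
    unfolding H_def using f hol_map_components[OF S] by (intro partial_commute[OF _ S z]) auto
  \<comment> \<open>Second-order cofactors: row \<open>j\<close> holds the unit vector of the
    adjugate, row \<open>l\<close> the one from expanding the differentiated row. Exchanging
    \<open>i\<close> and \<open>k\<close> amounts to swapping these two rows.\<close>
  define T where "T = (\<lambda>l i k. det (\<chi> m. if m = l then axis k 1 else if m = j then axis i 1 else ?J z $ m))"
  have Tanti: "T l i k = - T l k i" if "l \<noteq> j" for l i k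
  proof -
    let ?A = "\<chi> m. if m = l then axis i 1 else if m = j then axis k 1 else ?J z $ m"
    have "det (\<chi> m. ?A $ Transposition.transpose l j m) = of_int (sign (Transposition.transpose l j)) * det ?A"
      by (rule det_permute_rows) (simp add: permutes_swap_id)
    moreover have "(\<chi> m. ?A $ Transposition.transpose l j m) =
       (\<chi> m. if m = l then axis k 1 else if m = j then axis i 1 else ?J z $ m)"
      using that by (auto simp: vec_eq_iff transpose_def)
    ultimately show ?thesis using that by (simp add: T_def sign_swap_id)
  qed
  have "partial i (\<lambda>z. adjugate (?J z) $ i $ j) z = (\<Sum>l\<in>UNIV - {j}. \<Sum>k\<in>UNIV. H l i k * T l i k)" for i
  proof -
    define M where "M = (\<lambda>z. \<chi> m. if m = j then axis i 1 else ?J z $ m)"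
    define M' where "M' = (\<lambda>l k v. if l = j then 0 else \<Sum>m\<in>UNIV. v $ m * partial m (partial k (\<lambda>z. f z $ l)) z)"
    have dM: "((\<lambda>z. M z $ l $ k) has_derivative M' l k) (at z)" for l k
    proof (cases "l = j")
      case True
      then show ?thesis by (simp add: M_def M'_def)
    next
      case False
      have "holomorphic_fun_on (partial k (\<lambda>z. f z $ l)) S"
        using f hol_map_components[OF S] by (intro hol_partial[OF _ S]) auto
      from hol_has_derivative[OF this S z] show ?thesis
        using False by (simp add: M_def M'_def cjacobian_def)
    qed
    have "partial i (\<lambda>z. adjugate (?J z) $ i $ j) z =
       (\<Sum>l\<in>UNIV. det (\<chi> m. if m = l then (\<chi> k. M' l k (axis i 1)) else M z $ m))"
    proof (rule partial_of_derivative[OF hol_adjugate_jacobian[OF f S] S z])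
      show "((\<lambda>z. adjugate (?J z) $ i $ j) has_derivative
        (\<lambda>v. \<Sum>l\<in>UNIV. det (\<chi> m. if m = l then (\<chi> k. M' l k v) else M z $ m))) (at z)"
        using has_derivative_det[of M M' z, OF dM] by (simp add: adjugate_def M_def)
    qed
    also have "\<dots> = (\<Sum>l\<in>UNIV - {j}. det (\<chi> m. if m = l then (\<chi> k. M' l k (axis i 1)) else M z $ m))"
    proof -
      have "det (\<chi> m. if m = j then (\<chi> k. M' j k (axis i 1)) else M z $ m) = 0"
        by (rule det_zero_row(1)[of j]) (simp add: row_def vec_eq_iff M'_def)
      then show ?thesis by (subst sum.remove[of _ j]) auto
    qed
    also have "\<dots> = (\<Sum>l\<in>UNIV - {j}. \<Sum>k\<in>UNIV. H l i k * T l i k)"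
    proof (rule sum.cong[OF refl])
      fix l assume "l \<in> UNIV - {j}"
      then have l: "l \<noteq> j" by simp
      have "M' l k (axis i 1) = H l i k" for k
      proof -
        have "axis i 1 $ m * c = (if m = i then c else 0)" for m and c :: complex
          by (simp add: axis_def)
        then have "M' l k (axis i 1) = (\<Sum>m\<in>UNIV. if m = i then partial m (partial k (\<lambda>z. f z $ l)) z else 0)"
          unfolding M'_def using l by simp
        then show ?thesis by (simp add: H_def)
      qed
      then show "det (\<chi> m. if m = l then (\<chi> k. M' l k (axis i 1)) else M z $ m) = (\<Sum>k\<in>UNIV. H l i k * T l i k)"
        unfolding det_row_expand[of l "\<chi> k. M' l k (axis i 1)" "M z"] by (simp add: T_def M_def cong: if_cong)
    qed
    finally show ?thesis .
  qed
  then have "(\<Sum>i\<in>UNIV. partial i (\<lambda>z. adjugate (?J z) $ i $ j) z) =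
     (\<Sum>l\<in>UNIV - {j}. \<Sum>i\<in>UNIV. \<Sum>k\<in>UNIV. H l i k * T l i k)"
    by (simp add: sum.swap[of _ "UNIV - {j}"])
  also have "\<dots> = (\<Sum>l\<in>UNIV - {j}. 0)"
  proof (rule sum.cong[OF refl])
    fix l assume "l \<in> UNIV - {j}"
    then have l: "l \<noteq> j" by simp
    let ?s = "\<Sum>i\<in>UNIV. \<Sum>k\<in>UNIV. H l i k * T l i k"
    have "?s = (\<Sum>k\<in>UNIV. \<Sum>i\<in>UNIV. H l i k * T l i k)" by (rule sum.swap)
    also have "\<dots> = (\<Sum>k\<in>UNIV. \<Sum>i\<in>UNIV. - (H l k i * T l k i))"
    proof (intro sum.cong refl)
      fix k i
      show "H l i k * T l i k = - (H l k i * T l k i)"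
        using Hsym[of l i k] Tanti[OF l, of i k] by simp
    qed
    also have "\<dots> = - ?s" by (simp add: sum_negf)
    finally show "?s = 0" by simp
  qed
  finally show ?thesis by simp
qed

section \<open>Null vectors of holomorphic families of singular matrices\<close>

lemma hol_coeff_mult:
  assumes S: "open S" and P: "\<And>n. holomorphic_fun_on (\<lambda>z. coeff (P z) n) S" and Q: "\<And>n. holomorphic_fun_on (\<lambda>z. coeff (Q z) n) S"
  shows "holomorphic_fun_on (\<lambda>z. coeff (P z * Q z) n) S"
  unfolding coeff_mult by (intro hol_sum hol_mult S P Q)

lemma hol_coeff_prod:
  assumes S: "open S" and P: "\<And>i n. i \<in> A \<Longrightarrow> holomorphic_fun_on (\<lambda>z. coeff (P i z) n) S"
  shows "holomorphic_fun_on (\<lambda>z. coeff (\<Prod>i\<in>A. P i z) n) S"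
  using P
proof (induction A arbitrary: n rule: infinite_finite_induct)
  case (insert x F)
  have "holomorphic_fun_on (\<lambda>z. coeff (P x z * (\<Prod>i\<in>F. P i z)) n) S"
    by (rule hol_coeff_mult[OF S]) (use insert in auto)
  then show ?case using insert by simp
qed (auto intro: hol_const S)

lemma hol_coeff_det:
  fixes M :: "complex^'m::finite \<Rightarrow> complex poly^'n^'n::finite"
  assumes S: "open S" and "\<And>l k n. holomorphic_fun_on (\<lambda>z. coeff (M z $ l $ k) n) S"
  shows "holomorphic_fun_on (\<lambda>z. coeff (det (M z)) n) S"
  unfolding det_def coeff_sum
  by (intro hol_sum hol_coeff_mult hol_coeff_prod hol_const assms)

text \<open>For \<open>t\<close> larger than a bound of the operator \<open>A\<close>, no nonzero
  \<open>x\<close> can satisfy \<open>A *v x = - (t *s x)\<close>.\<close>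

lemma exists_shift_det_nonzero:
  fixes A :: "complex^'n^'n::finite"
  shows "\<exists>t. det (\<chi> l k. A $ l $ k + (if l = k then t else 0)) \<noteq> 0"
proof -
  have "linear ((*v) A)"
    by (rule linearI) (auto simp: vec_eq_iff matrix_vector_mult_def scaleR_sum_right distrib_left sum.distrib)
  then have "bounded_linear ((*v) A)" using linear_conv_bounded_linear by blast
  then obtain K where K: "K > 0" "\<And>x. norm (A *v x) \<le> norm x * K"
    using bounded_linear.pos_bounded by blast
  define t where "t = complex_of_real (K + 1)"
  let ?B = "\<chi> l k. A $ l $ k + (if l = k then t else 0)"
  have Bx: "?B *v x = A *v x + t *s x" for x
  proof -
    have "(\<Sum>k\<in>UNIV. (A $ l $ k + (if l = k then t else 0)) * x $ k) = (\<Sum>k\<in>UNIV. A $ l $ k * x $ k) + t * x $ l" for l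
    proof -
      have "(\<Sum>k\<in>UNIV. (A $ l $ k + (if l = k then t else 0)) * x $ k) =
        (\<Sum>k\<in>UNIV. A $ l $ k * x $ k + (if k = l then t * x $ k else 0))"
        by (rule sum.cong) (auto simp: algebra_simps)
      then show ?thesis by (simp add: sum.distrib)
    qed
    then show ?thesis by (simp add: vec_eq_iff matrix_vector_mult_def)
  qed
  have "x = 0" if "?B *v x = 0" for x
  proof (rule ccontr)
    assume "x \<noteq> 0"
    from that have "A *v x = - (t *s x)" unfolding Bx by (simp add: eq_neg_iff_add_eq_0)
    then have "norm (A *v x) = norm t * norm x" by (simp only: norm_minus_cancel norm_vector_scale)
    then have "norm (A *v x) = (K + 1) * norm x" using K by (simp add: t_def)
    then show False using K(2)[of x] \<open>x \<noteq> 0\<close> by (simp add: algebra_simps)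
  qed
  then have "\<exists>B'. B' ** ?B = mat 1" using matrix_left_invertible_ker[of ?B] by blast
  then have "invertible ?B" using matrix_left_right_inverse unfolding invertible_def by blast
  then show ?thesis using invertible_det_nz by blast
qed

lemma poly_det:
  fixes B :: "complex poly^'n^'n::finite"
  shows "poly (det B) t = det (\<chi> l k. poly (B $ l $ k) t)"
  unfolding det_def by (simp add: poly_sum poly_prod)

text \<open>If \<open>n\<close> is the least power of \<open>t\<close> occurring in the adjugate of \<open>A + t I\<close>, then comparing
  coefficients in \<open>(A + t I) adj (A + t I) = det (A + t I) I\<close> shows that \<open>A\<close> times the \<open>n\<close>-th
  coefficient matrix is a scalar matrix, which vanishes because \<open>det A = 0\<close>.\<close>

lemma exists_holomorphic_null_field:
  fixes A :: "complex^'m::finite \<Rightarrow> complex^'n^'n::finite"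
  assumes S: "open S" "S \<noteq> {}" and A: "\<And>l k. holomorphic_fun_on (\<lambda>z. A z $ l $ k) S"
    and det: "\<And>z. z \<in> S \<Longrightarrow> det (A z) = 0"
  shows "\<exists>X. (\<forall>k. holomorphic_fun_on (\<lambda>z. X z $ k) S) \<and> (\<forall>z\<in>S. A z *v X z = 0) \<and> (\<exists>z\<in>S. X z \<noteq> 0)"
proof -
  define B where "B = (\<lambda>z. \<chi> l k. [:A z $ l $ k:] + (if l = k then [:0, 1:] else 0))"
  have "holomorphic_fun_on (\<lambda>z. coeff (B z $ l $ k) n) S" for l k n
  proof -
    have "coeff (B z $ l $ k) n = (if n = 0 then A z $ l $ k else 0) + coeff (if l = k then [:0, 1:] else 0) n" for z
      by (auto simp: B_def coeff_pCons split: nat.splits)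
    then show ?thesis using A[of l k] by (cases "n = 0") (auto intro!: hol_add hol_const S)
  qed
  then have holB: "holomorphic_fun_on (\<lambda>z. coeff (adjugate (B z) $ i $ j) n) S" for i j n
    unfolding adjugate_def vec_lambda_beta
  proof (intro hol_coeff_det S(1))
    fix l k n
    assume *: "\<And>l k n. holomorphic_fun_on (\<lambda>z. coeff (B z $ l $ k) n) S"
    show "holomorphic_fun_on (\<lambda>z. coeff ((\<chi> k. if k = j then axis i 1 else B z $ k) $ l $ k) n) S"
      using * hol_const[OF S(1)] by (cases "l = j") auto
  qed
  have rel: "(\<Sum>k\<in>UNIV. A z $ i $ k * coeff (adjugate (B z) $ k $ j) n)
      + coeff (pCons 0 (adjugate (B z) $ i $ j)) n = (if i = j then coeff (det (B z)) n else 0)" for z i j n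
  proof -
    have "(if i = j then coeff (det (B z)) n else 0) = coeff (\<Sum>k\<in>UNIV. B z $ i $ k * adjugate (B z) $ k $ j) n"
      unfolding mult_adjugate by simp
    also have "\<dots> = (\<Sum>k\<in>UNIV. A z $ i $ k * coeff (adjugate (B z) $ k $ j) n +
        (if k = i then coeff (pCons 0 (adjugate (B z) $ k $ j)) n else 0))"
      unfolding coeff_sum by (rule sum.cong) (auto simp: B_def algebra_simps)
    finally show ?thesis by (simp add: sum.distrib)
  qed
  define Q where "Q = (\<lambda>n. \<exists>z\<in>S. \<exists>i j. coeff (adjugate (B z) $ i $ j) n \<noteq> 0)"
  have "\<exists>n. Q n"
  proof -
    obtain z where z: "z \<in> S" using S by blast
    obtain t where t: "det (\<chi> l k. A z $ l $ k + (if l = k then t else 0)) \<noteq> 0"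
      using exists_shift_det_nonzero by blast
    have "(\<chi> l k. poly (B z $ l $ k) t) = (\<chi> l k. A z $ l $ k + (if l = k then t else 0))"
      by (simp add: vec_eq_iff B_def)
    then have "poly (det (B z)) t \<noteq> 0" using t by (simp add: poly_det)
    then have nz: "det (B z) \<noteq> 0" by auto
    obtain i :: 'n where True by blast
    have "(\<Sum>k\<in>UNIV. B z $ i $ k * adjugate (B z) $ k $ i) \<noteq> 0" using nz by (simp add: mult_adjugate)
    then obtain k where "B z $ i $ k * adjugate (B z) $ k $ i \<noteq> 0"
      using sum.neutral[of UNIV "\<lambda>k. B z $ i $ k * adjugate (B z) $ k $ i"] by blast
    then have "adjugate (B z) $ k $ i \<noteq> 0" by auto
    then have "lead_coeff (adjugate (B z) $ k $ i) \<noteq> 0" by simp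
    then show ?thesis using z unfolding Q_def by blast
  qed
  define n where "n = (LEAST n. Q n)"
  have Qmin: "\<not> Q k" if "k < n" for k
    using that unfolding n_def by (rule not_less_Least)
  have Qn: "Q n" using \<open>\<exists>n. Q n\<close> unfolding n_def by (rule LeastI_ex)
  then obtain z0 i0 j where z0: "z0 \<in> S" "coeff (adjugate (B z0) $ i0 $ j) n \<noteq> 0" unfolding Q_def by blast
  define M where "M = (\<lambda>z. \<chi> k j. coeff (adjugate (B z) $ k $ j) n)"
  have AM: "A z ** M z = (\<chi> i j. if i = j then coeff (det (B z)) n else 0)" if z: "z \<in> S" for z
  proof -
    \<comment> \<open>The factor \<open>t\<close> lowers the index by one, so this is coefficient
      \<open>n - 1\<close> of the adjugate, zero by minimality; for \<open>n = 0\<close> it is zero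
      outright.\<close>
    have "coeff (pCons 0 (adjugate (B z) $ i $ j)) n = 0" for i j
    proof (cases n)
      case (Suc k)
      then have "coeff (adjugate (B z) $ i $ j) k = 0" using Qmin[of k] z unfolding Q_def by auto
      then show ?thesis using Suc by simp
    qed simp
    then show ?thesis using rel[of z _ _ n] by (simp add: vec_eq_iff matrix_matrix_mult_def M_def)
  qed
  have AM0: "A z ** M z = 0" if z: "z \<in> S" for z
  proof -
    have "det (A z ** M z) = 0" by (simp add: det_mul det[OF z])
    moreover have "det (\<chi> i j::'n. if i = j then coeff (det (B z)) n else 0) = coeff (det (B z)) n ^ CARD('n)"
      by (subst det_diagonal) auto
    ultimately have "coeff (det (B z)) n = 0" unfolding AM[OF z] by simp
    then show ?thesis using AM[OF z] by (simp add: vec_eq_iff)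
  qed
  \<comment> \<open>The column \<open>j\<close> is chosen nonzero at the single point
    \<open>z0\<close> and then kept everywhere, so that the field is holomorphic.\<close>
  define X where "X = (\<lambda>z. \<chi> k. M z $ k $ j)"
  show ?thesis
  proof (intro exI[of _ X] conjI allI ballI)
    show "holomorphic_fun_on (\<lambda>z. X z $ k) S" for k using holB by (simp add: X_def M_def)
    show "A z *v X z = 0" if "z \<in> S" for z
    proof -
      have "(A z ** M z) $ i $ j = 0" for i using AM0[OF that] by simp
      then show ?thesis by (simp add: vec_eq_iff matrix_vector_mult_def matrix_matrix_mult_def X_def)
    qed
    have "X z0 $ i0 \<noteq> 0" using z0 by (simp add: X_def M_def)
    then show "\<exists>z\<in>S. X z \<noteq> 0" using z0 by (metis zero_index)
  qed
qed

section \<open>Integration by parts along holomorphic vector fields\<close>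

lemma real_linear_basis_bound:
  fixes L :: "'a::euclidean_space \<Rightarrow> complex"
  assumes "linear L"
  shows "L v = (\<Sum>b\<in>Basis. (v \<bullet> b) *\<^sub>R L b)"
proof -
  have "L v = L (\<Sum>b\<in>Basis. (v \<bullet> b) *\<^sub>R b)" by (simp add: euclidean_representation)
  then show ?thesis using assms by (simp add: linear_sum linear_cmul)
qed

text \<open>Extension by zero reduces this to functions on the whole space: off \<open>K\<close> the
  derivative vanishes, and on the compact \<open>K\<close> it is bounded on a basis and hence in all
  directions.\<close>

lemma integral_derivative_compact_support:
  fixes \<Phi> :: "'a::euclidean_space \<Rightarrow> complex"
  assumes D: "open D" and K: "compact K" "K \<subseteq> D" and supp: "\<And>x. x \<notin> K \<Longrightarrow> \<Phi> x = 0"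
    and d: "\<And>x. x \<in> D \<Longrightarrow> (\<Phi> has_derivative \<Phi>' x) (at x)"
    and cont: "\<And>v. continuous_on D (\<lambda>x. \<Phi>' x v)"
  shows "integrable lborel (\<lambda>x. indicator D x *\<^sub>R \<Phi>' x v)" "(\<integral>x. indicator D x *\<^sub>R \<Phi>' x v \<partial>lborel) = 0"
proof -
  define P where "P = (\<lambda>x v. indicator D x *\<^sub>R \<Phi>' x v)"
  have off: "(\<Phi> has_derivative (\<lambda>_. 0)) (at x)" if "x \<notin> K" for x
    by (rule has_derivative_transform_within_open[of "\<lambda>_. 0" _ _ _ "- K"])
       (use that supp K compact_imp_closed in \<open>auto simp: open_Compl\<close>)
  have P0: "P x = (\<lambda>_. 0)" if "x \<notin> K" for x
  proof (cases "x \<in> D")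
    case True
    then have "\<Phi>' x = (\<lambda>_. 0)" using has_derivative_unique[OF d[OF True] off[OF that]] by simp
    then show ?thesis by (simp add: P_def fun_eq_iff)
  qed (simp add: P_def fun_eq_iff)
  have dP: "(\<Phi> has_derivative P x) (at x)" for x
  proof (cases "x \<in> D")
    case True
    then show ?thesis using d[OF True] by (simp add: P_def)
  next
    case False
    then have "x \<notin> K" using K by blast
    then show ?thesis using off P0 by simp
  qed
  have lin: "linear (P x)" for x
    using dP has_derivative_bounded_linear bounded_linear.linear by blast
  have "\<exists>B. \<forall>x. norm (P x b) \<le> B" for b
  proof -
    have "compact ((\<lambda>x. \<Phi>' x b) ` K)"
      using cont K by (intro compact_continuous_image) (auto intro: continuous_on_subset)
    then obtain B where B: "\<And>x. x \<in> K \<Longrightarrow> norm (\<Phi>' x b) \<le> B"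
      unfolding compact_eq_bounded_closed bounded_iff by blast
    have "norm (P x b) \<le> max 0 B" for x
    proof (cases "x \<in> K")
      case True
      then show ?thesis using B[OF True] K by (auto simp: P_def)
    qed (use P0 in auto)
    then show ?thesis by blast
  qed
  then obtain B where B: "\<And>x b. norm (P x b) \<le> B b" by metis
  have bd: "norm (P x v) \<le> (\<Sum>b\<in>Basis. B b) * norm v" for x v
  proof -
    have "norm (P x v) = norm (\<Sum>b\<in>Basis. (v \<bullet> b) *\<^sub>R P x b)"
      using real_linear_basis_bound[OF lin, of x v] by simp
    also have "\<dots> \<le> (\<Sum>b\<in>Basis. norm v * B b)"
      by (rule sum_norm_le) (auto intro!: mult_mono B simp: Basis_le_norm)
    also have "\<dots> = (\<Sum>b\<in>Basis. B b) * norm v"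
      unfolding sum_distrib_right by (simp add: mult.commute)
    finally show ?thesis .
  qed
  obtain R where R: "\<And>x. x \<in> K \<Longrightarrow> norm x \<le> R"
    using K compact_imp_bounded bounded_iff by metis
  have s: "\<Phi> x = 0" if "norm x > R" for x using that R supp by force
  show "integrable lborel (\<lambda>x. indicator D x *\<^sub>R \<Phi>' x v)" "(\<integral>x. indicator D x *\<^sub>R \<Phi>' x v \<partial>lborel) = 0"
    using integral_derivative_bounded_support[OF dP bd s] by (simp_all add: P_def)
qed

text \<open>Twice the antilinear part of a real linear \<open>L\<close>. For a differential and
  \<open>v = axis j 1\<close> it is twice the Wirtinger derivative with respect to the conjugate of
  the \<open>j\<close>-th coordinate; it vanishes for all \<open>v\<close> exactly when
  \<open>L\<close> is complex linear.\<close>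

definition dbar :: "(complex^'n \<Rightarrow> complex) \<Rightarrow> complex^'n::finite \<Rightarrow> complex" where
  "dbar L v = L v + \<i> * L (\<i> *s v)"

lemma complex_scale_split: "c *s (v::complex^'n) = Re c *\<^sub>R v + Im c *\<^sub>R (\<i> *s v)"
proof -
  have "c * a = complex_of_real (Re c) * a + complex_of_real (Im c) * (\<i> * a)" for a
    by (subst (1) complex_eq[of c]) (simp add: algebra_simps)
  then show ?thesis
    unfolding scaleR_eq_vector_scale by (simp add: vec_eq_iff)
qed

lemma dbar_scale:
  assumes "linear L"
  shows "dbar L (c *s v) = cnj c * dbar L v"
proof -
  have A: "L (c *s v) = Re c *\<^sub>R L v + Im c *\<^sub>R L (\<i> *s v)" for c v
    using complex_scale_split[of c v] assms by (simp add: linear_add linear_cmul)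
  have ic: "\<i> *s (c *s v) = (\<i> * c) *s v" by simp
  have "dbar L (c *s v) = Re c *\<^sub>R L v + Im c *\<^sub>R L (\<i> *s v) + \<i> * (Re (\<i> * c) *\<^sub>R L v + Im (\<i> * c) *\<^sub>R L (\<i> *s v))"
    unfolding dbar_def by (simp only: ic A[of c v] A[of "\<i> * c" v])
  also have "\<dots> = cnj c * dbar L v"
    by (simp add: dbar_def scaleR_conv_of_real complex_eq_iff algebra_simps)
  finally show ?thesis .
qed

lemma dbar_sum:
  assumes "linear L" "finite A"
  shows "dbar L (\<Sum>i\<in>A. g i) = (\<Sum>i\<in>A. dbar L (g i))"
proof -
  have "\<i> *s (\<Sum>i\<in>A. g i) = (\<Sum>i\<in>A. \<i> *s g i)" by (simp add: vec.scale_sum_right)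
  then show ?thesis using assms by (simp add: dbar_def linear_sum sum.distrib sum_distrib_left)
qed

lemma dbar_expand:
  assumes "linear L"
  shows "dbar L v = (\<Sum>i\<in>UNIV. cnj (v $ i) * dbar L (axis i 1))"
proof -
  have "dbar L v = dbar L (\<Sum>i\<in>UNIV. v $ i *s axis i 1)" by (simp only: basis_expansion)
  then show ?thesis by (simp add: dbar_sum[OF assms] dbar_scale[OF assms])
qed

text \<open>Compactness is imposed later, on the preimage of \<open>C\<close> under
  \<open>f\<close>, because the integrals run over \<open>D\<close>. The derivative is a separate
  argument so that \<open>dbar\<close> can be applied to it.\<close>

definition test_function ::
  "(complex^'n::finite \<Rightarrow> complex) \<Rightarrow> (complex^'n \<Rightarrow> complex^'n \<Rightarrow> complex) \<Rightarrow> (complex^'n) set \<Rightarrow> bool" where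
  "test_function \<psi> \<psi>' C \<longleftrightarrow> (\<forall>w. (\<psi> has_derivative \<psi>' w) (at w)) \<and>
     (\<forall>v. continuous_on UNIV (\<lambda>w. \<psi>' w v)) \<and> (\<forall>w. w \<notin> C \<longrightarrow> \<psi> w = 0)"

lemma test_function_bump:
  assumes e: "e > 0"
  shows "test_function (\<lambda>y. of_real (bump e (w - y))) (\<lambda>y v. of_real (bump_deriv e (w - y) (- v))) (cball (w::complex^'n::finite) e)"
  unfolding test_function_def
proof (intro conjI allI impI)
  fix y :: "complex^'n"
  have "((\<lambda>y. w - y) has_derivative (\<lambda>v. - v)) (at y)" by (auto intro!: derivative_eq_intros)
  from has_derivative_compose[OF this bump_has_derivative[OF e]]
  show "((\<lambda>y. complex_of_real (bump e (w - y))) has_derivative (\<lambda>v. of_real (bump_deriv e (w - y) (- v)))) (at y)"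
    by (rule bounded_linear.has_derivative[OF bounded_linear_of_real])
next
  fix v show "continuous_on UNIV (\<lambda>y. complex_of_real (bump_deriv e (w - y) (- v)))"
    by (intro continuous_intros continuous_bump_deriv[OF e])
next
  fix y assume "y \<notin> cball w e"
  then have "e \<le> norm (w - y)" by (simp add: dist_norm)
  then show "complex_of_real (bump e (w - y)) = 0" using bump_zero[OF e] by simp
qed

lemma continuous_partial: "holomorphic_fun_on f S \<Longrightarrow> open S \<Longrightarrow> continuous_on S (partial i f)"
  by (rule hol_continuous[OF hol_partial])

lemma cnj_has_derivative: "(f has_derivative f') F \<Longrightarrow> ((\<lambda>x. cnj (f x)) has_derivative (\<lambda>v. cnj (f' v))) F"
  by (rule bounded_linear.has_derivative[OF bounded_linear_cnj])

text \<open>Integration by parts along the holomorphic vector field \<open>X\<close>: the composition \<open>\<psi> \<circ> f\<close>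
  is only seen through the derivative of \<open>\<psi>\<close> in direction \<open>f' X\<close>.\<close>

lemma integral_vector_field:
  fixes f :: "complex^'n::finite \<Rightarrow> complex^'n" and X :: "complex^'n \<Rightarrow> complex^'n"
  assumes D: "open D" and f: "holomorphic_map_on f D" and K: "compact {z \<in> D. f z \<in> C}"
    and \<psi>: "test_function \<psi> \<psi>' C"
    and X: "\<And>i. holomorphic_fun_on (\<lambda>z. X z $ i) D" and b: "holomorphic_fun_on b D"
  shows "(\<integral>z. indicator D z *\<^sub>R (b z * (2 * cnj (\<Sum>i\<in>UNIV. partial i (\<lambda>z. X z $ i) z) * \<psi> (f z)
      + dbar (\<psi>' (f z)) (cjacobian f z *v X z))) \<partial>lborel) = 0"
proof -
  have d\<psi>: "(\<psi> has_derivative \<psi>' w) (at w)" and c\<psi>: "continuous_on UNIV (\<lambda>w. \<psi>' w v)" and s\<psi>: "w \<notin> C \<Longrightarrow> \<psi> w = 0" for w v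
    using \<psi> by (auto simp: test_function_def)
  have lin\<psi>: "linear (\<psi>' w)" for w
    using d\<psi> has_derivative_bounded_linear bounded_linear.linear by blast
  have cont\<psi>: "continuous_on UNIV \<psi>"
    by (intro continuous_at_imp_continuous_on ballI has_derivative_continuous[OF d\<psi>])
  let ?J = "cjacobian f"
  define b' where "b' = (\<lambda>z v. \<Sum>k\<in>UNIV. v $ k * partial k b z)"
  define X' where "X' = (\<lambda>i z v. \<Sum>k\<in>UNIV. v $ k * partial k (\<lambda>z. X z $ i) z)"
  define \<Phi> where "\<Phi> = (\<lambda>i z. if z \<in> D then b z * cnj (X z $ i) * \<psi> (f z) else 0)"
  define \<Phi>' where "\<Phi>' = (\<lambda>i z v. b z * cnj (X z $ i) * \<psi>' (f z) (?J z *v v)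
     + (b z * cnj (X' i z v) + b' z v * cnj (X z $ i)) * \<psi> (f z))"
  have contf: "continuous_on D f" by (rule hol_continuous[OF f])
  have contJ: "continuous_on D (\<lambda>z. ?J z $ l $ k)" for l k
    by (rule hol_continuous[OF hol_jacobian[OF f D]])
  have contJv: "continuous_on D (\<lambda>z. ?J z *v v)" for v
    unfolding matrix_vector_mult_def by (intro continuous_intros contJ)
  have cont2: "continuous_on D (\<lambda>z. \<psi>' (f z) (?J z *v v))" for v
    unfolding real_linear_basis_bound[OF lin\<psi>, of _ "?J _ *v v"]
    by (intro continuous_intros contJv continuous_on_compose2[OF c\<psi> contf]) auto
  have cont\<Phi>: "continuous_on D (\<lambda>z. \<Phi>' i z v)" for i v
    unfolding \<Phi>'_def X'_def b'_def
    by (intro continuous_intros cont2 continuous_on_compose2[OF cont\<psi> contf] hol_continuous[OF b]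
          hol_continuous[OF X] continuous_partial b X D) auto
  have d\<Phi>: "(\<Phi> i has_derivative \<Phi>' i z) (at z)" if z: "z \<in> D" for i z
  proof -
    have 1: "(b has_derivative b' z) (at z)" unfolding b'_def by (rule hol_has_derivative[OF b D z])
    have 2: "((\<lambda>z. X z $ i) has_derivative X' i z) (at z)"
      unfolding X'_def by (rule hol_has_derivative[OF X D z])
    have 3: "((\<lambda>z. \<psi> (f z)) has_derivative (\<lambda>v. \<psi>' (f z) (?J z *v v))) (at z)"
      by (rule has_derivative_compose[OF jacobian_has_derivative[OF f D z] d\<psi>])
    have "((\<lambda>z. b z * cnj (X z $ i) * \<psi> (f z)) has_derivative \<Phi>' i z) (at z)"
      unfolding \<Phi>'_def by (rule has_derivative_mult[OF has_derivative_mult[OF 1 cnj_has_derivative[OF 2]] 3])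
    then show ?thesis
      by (rule has_derivative_transform_within_open[OF _ D z]) (simp add: \<Phi>_def)
  qed
  note I = integral_derivative_compact_support[where D = D and K = "{z \<in> D. f z \<in> C}"]
  have s\<Phi>: "\<Phi> i x = 0" if "x \<notin> {z \<in> D. f z \<in> C}" for i x
    using that s\<psi> by (auto simp: \<Phi>_def)
  have I1: "integrable lborel (\<lambda>x. indicator D x *\<^sub>R \<Phi>' i x v)" for i v
    by (rule I(1)[of "\<Phi> i"]) (use D K s\<Phi> d\<Phi> cont\<Phi> in auto)
  have I2: "(\<integral>x. indicator D x *\<^sub>R \<Phi>' i x v \<partial>lborel) = 0" for i v
    by (rule I(2)[of "\<Phi> i"]) (use D K s\<Phi> d\<Phi> cont\<Phi> in auto)
  \<comment> \<open>The holomorphic factor \<open>b\<close> contributes nothing to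
    \<open>dbar\<close>, and the antiholomorphic factor \<open>cnj (X z $ i)\<close> contributes its
    derivative twice.\<close>
  have dbar\<Phi>: "dbar (\<Phi>' i z) v = b z * (2 * cnj (X' i z v) * \<psi> (f z) + cnj (X z $ i) * dbar (\<psi>' (f z)) (?J z *v v))" for i z v
  proof -
    have bc: "b' z (\<i> *s v) = \<i> * b' z v" by (simp add: b'_def sum_distrib_left mult.assoc)
    have xc: "X' i z (\<i> *s v) = \<i> * X' i z v" by (simp add: X'_def sum_distrib_left mult.assoc)
    have jc: "?J z *v (\<i> *s v) = \<i> *s (?J z *v v)" by (simp add: vec.scale)
    have ii: "\<i> * (\<i> * x) = - x" for x :: complex by (simp add: mult.assoc[symmetric])
    show ?thesis unfolding dbar_def \<Phi>'_def bc xc jc by (simp add: algebra_simps ii)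
  qed
  \<comment> \<open>Each \<open>dbar\<close> is a complex combination of two real directional
    derivatives, both with integral zero.\<close>
  have zero: "(\<integral>z. (\<Sum>i\<in>UNIV. indicator D z *\<^sub>R dbar (\<Phi>' i z) (axis i 1)) \<partial>lborel) = 0"
  proof -
    have "(\<integral>z. (\<Sum>i\<in>UNIV. indicator D z *\<^sub>R dbar (\<Phi>' i z) (axis i 1)) \<partial>lborel) =
      (\<integral>z. (\<Sum>i\<in>UNIV. indicator D z *\<^sub>R \<Phi>' i z (axis i 1) + \<i> * (indicator D z *\<^sub>R \<Phi>' i z (\<i> *s axis i 1))) \<partial>lborel)"
      by (simp add: dbar_def scaleR_add_right)
    also have "\<dots> = (\<Sum>i\<in>UNIV. (\<integral>z. indicator D z *\<^sub>R \<Phi>' i z (axis i 1) \<partial>lborel) + \<i> * (\<integral>z. indicator D z *\<^sub>R \<Phi>' i z (\<i> *s axis i 1) \<partial>lborel))"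
      proof -
      have "integrable lborel (\<lambda>z. \<i> * (indicator D z *\<^sub>R \<Phi>' i z (\<i> *s axis i 1)))" for i
        by (intro integrable_mult_right I1)
      then show ?thesis
        by (simp add: Bochner_Integration.integral_sum Bochner_Integration.integral_add I1 Bochner_Integration.integrable_add
            del: mult_scaleR_right)
    qed
    finally show ?thesis using I2 by simp
  qed
  have "(\<Sum>i\<in>UNIV. indicator D z *\<^sub>R dbar (\<Phi>' i z) (axis i 1)) =
     indicator D z *\<^sub>R (b z * (2 * cnj (\<Sum>i\<in>UNIV. partial i (\<lambda>z. X z $ i) z) * \<psi> (f z)
      + dbar (\<psi>' (f z)) (?J z *v X z)))" for z
  proof -
    have Xa: "X' i z (axis i 1) = partial i (\<lambda>z. X z $ i) z" for i
    proof -
      have "axis i 1 $ k * c = (if k = i then c else 0)" for k and c :: complex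
        by (simp add: axis_def)
      then show ?thesis by (simp add: X'_def)
    qed
    have "?J z *v X z = ?J z *v (\<Sum>i\<in>UNIV. X z $ i *s axis i 1)" by (simp only: basis_expansion)
    also have "\<dots> = (\<Sum>i\<in>UNIV. X z $ i *s (?J z *v axis i 1))" by (simp add: vec.sum vec.scale)
    finally have "dbar (\<psi>' (f z)) (?J z *v X z) = (\<Sum>i\<in>UNIV. cnj (X z $ i) * dbar (\<psi>' (f z)) (?J z *v axis i 1))"
      by (simp add: dbar_sum[OF lin\<psi>] dbar_scale[OF lin\<psi>])
    then show ?thesis
      unfolding dbar\<Phi> Xa scaleR_sum_right[symmetric]
      by (simp add: sum.distrib sum_distrib_left sum_distrib_right algebra_simps cnj_sum)
  qed
  then show ?thesis using zero by simp
qed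

lemma partial_mult:
  assumes "holomorphic_fun_on f S" "holomorphic_fun_on g S" "open S" "z \<in> S"
  shows "partial i (\<lambda>z. f z * g z) z = f z * partial i g z + partial i f z * g z"
proof -
  have "partial i (\<lambda>z. f z * g z) z = (\<lambda>v. f z * (\<Sum>i\<in>UNIV. v $ i * partial i g z) + (\<Sum>i\<in>UNIV. v $ i * partial i f z) * g z) (axis i 1)"
    using assms
    by (intro partial_of_derivative[OF hol_mult[OF assms(3,1,2)] assms(3,4)] has_derivative_mult hol_has_derivative)
  moreover have "axis i 1 $ k * c = (if k = i then c else 0)" for k and c :: complex
    by (simp add: axis_def)
  ultimately show ?thesis by simp
qed

lemma partial_component: "partial i (\<lambda>z. z $ k) z = (if i = k then 1 else 0)"
proof -
  have "partial i (\<lambda>z. z $ k) z = (\<lambda>v. v $ k) (axis i 1)"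
    by (rule partial_of_derivative[of _ UNIV]) (auto intro!: hol_component bounded_linear_imp_has_derivative bounded_linear_vec_nth)
  then show ?thesis by (simp add: axis_def)
qed

lemma continuous_AE_zero:
  fixes g :: "'a::euclidean_space \<Rightarrow> complex"
  assumes D: "open D" and g: "continuous_on D g" and ae: "AE x in lborel. x \<in> D \<longrightarrow> g x = 0" and x: "x \<in> D"
  shows "g x = 0"
proof (rule ccontr)
  assume "g x \<noteq> 0"
  have "open (D \<inter> g -` (- {0}))" using g D by (intro continuous_open_preimage) auto
  moreover have "x \<in> D \<inter> g -` (- {0})" using x \<open>g x \<noteq> 0\<close> by simp
  ultimately obtain r where r: "r > 0" "cball x r \<subseteq> D \<inter> g -` (- {0})"
    unfolding open_contains_cball by blast
  then have "AE y in lborel. y \<notin> cball x r" using ae by (auto elim!: eventually_mono)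
  then have "emeasure lborel (cball x r) = 0"
    using AE_iff_measurable[of "cball x r" lborel "\<lambda>y. y \<notin> cball x r"] by (simp add: cball_def)
  then show False using emeasure_cball_pos_finite[OF r(1), of x] by simp
qed

text \<open>Otherwise there is a holomorphic field \<open>X\<close> tangent to the (compact) fibres of \<open>f\<close>. Integrating
  by parts the product of \<open>div (a X)\<close>, its conjugate and a bump function of \<open>f\<close> gives \<open>div (a X) = 0\<close>
  for all holomorphic \<open>a\<close>, and the choices \<open>a = 1\<close> and \<open>a z = z $ k\<close> give \<open>X = 0\<close>.\<close>

lemma jacobian_det_nonzero:
  fixes f :: "complex^'n::finite \<Rightarrow> complex^'n"
  assumes D: "open D" "D \<noteq> {}" and G: "open G" and f: "holomorphic_map_on f D" and fDG: "f ` D \<subseteq> G"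
    and proper: "\<And>C. compact C \<Longrightarrow> C \<subseteq> G \<Longrightarrow> compact {z \<in> D. f z \<in> C}"
  shows "\<exists>z\<in>D. det (cjacobian f z) \<noteq> 0"
proof (rule ccontr)
  assume "\<not> ?thesis"
  then have det0: "\<And>z. z \<in> D \<Longrightarrow> det (cjacobian f z) = 0" by blast
  obtain X :: "complex^'n \<Rightarrow> complex^'n" where X: "\<And>k. holomorphic_fun_on (\<lambda>z. X z $ k) D" "\<And>z. z \<in> D \<Longrightarrow> cjacobian f z *v X z = 0"
    and X0: "\<exists>z\<in>D. X z \<noteq> 0"
    using exists_holomorphic_null_field[OF D, of "cjacobian f"] hol_jacobian[OF f D(1)] det0 by blast
  have div0: "(\<Sum>i\<in>UNIV. partial i (\<lambda>z. a z * X z $ i) z) = 0" if a: "holomorphic_fun_on a D" and z: "z \<in> D" for a z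
  proof -
    define E where "E = (\<lambda>z. \<Sum>i\<in>UNIV. partial i (\<lambda>z. a z * X z $ i) z)"
    have aX: "holomorphic_fun_on (\<lambda>z. a z * X z $ i) D" for i by (intro hol_mult D a X)
    have hE: "holomorphic_fun_on E D" unfolding E_def by (intro hol_sum D hol_partial aX)
    have cE: "continuous_on D E" by (rule hol_continuous[OF hE])
    have "f z \<in> G" using z fDG by blast
    then obtain e where e: "e > 0" "cball (f z) e \<subseteq> G" using G open_contains_cball by blast
    let ?\<psi> = "\<lambda>y. bump e (f z - y)"
    let ?\<psi>' = "\<lambda>y v. complex_of_real (bump_deriv e (f z - y) (- v))"
    have K: "compact {x \<in> D. f x \<in> cball (f z) e}" using proper[of "cball (f z) e"] e by auto
    have tf: "test_function (\<lambda>y. complex_of_real (?\<psi> y)) ?\<psi>' (cball (f z) e)" by (rule test_function_bump[OF e(1)])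
    have lin: "linear (?\<psi>' w)" for w
      using tf has_derivative_bounded_linear bounded_linear.linear unfolding test_function_def by blast
    \<comment> \<open>Taking \<open>b = E\<close> makes the first term twice the square of
      \<open>norm (E x)\<close> times the bump; the \<open>dbar\<close> term drops out because
      \<open>a z *s X z\<close> lies in the kernel of the Jacobian matrix.\<close>
    have "(\<integral>x. indicator D x *\<^sub>R (E x * (2 * cnj (\<Sum>i\<in>UNIV. partial i (\<lambda>x. (\<chi> i. a x * X x $ i) $ i) x) * of_real (?\<psi> (f x))
      + dbar (?\<psi>' (f x)) (cjacobian f x *v (\<chi> i. a x * X x $ i)))) \<partial>lborel) = 0"
      by (rule integral_vector_field[OF D(1) f K tf _ hE]) (simp add: aX)
    also have "(\<lambda>x. indicator D x *\<^sub>R (E x * (2 * cnj (\<Sum>i\<in>UNIV. partial i (\<lambda>x. (\<chi> i. a x * X x $ i) $ i) x) * of_real (?\<psi> (f x))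
      + dbar (?\<psi>' (f x)) (cjacobian f x *v (\<chi> i. a x * X x $ i))))) =
      (\<lambda>x. complex_of_real (indicator D x * (2 * (norm (E x))\<^sup>2 * ?\<psi> (f x))))"
    proof
      fix x
      show "indicator D x *\<^sub>R (E x * (2 * cnj (\<Sum>i\<in>UNIV. partial i (\<lambda>x. (\<chi> i. a x * X x $ i) $ i) x) * of_real (?\<psi> (f x))
      + dbar (?\<psi>' (f x)) (cjacobian f x *v (\<chi> i. a x * X x $ i)))) =
      complex_of_real (indicator D x * (2 * (norm (E x))\<^sup>2 * ?\<psi> (f x)))"
      proof (cases "x \<in> D")
        case True
        have "(\<chi> i. a x * X x $ i) = a x *s X x" by (simp add: vec_eq_iff)
        then have "cjacobian f x *v (\<chi> i. a x * X x $ i) = 0"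
          using X(2)[OF True] by (simp add: vec.scale)
        moreover have "dbar (?\<psi>' (f x)) 0 = 0"
          using dbar_scale[OF lin, of _ 0 0] by simp
        moreover have "E x * cnj (E x) = complex_of_real ((norm (E x))\<^sup>2)" by (rule complex_norm_square[symmetric])
        ultimately show ?thesis using True by (simp add: E_def mult_ac)
      qed simp
    qed
    finally have z0: "(\<integral>x. indicator D x * (2 * (norm (E x))\<^sup>2 * ?\<psi> (f x)) \<partial>lborel) = 0"
      by (simp only: integral_complex_of_real of_real_eq_0_iff)
    define Q where "Q = (\<lambda>x. indicator D x * (2 * (norm (E x))\<^sup>2 * ?\<psi> (f x)))"
    have contQ: "continuous_on D (\<lambda>x. 2 * (norm (E x))\<^sup>2 * ?\<psi> (f x))"
      by (intro continuous_intros continuous_bump[OF e(1)] cE hol_continuous[OF f])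
    have "integrable lborel (\<lambda>x. indicator {x \<in> D. f x \<in> cball (f z) e} x *\<^sub>R (2 * (norm (E x))\<^sup>2 * ?\<psi> (f x)))"
      by (rule borel_integrable_compact[OF K]) (rule continuous_on_subset[OF contQ], auto)
    moreover have "(\<lambda>x. indicator {x \<in> D. f x \<in> cball (f z) e} x *\<^sub>R (2 * (norm (E x))\<^sup>2 * ?\<psi> (f x))) = Q"
    proof
      fix x show "indicator {x \<in> D. f x \<in> cball (f z) e} x *\<^sub>R (2 * (norm (E x))\<^sup>2 * ?\<psi> (f x)) = Q x"
        using bump_zero[OF e(1), of "f z - f x"] by (auto simp: Q_def indicator_def dist_norm)
    qed
    ultimately have Qint: "integrable lborel Q" by simp
    have "AE x in lborel. Q x = 0"
      proof -
      have "Q x \<ge> 0" for x by (simp add: Q_def bump_nonneg[OF e(1)])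
      moreover have "integral\<^sup>L lborel Q = 0" using z0 by (simp add: Q_def)
      ultimately show ?thesis using integral_nonneg_eq_0_iff_AE[OF Qint] by simp
    qed
    then have "AE x in lborel. x \<in> D \<longrightarrow> complex_of_real (2 * (norm (E x))\<^sup>2 * ?\<psi> (f x)) = 0"
      by (rule eventually_mono) (auto simp: Q_def)
    from continuous_AE_zero[OF D(1) continuous_on_of_real[OF contQ] this z]
    have "complex_of_real (2 * (norm (E z))\<^sup>2 * ?\<psi> (f z)) = 0" .
    moreover have "?\<psi> (f z) > 0"
      using integral_bump0_pos[OF e(1), where 'a="complex^'n"] e(1) by (simp add: bump_def bump0_def)
    ultimately show ?thesis by (simp add: E_def)
  qed
  have "X z $ k = 0" if z: "z \<in> D" for z k
  proof -
    have d1: "(\<Sum>i\<in>UNIV. partial i (\<lambda>z. X z $ i) z) = 0"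
      using div0[OF hol_const[OF D(1), of 1] z] by simp
    have "0 = (\<Sum>i\<in>UNIV. partial i (\<lambda>z. z $ k * X z $ i) z)"
      using div0[OF hol_component[OF D(1), of k] z] by simp
    also have "\<dots> = (\<Sum>i\<in>UNIV. z $ k * partial i (\<lambda>z. X z $ i) z + (if i = k then X z $ i else 0))"
      by (rule sum.cong[OF refl]) (simp add: partial_mult[OF hol_component[OF D(1)] X(1) D(1) z] partial_component)
    also have "\<dots> = X z $ k" by (simp add: sum.distrib sum_distrib_left[symmetric] d1)
    finally show ?thesis by simp
  qed
  then show False using X0 by (auto simp: vec_eq_iff)
qed

text \<open>Column \<open>j\<close> of the adjugate has divergence zero by the Piola identity, and
  the Jacobian matrix maps it to \<open>det (cjacobian f z) *s axis j 1\<close>. The determinant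
  comes out conjugated since \<open>dbar\<close> is antilinear.\<close>

lemma integral_transform_dbar:
  fixes f :: "complex^'n::finite \<Rightarrow> complex^'n"
  assumes D: "open D" and f: "holomorphic_map_on f D" and K: "compact {z \<in> D. f z \<in> C}"
    and \<psi>: "test_function \<psi> \<psi>' C" and b: "holomorphic_fun_on b D"
  shows "(\<integral>z. indicator D z *\<^sub>R (cnj (det (cjacobian f z)) * b z * dbar (\<psi>' (f z)) (axis j 1)) \<partial>lborel) = 0"
proof -
  let ?J = "cjacobian f"
  define X where "X = (\<lambda>z. \<chi> i. adjugate (?J z) $ i $ j)"
  have lin\<psi>: "linear (\<psi>' w)" for w
    using \<psi> has_derivative_bounded_linear bounded_linear.linear unfolding test_function_def by blast
  have X: "holomorphic_fun_on (\<lambda>z. X z $ i) D" for i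
    using hol_adjugate_jacobian[OF f D] by (simp add: X_def)
  have JX: "?J z *v X z = det (?J z) *s axis j 1" for z
    using mult_adjugate[of "?J z" _ j] by (auto simp: vec_eq_iff matrix_vector_mult_def X_def axis_def)
  have "(\<integral>z. indicator D z *\<^sub>R (b z * (2 * cnj (\<Sum>i\<in>UNIV. partial i (\<lambda>z. X z $ i) z) * \<psi> (f z)
      + dbar (\<psi>' (f z)) (?J z *v X z))) \<partial>lborel) = 0"
    by (rule integral_vector_field[OF D f K \<psi> X b])
  also have "(\<lambda>z. indicator D z *\<^sub>R (b z * (2 * cnj (\<Sum>i\<in>UNIV. partial i (\<lambda>z. X z $ i) z) * \<psi> (f z)
      + dbar (\<psi>' (f z)) (?J z *v X z)))) =
     (\<lambda>z. indicator D z *\<^sub>R (cnj (det (cjacobian f z)) * b z * dbar (\<psi>' (f z)) (axis j 1)))"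
  proof
    fix z
    show "indicator D z *\<^sub>R (b z * (2 * cnj (\<Sum>i\<in>UNIV. partial i (\<lambda>z. X z $ i) z) * \<psi> (f z)
      + dbar (\<psi>' (f z)) (?J z *v X z))) = indicator D z *\<^sub>R (cnj (det (cjacobian f z)) * b z * dbar (\<psi>' (f z)) (axis j 1))"
    proof (cases "z \<in> D")
      case True
      then show ?thesis
        using piola_identity[OF f D True, of j] unfolding JX dbar_scale[OF lin\<psi>] by (simp add: X_def mult_ac)
    qed simp
  qed
  finally show ?thesis .
qed

section \<open>Existence of the Bergman kernel\<close>

lemma borel_measurable_cnj [measurable]: "cnj \<in> borel_measurable borel"
  by (intro borel_measurable_continuous_onI continuous_intros)

text \<open>Fatou's lemma, used for the norm of a minimiser in the Bergman space and for the square
  integrability of the Jacobian determinant.\<close>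

lemma nn_integral_limit_bound:
  fixes u :: "nat \<Rightarrow> 'a \<Rightarrow> ennreal"
  assumes "\<And>n. u n \<in> borel_measurable M" "\<And>x. x \<in> space M \<Longrightarrow> (\<lambda>n. u n x) \<longlonglongrightarrow> v x" "\<And>n. (\<integral>\<^sup>+x. u n x \<partial>M) \<le> C"
  shows "(\<integral>\<^sup>+x. v x \<partial>M) \<le> C"
proof -
  have "(\<integral>\<^sup>+x. v x \<partial>M) = (\<integral>\<^sup>+x. liminf (\<lambda>n. u n x) \<partial>M)"
    using assms(2) by (intro nn_integral_cong lim_imp_Liminf[symmetric]) auto
  also have "\<dots> \<le> liminf (\<lambda>n. \<integral>\<^sup>+x. u n x \<partial>M)" by (rule nn_integral_liminf[OF assms(1)])
  also have "\<dots> \<le> limsup (\<lambda>n. \<integral>\<^sup>+x. u n x \<partial>M)" by (rule Liminf_le_Limsup) simp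
  also have "\<dots> \<le> C" using assms(3) by (intro Limsup_bounded) simp
  finally show ?thesis .
qed

text \<open>Integration over the whole space is harmless, as functions in the Bergman space vanish
  off \<open>D\<close>.\<close>

definition l2ip :: "(complex^'n::finite \<Rightarrow> complex) \<Rightarrow> (complex^'n \<Rightarrow> complex) \<Rightarrow> complex" where
  "l2ip f g = (\<integral>x. f x * cnj (g x) \<partial>lborel)"

definition l2sq :: "(complex^'n::finite \<Rightarrow> complex) \<Rightarrow> real" where
  "l2sq f = (\<integral>x. (norm (f x))\<^sup>2 \<partial>lborel)"

lemma bergman_space_iff:
  assumes "open D"
  shows "f \<in> bergman_space D \<longleftrightarrow> holomorphic_fun_on f D \<and> (\<forall>z. z \<notin> D \<longrightarrow> f z = 0) \<and>
     integrable lborel (\<lambda>z. (norm (f z))\<^sup>2)"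
proof -
  have "integrable lborel (\<lambda>z. indicator D z *\<^sub>R (norm (f z))\<^sup>2) \<longleftrightarrow> integrable lborel (\<lambda>z. (norm (f z))\<^sup>2)"
    if "\<forall>z. z \<notin> D \<longrightarrow> f z = 0"
  proof -
    have "(\<lambda>z. indicator D z *\<^sub>R (norm (f z))\<^sup>2) = (\<lambda>z. (norm (f z))\<^sup>2)"
      using that by (auto simp: indicator_def fun_eq_iff)
    then show ?thesis by simp
  qed
  then show ?thesis by (auto simp: bergman_space_def set_integrable_def)
qed

lemma bergman_set_integral:
  assumes "f \<in> bergman_space D"
  shows "(LINT \<zeta>:D|lborel. f \<zeta> * cnj (g \<zeta>)) = l2ip f g"
proof -
  have "(\<lambda>z. indicator D z *\<^sub>R (f z * cnj (g z))) = (\<lambda>z. f z * cnj (g z))"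
    using assms by (auto simp: indicator_def bergman_space_def)
  then show ?thesis by (simp add: set_lebesgue_integral_def l2ip_def)
qed

context
  fixes D :: "(complex^'n::finite) set"
  assumes D: "open D" "bounded D"
begin

lemma bergman_measurable: "f \<in> bergman_space D \<Longrightarrow> f \<in> borel_measurable borel"
proof -
  assume f: "f \<in> bergman_space D"
  then have "(\<lambda>z. indicator D z *\<^sub>R f z) = f" by (auto simp: indicator_def bergman_space_def)
  moreover have "(\<lambda>z. indicator D z *\<^sub>R f z) \<in> borel_measurable borel"
    using f D hol_continuous by (intro indicator_times_measurable) (auto simp: bergman_space_def)
  ultimately show ?thesis by simp
qed

lemma bergman_integrable_sq: "f \<in> bergman_space D \<Longrightarrow> integrable lborel (\<lambda>z. (norm (f z))\<^sup>2)"
  using bergman_space_iff D by blast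

lemma bergman_integrable_ip:
  assumes f: "f \<in> bergman_space D" and g: "g \<in> bergman_space D"
  shows "integrable lborel (\<lambda>z. f z * cnj (g z))"
proof (rule Bochner_Integration.integrable_bound[OF Bochner_Integration.integrable_add[OF bergman_integrable_sq[OF f] bergman_integrable_sq[OF g]]])
  show "(\<lambda>z. f z * cnj (g z)) \<in> borel_measurable lborel"
    using bergman_measurable[OF f] bergman_measurable[OF g] by measurable
  have "norm a * norm b \<le> (norm a)\<^sup>2 + (norm b)\<^sup>2" for a b :: complex
    using sum_squares_bound[of "norm a" "norm b"] mult_nonneg_nonneg[OF norm_ge_zero norm_ge_zero, of a b] by linarith
  then show "AE z in lborel. norm (f z * cnj (g z)) \<le> norm ((norm (f z))\<^sup>2 + (norm (g z))\<^sup>2)"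
    by (simp add: norm_mult)
qed

lemma bergman_add:
  assumes f: "f \<in> bergman_space D" and g: "g \<in> bergman_space D"
  shows "(\<lambda>z. f z + g z) \<in> bergman_space D"
  unfolding bergman_space_iff[OF D(1)]
proof (intro conjI allI impI)
  show "holomorphic_fun_on (\<lambda>z. f z + g z) D" using f g D by (intro hol_add) (auto simp: bergman_space_def)
  show "f z + g z = 0" if "z \<notin> D" for z using that f g by (simp add: bergman_space_def)
  have "(norm (a + b))\<^sup>2 \<le> 2 * (norm a)\<^sup>2 + 2 * (norm b)\<^sup>2" for a b :: complex
  proof -
    have "(norm (a + b))\<^sup>2 \<le> (norm a + norm b)\<^sup>2" by (intro power_mono norm_triangle_ineq) simp
    also have "\<dots> \<le> 2 * (norm a)\<^sup>2 + 2 * (norm b)\<^sup>2"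
      using sum_squares_bound[of "norm a" "norm b"] by (simp add: power2_sum)
    finally show ?thesis .
  qed
  note bd = this
  show "integrable lborel (\<lambda>z. (norm (f z + g z))\<^sup>2)"
  proof (rule Bochner_Integration.integrable_bound)
    show "integrable lborel (\<lambda>z. 2 * (norm (f z))\<^sup>2 + 2 * (norm (g z))\<^sup>2)"
      by (intro Bochner_Integration.integrable_add integrable_mult_right bergman_integrable_sq f g)
    show "(\<lambda>z. (norm (f z + g z))\<^sup>2) \<in> borel_measurable lborel"
      using bergman_measurable[OF f] bergman_measurable[OF g] by measurable
    show "AE z in lborel. norm ((norm (f z + g z))\<^sup>2) \<le> norm (2 * (norm (f z))\<^sup>2 + 2 * (norm (g z))\<^sup>2)"
      using bd by simp
  qed
qed

lemma bergman_cmult: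
  assumes f: "f \<in> bergman_space D"
  shows "(\<lambda>z. c * f z) \<in> bergman_space D"
  using f bergman_integrable_sq[OF f] D unfolding bergman_space_iff[OF D(1)]
  by (auto intro!: hol_cmult simp: norm_mult power_mult_distrib)

lemma bergman_diff:
  assumes f: "f \<in> bergman_space D" and g: "g \<in> bergman_space D"
  shows "(\<lambda>z. f z - g z) \<in> bergman_space D"
  using bergman_add[OF f bergman_cmult[OF g, of "-1"]] by simp

lemma bergman_bounded:
  assumes "holomorphic_fun_on f D" "\<And>z. z \<in> D \<Longrightarrow> norm (f z) \<le> B"
  shows "(\<lambda>z. indicator D z * f z) \<in> bergman_space D"
  unfolding bergman_space_iff[OF D(1)]
proof (intro conjI allI impI)
  show "holomorphic_fun_on (\<lambda>z. indicator D z * f z) D"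
    by (rule hol_transform[OF D(1) assms(1)]) simp
  have m: "(\<lambda>z. indicator D z *\<^sub>R f z) \<in> borel_measurable borel"
    using D hol_continuous[OF assms(1)] by (intro indicator_times_measurable)
  have fin: "emeasure lborel D < \<infinity>" using D emeasure_bounded_finite by auto
  show "integrable lborel (\<lambda>z. (norm (indicator D z * f z))\<^sup>2)"
  proof (rule Bochner_Integration.integrable_bound)
    show "integrable lborel (\<lambda>z. B\<^sup>2 * indicator D z)"
      using D fin by (intro integrable_mult_right integrable_real_indicator) auto
    have "(\<lambda>z. (norm (indicator D z *\<^sub>R f z))\<^sup>2) \<in> borel_measurable borel"
      by (intro borel_measurable_power measurable_compose[OF m borel_measurable_norm])
    moreover have "(\<lambda>z. (norm (indicator D z *\<^sub>R f z))\<^sup>2) = (\<lambda>z. (norm (indicator D z * f z))\<^sup>2)"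
      by (auto simp: indicator_def)
    ultimately show "(\<lambda>z. (norm (indicator D z * f z))\<^sup>2) \<in> borel_measurable lborel" by simp
    show "AE z in lborel. norm ((norm (indicator D z * f z))\<^sup>2) \<le> norm (B\<^sup>2 * indicator D z)"
      using assms(2) by (auto simp: indicator_def intro!: AE_I2 power_mono)
  qed
qed simp

lemma l2ip_cnj: "cnj (l2ip f g) = l2ip g f"
  unfolding l2ip_def by (subst Bochner_Integration.integral_cnj[symmetric]) (simp add: mult.commute)

lemma l2ip_self: "l2ip f f = of_real (l2sq f)"
  unfolding l2ip_def l2sq_def integral_complex_of_real[symmetric] complex_norm_square ..

lemma l2sq_add:
  assumes f: "f \<in> bergman_space D" and g: "g \<in> bergman_space D"
  shows "l2sq (\<lambda>z. f z + c * g z) = l2sq f + 2 * Re (c * l2ip g f) + (norm c)\<^sup>2 * l2sq g"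
proof -
  have "(norm (a + c * b))\<^sup>2 = (norm a)\<^sup>2 + 2 * Re (c * (b * cnj a)) + (norm c)\<^sup>2 * (norm b)\<^sup>2" for a b :: complex
  proof -
    have "(norm (a + c * b))\<^sup>2 = (norm a)\<^sup>2 + 2 * Re (cnj a * (c * b)) + (norm (c * b))\<^sup>2"
      unfolding cmod_power2 by (simp add: power2_eq_square algebra_simps)
    then show ?thesis by (simp add: norm_mult power_mult_distrib mult_ac)
  qed
  then have "l2sq (\<lambda>z. f z + c * g z) = (\<integral>z. (norm (f z))\<^sup>2 + 2 * Re (c * (g z * cnj (f z))) + (norm c)\<^sup>2 * (norm (g z))\<^sup>2 \<partial>lborel)"
    unfolding l2sq_def by simp
  also have "\<dots> = l2sq f + 2 * (\<integral>z. Re (c * (g z * cnj (f z))) \<partial>lborel) + (norm c)\<^sup>2 * l2sq g"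
  proof -
    have 1: "integrable lborel (\<lambda>z. Re (c * (g z * cnj (f z))))"
      by (intro integrable_Re integrable_mult_right bergman_integrable_ip f g)
    define r where "r z = Re (c * (g z * cnj (f z)))" for z
    show ?thesis
      using 1 bergman_integrable_sq[OF f] bergman_integrable_sq[OF g]
      unfolding r_def[symmetric] by (simp add: l2sq_def)
  qed
  also have "(\<integral>z. Re (c * (g z * cnj (f z))) \<partial>lborel) = Re (c * l2ip g f)"
    using bergman_integrable_ip[OF g f] unfolding l2ip_def by (subst integral_Re) auto
  finally show ?thesis .
qed

lemma l2sq_nonneg: "0 \<le> l2sq f"
  unfolding l2sq_def by (intro integral_nonneg_AE) simp

lemma l2ip_diff:
  assumes "f \<in> bergman_space D" "g \<in> bergman_space D" "h \<in> bergman_space D"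
  shows "l2ip (\<lambda>z. f z - c * g z) h = l2ip f h - c * l2ip g h"
proof -
  have "l2ip (\<lambda>z. f z - c * g z) h = (\<integral>z. f z * cnj (h z) - c * (g z * cnj (h z)) \<partial>lborel)"
    unfolding l2ip_def by (simp add: algebra_simps)
  also have "\<dots> = l2ip f h - c * l2ip g h"
    unfolding l2ip_def by (subst Bochner_Integration.integral_diff) (auto intro!: bergman_integrable_ip integrable_mult_right assms)
  finally show ?thesis .
qed

text \<open>The mean value property is applied to the square of \<open>f\<close> instead of
  \<open>f\<close>, so that \<open>l2sq f\<close> appears at once; \<open>B\<close> is a bound of
  the bump.\<close>

lemma bergman_point_evaluation:
  assumes e: "e > 0"
  shows "\<exists>B>0. \<forall>w f. cball w e \<subseteq> D \<longrightarrow> f \<in> bergman_space D \<longrightarrow> (norm (f w))\<^sup>2 \<le> B * l2sq f"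
proof -
  obtain B where B: "B > 0" "\<And>x::complex^'n. bump e x \<le> B" using bump_bound[OF e] by blast
  have "(norm (f w))\<^sup>2 \<le> B * l2sq f" if w: "cball w e \<subseteq> D" and f: "f \<in> bergman_space D" for w f
  proof -
    have hf: "holomorphic_fun_on f D" using f by (simp add: bergman_space_def)
    have h2: "holomorphic_fun_on (\<lambda>z. (f z)\<^sup>2) D" by (intro hol_power D hf)
    let ?k = "\<lambda>x. indicator (ball 0 e) x *\<^sub>R ((f (w + x))\<^sup>2 * of_real (bump e x))"
    have int: "integrable lborel (\<lambda>x. (norm (f (w + x)))\<^sup>2)"
    proof -
      have "integrable (distr lborel borel ((+) w)) (\<lambda>x. (norm (f x))\<^sup>2)"
        using bergman_integrable_sq[OF f] by (simp add: lborel_distr_plus)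
      then show ?thesis by (subst (asm) integrable_distr_eq) (use bergman_measurable[OF f] in auto)
    qed
    have tr: "(\<integral>x. (norm (f (w + x)))\<^sup>2 \<partial>lborel) = l2sq f"
    proof -
      have "(\<integral>x. complex_of_real ((norm (f (w + x)))\<^sup>2) \<partial>lborel) = (\<integral>x. complex_of_real ((norm (f x))\<^sup>2) \<partial>lborel)"
        by (rule integral_translate) (use bergman_measurable[OF f] in simp)
      then show ?thesis unfolding integral_complex_of_real of_real_eq_iff l2sq_def .
    qed
    have kb: "norm (?k x) \<le> B * (norm (f (w + x)))\<^sup>2" for x
    proof -
      have "norm (?k x) \<le> (norm (f (w + x)))\<^sup>2 * bump e x"
        using bump_nonneg[OF e, of x] by (auto simp: indicator_def norm_mult norm_power)
      also have "\<dots> \<le> (norm (f (w + x)))\<^sup>2 * B" using B by (intro mult_left_mono) auto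
      finally show ?thesis by (simp add: mult.commute)
    qed
    have fm: "(\<lambda>x. f (w + x)) \<in> borel_measurable borel"
      by (rule measurable_compose[OF _ bergman_measurable[OF f]]) simp
    have kint: "integrable lborel ?k"
    proof (rule Bochner_Integration.integrable_bound)
      show "integrable lborel (\<lambda>x. B * (norm (f (w + x)))\<^sup>2)" using int by simp
      show "?k \<in> borel_measurable lborel"
        proof -
        note [measurable] = fm bump_measurable[OF e]
        have [measurable]: "ball (0::complex^'n) e \<in> sets borel" by simp
        show ?thesis by measurable
      qed
    qed (use kb B in \<open>auto simp: abs_mult\<close>)
    have "(norm (f w))\<^sup>2 = norm ((f w)\<^sup>2)" by (simp add: norm_power)
    also have "\<dots> = norm (\<integral>x. ?k x \<partial>lborel)"
      using hol_mean_value[OF e h2 D(1) w] by simp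
    also have "\<dots> \<le> (\<integral>x. norm (?k x) \<partial>lborel)" by (rule integral_norm_bound)
    also have "\<dots> \<le> (\<integral>x. B * (norm (f (w + x)))\<^sup>2 \<partial>lborel)"
      by (intro integral_mono integrable_norm kint kb integrable_mult_right int)
    also have "\<dots> = B * l2sq f" using tr by simp
    finally show ?thesis .
  qed
  then show ?thesis using B by blast
qed

text \<open>A minimising sequence is Cauchy by the parallelogram law. Bounded point evaluations turn
  this into locally uniform convergence to a holomorphic function, and Fatou's lemma shows that the
  limit still attains the infimum.\<close>

lemma bergman_minimiser:
  assumes w: "w \<in> D"
  shows "\<exists>h0\<in>bergman_space D. h0 w = 1 \<and> (\<forall>h\<in>bergman_space D. h w = 1 \<longrightarrow> l2sq h0 \<le> l2sq h)"
proof -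
  define C where "C = {h \<in> bergman_space D. h w = 1}"
  define d where "d = Inf (l2sq ` C)"
  have "(\<lambda>z. indicator D z * 1) \<in> C"
    using bergman_bounded[OF hol_const[OF D(1)], of 1 1] w by (simp add: C_def)
  then have Cne: "l2sq ` C \<noteq> {}" by blast
  have bdd: "bdd_below (l2sq ` C)" using l2sq_nonneg by (intro bdd_belowI[of _ 0]) auto
  have dle: "d \<le> l2sq h" if "h \<in> C" for h unfolding d_def using bdd that by (intro cInf_lower) auto
  have "\<exists>h\<in>C. l2sq h < d + 1 / real (Suc n)" for n
  proof -
    have "Inf (l2sq ` C) < d + 1 / real (Suc n)" by (simp add: d_def)
    then show ?thesis using cInf_lessD[OF Cne] by blast
  qed
  then obtain h where h: "\<And>n. h n \<in> C" "\<And>n. l2sq (h n) < d + 1 / real (Suc n)" by metis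
  have hb: "h n \<in> bergman_space D" for n using h(1)[of n] by (simp add: C_def)
  have close: "l2sq (\<lambda>z. h m z - h n z) \<le> 2 / real (Suc m) + 2 / real (Suc n)" for m n
  proof -
    have "l2sq (\<lambda>z. h m z + 1 * h n z) = l2sq (h m) + 2 * Re (1 * l2ip (h n) (h m)) + (norm (1::complex))\<^sup>2 * l2sq (h n)"
      by (rule l2sq_add[OF hb hb])
    moreover have "l2sq (\<lambda>z. h m z + (-1) * h n z) = l2sq (h m) + 2 * Re ((-1) * l2ip (h n) (h m)) + (norm (-1::complex))\<^sup>2 * l2sq (h n)"
      by (rule l2sq_add[OF hb hb])
    \<comment> \<open>The midpoint of two competitors is again a competitor, so its squared norm is
      at least \<open>d\<close>.\<close>
    moreover have "4 * d \<le> l2sq (\<lambda>z. h m z + 1 * h n z)"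
    proof -
      have "(\<lambda>z. (1/2) * (h m z + h n z)) \<in> C"
        using h(1)[of m] h(1)[of n] bergman_cmult[OF bergman_add[OF hb[of m] hb[of n]], of "1/2"] by (simp add: C_def)
      from dle[OF this] have "d \<le> (1/4) * l2sq (\<lambda>z. h m z + 1 * h n z)"
        by (simp add: l2sq_def norm_mult norm_divide power_divide)
      then show ?thesis by simp
    qed
    ultimately have "l2sq (\<lambda>z. h m z - h n z) \<le> 2 * l2sq (h m) + 2 * l2sq (h n) - 4 * d" by simp
    then show ?thesis using h(2)[of m] h(2)[of n] by simp
  qed
  have hol: "holomorphic_fun_on (h n) D" for n using hb by (simp add: bergman_space_def)
  have "\<exists>g. holomorphic_fun_on g D \<and> (\<forall>z\<in>D. (\<lambda>n. h n z) \<longlonglongrightarrow> g z)"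
  proof (rule hol_uniform_limit[OF D(1) hol])
    fix z assume "z \<in> D"
    then obtain r' where r': "r' > 0" "cball z r' \<subseteq> D" using D(1) open_contains_cball by blast
    define r where "r = r' / 2"
    have r: "r > 0" using r' by (simp add: r_def)
    have sub: "cball x r \<subseteq> D" if "x \<in> ball z r" for x
    proof
      fix y assume "y \<in> cball x r"
      then have "y \<in> cball z r'" using that dist_triangle[of z y x] by (auto simp: r_def)
      then show "y \<in> D" using r' by blast
    qed
    obtain B where B: "B > 0" "\<And>w f. cball w r \<subseteq> D \<Longrightarrow> f \<in> bergman_space D \<Longrightarrow> (norm (f w))\<^sup>2 \<le> B * l2sq f"
      using bergman_point_evaluation[OF r] by blast
    have "\<exists>N. \<forall>m\<ge>N. \<forall>n\<ge>N. \<forall>x\<in>ball z r. norm (h m x - h n x) \<le> e" if e: "e > 0" for e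
    proof -
      obtain N :: nat where N: "4 * B / e\<^sup>2 < real N" using reals_Archimedean2 by blast
      have "norm (h m x - h n x) \<le> e" if mn: "m \<ge> N" "n \<ge> N" and x: "x \<in> ball z r" for m n x
      proof -
        have "4 * B / e\<^sup>2 < real (Suc N)" using N by simp
        then have "4 * B < e\<^sup>2 * real (Suc N)" using e by (simp add: field_simps)
        then have sN: "B * (4 / real (Suc N)) < e\<^sup>2" by (simp add: field_simps)
        have "(norm (h m x - h n x))\<^sup>2 \<le> B * l2sq (\<lambda>z. h m z - h n z)"
          using B(2)[OF sub[OF x] bergman_diff[OF hb hb]] .
        also have "\<dots> \<le> B * (2 / real (Suc m) + 2 / real (Suc n))"
          using B close by (intro mult_left_mono) auto
        also have "\<dots> \<le> B * (2 / real (Suc N) + 2 / real (Suc N))"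
          using B mn by (intro mult_left_mono add_mono divide_left_mono) auto
        also have "\<dots> = B * (4 / real (Suc N))" by simp
        finally have "(norm (h m x - h n x))\<^sup>2 \<le> e\<^sup>2" using sN by simp
        then show ?thesis using e by (meson less_imp_le power2_le_imp_le)
      qed
      then show ?thesis by blast
    qed
    moreover have "ball z r \<subseteq> D" using sub r by (meson ball_subset_cball centre_in_ball dual_order.trans)
    ultimately show "\<exists>r>0. ball z r \<subseteq> D \<and> (\<forall>e>0. \<exists>N. \<forall>m\<ge>N. \<forall>n\<ge>N. \<forall>x\<in>ball z r. norm (h m x - h n x) \<le> e)"
      using r by blast
  qed
  then obtain g where g: "holomorphic_fun_on g D" "\<And>z. z \<in> D \<Longrightarrow> (\<lambda>n. h n z) \<longlonglongrightarrow> g z" by blast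
  define h0 where "h0 = (\<lambda>z. indicator D z * g z)"
  have lim: "(\<lambda>n. h n z) \<longlonglongrightarrow> h0 z" for z
  proof (cases "z \<in> D")
    case True
    then show ?thesis using g(2) by (simp add: h0_def)
  next
    case False
    then have "h n z = 0" for n using hb[of n] by (simp add: bergman_space_def)
    then show ?thesis using False by (simp add: h0_def)
  qed
  have h0m: "h0 \<in> borel_measurable borel"
    by (rule borel_measurable_LIMSEQ_metric[OF bergman_measurable[OF hb] lim])
  have nnb: "(\<integral>\<^sup>+z. ennreal ((norm (h0 z))\<^sup>2) \<partial>lborel) \<le> ennreal (d + 1 / real (Suc N))" for N
  proof (rule nn_integral_limit_bound[where u = "\<lambda>n z. ennreal ((norm (h (n + N) z))\<^sup>2)"])
    show "(\<lambda>z. ennreal ((norm (h (n + N) z))\<^sup>2)) \<in> borel_measurable lborel" for n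
      using bergman_measurable[OF hb[of "n + N"]] by simp
    show "(\<lambda>n. ennreal ((norm (h (n + N) z))\<^sup>2)) \<longlonglongrightarrow> ennreal ((norm (h0 z))\<^sup>2)" for z
      by (intro tendsto_ennrealI tendsto_power tendsto_norm LIMSEQ_ignore_initial_segment lim)
    show "(\<integral>\<^sup>+z. ennreal ((norm (h (n + N) z))\<^sup>2) \<partial>lborel) \<le> ennreal (d + 1 / real (Suc N))" for n
    proof -
      have "(\<integral>\<^sup>+z. ennreal ((norm (h (n + N) z))\<^sup>2) \<partial>lborel) = ennreal (l2sq (h (n + N)))"
        unfolding l2sq_def by (rule nn_integral_eq_integral[OF bergman_integrable_sq[OF hb]]) simp
      also have "l2sq (h (n + N)) \<le> d + 1 / real (Suc N)"
      proof -
        have "1 / real (Suc (n + N)) \<le> 1 / real (Suc N)" by (intro divide_left_mono) auto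
        then show ?thesis using h(2)[of "n + N"] by linarith
      qed
      finally show ?thesis by (simp add: ennreal_leI)
    qed
  qed
  have int0: "integrable lborel (\<lambda>z. (norm (h0 z))\<^sup>2)"
    using h0m le_less_trans[OF nnb[of 0] ennreal_less_top] by (intro integrableI_nonneg) auto
  have "h0 \<in> bergman_space D"
    unfolding bergman_space_iff[OF D(1)]
    using hol_transform[OF D(1) g(1), of h0] int0 by (auto simp: h0_def)
  moreover have "h0 w = 1"
  proof -
    have "h n w = 1" for n using h(1) by (simp add: C_def)
    then show ?thesis using lim[of w] by (simp add: LIMSEQ_const_iff)
  qed
  moreover have "l2sq h0 \<le> d"
  proof (rule field_le_epsilon)
    fix e :: real assume "e > 0"
    then obtain N where N: "1 / real (Suc N) < e" using nat_approx_posE by blast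
    have "ennreal (l2sq h0) \<le> ennreal (d + 1 / real (Suc N))"
      using nnb[of N] unfolding l2sq_def by (simp add: nn_integral_eq_integral[OF int0])
    moreover have "0 \<le> d + 1 / real (Suc N)"
      using h(2)[of N] l2sq_nonneg[of "h N"] by linarith
    ultimately have "l2sq h0 \<le> d + 1 / real (Suc N)" using ennreal_le_iff by blast
    then show "l2sq h0 \<le> d + e" using N by simp
  qed
  ultimately show ?thesis using dle unfolding C_def by (metis (mono_tags, lifting) mem_Collect_eq order_trans)
qed

text \<open>The representer is proportional to the element of least norm among those with value \<open>1\<close> at \<open>w\<close>.\<close>

lemma bergman_representer:
  assumes w: "w \<in> D"
  shows "\<exists>g\<in>bergman_space D. \<forall>f\<in>bergman_space D. f w = l2ip f g"
proof -
  obtain h0 where h0: "h0 \<in> bergman_space D" "h0 w = 1" and min: "\<And>h. h \<in> bergman_space D \<Longrightarrow> h w = 1 \<Longrightarrow> l2sq h0 \<le> l2sq h"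
    using bergman_minimiser[OF w] by blast
  have orth: "l2ip h h0 = 0" if h: "h \<in> bergman_space D" "h w = 0" for h
  proof (rule ccontr)
    define a where "a = l2ip h h0"
    \<comment> \<open>Adding \<open>c * h\<close> with \<open>c = - of_real t * cnj a\<close>
      changes the squared norm by \<open>norm a ^ 2\<close> times
      \<open>t * (t * l2sq h - 2)\<close>, which is negative for this \<open>t\<close>.\<close>
    define t where "t = 1 / (l2sq h + 1)"
    have N: "l2sq h \<ge> 0" by (rule l2sq_nonneg)
    assume "l2ip h h0 \<noteq> 0"
    then have a: "(norm a)\<^sup>2 > 0" by (simp add: a_def)
    have t: "t > 0" "t * l2sq h < 1" using N by (auto simp: t_def field_simps)
    define c where "c = - of_real t * cnj a"
    have ca: "Re (c * a) = - (t * (norm a)\<^sup>2)" "(norm c)\<^sup>2 = t\<^sup>2 * (norm a)\<^sup>2"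
    proof -
      have "c * a = - of_real (t * (norm a)\<^sup>2)"
        by (simp add: c_def complex_norm_square mult.commute[of "cnj a"] del: of_real_power)
      then show "Re (c * a) = - (t * (norm a)\<^sup>2)" by (simp del: of_real_mult of_real_power)
      show "(norm c)\<^sup>2 = t\<^sup>2 * (norm a)\<^sup>2" using t by (simp add: c_def norm_mult power_mult_distrib)
    qed
    have "(\<lambda>z. h0 z + c * h z) \<in> bergman_space D" by (intro bergman_add bergman_cmult h0 h)
    then have "l2sq h0 \<le> l2sq (\<lambda>z. h0 z + c * h z)" by (rule min) (simp add: h0 h)
    also have "\<dots> = l2sq h0 - 2 * (t * (norm a)\<^sup>2) + t\<^sup>2 * (norm a)\<^sup>2 * l2sq h"
      unfolding l2sq_add[OF h0(1) h(1)] using ca by (simp add: a_def)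
    finally have "2 * (t * (norm a)\<^sup>2) \<le> (t * (norm a)\<^sup>2) * (t * l2sq h)" by (simp add: power2_eq_square mult_ac)
    moreover have "(t * (norm a)\<^sup>2) * (t * l2sq h) < (t * (norm a)\<^sup>2) * 1"
      using t a by (intro mult_strict_left_mono) auto
    moreover have "t * (norm a)\<^sup>2 > 0" using t a by simp
    ultimately show False by linarith
  qed
  have rep: "l2ip f h0 = f w * of_real (l2sq h0)" if f: "f \<in> bergman_space D" for f
  proof -
    have "l2ip (\<lambda>z. f z - f w * h0 z) h0 = 0"
      by (rule orth) (use h0 f in \<open>auto intro!: bergman_diff bergman_cmult\<close>)
    then show ?thesis using l2ip_diff[OF f h0(1) h0(1)] by (simp add: l2ip_self)
  qed
  have pos: "l2sq h0 > 0"
  proof -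
    obtain e where e: "e > 0" "cball w e \<subseteq> D" using w D open_contains_cball by blast
    obtain B where "B > 0" "(norm (h0 w))\<^sup>2 \<le> B * l2sq h0" using bergman_point_evaluation[OF e(1)] e(2) h0(1) by blast
    then have "1 \<le> B * l2sq h0" using h0 by simp
    then show ?thesis using \<open>B > 0\<close> l2sq_nonneg[of h0] by (cases "l2sq h0 = 0") auto
  qed
  define g where "g = (\<lambda>z. of_real (1 / l2sq h0) * h0 z)"
  have "l2ip f g = f w" if f: "f \<in> bergman_space D" for f
  proof -
    have "l2ip f g = (\<integral>z. of_real (1 / l2sq h0) * (f z * cnj (h0 z)) \<partial>lborel)"
      unfolding l2ip_def g_def by (simp add: mult_ac)
    also have "\<dots> = of_real (1 / l2sq h0) * l2ip f h0" by (simp add: l2ip_def)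
    finally show ?thesis using pos by (simp add: rep[OF f])
  qed
  moreover have "g \<in> bergman_space D" unfolding g_def by (intro bergman_cmult h0)
  ultimately show ?thesis by metis
qed

text \<open>The kernel is a definite description, so uniqueness is required too: the difference of
  two representers is orthogonal to itself, and point evaluation then makes it vanish.\<close>

lemma bergman_kernel_reproducing:
  assumes w: "w \<in> D"
  shows bergman_kernel_in_space: "(\<lambda>z. bergman_kernel D z w) \<in> bergman_space D"
    and bergman_kernel_eval: "\<And>f. f \<in> bergman_space D \<Longrightarrow> f w = l2ip f (\<lambda>z. bergman_kernel D z w)"
proof -
  let ?P = "\<lambda>g. g \<in> bergman_space D \<and> (\<forall>f\<in>bergman_space D. f w = (LINT \<zeta>:D|lborel. f \<zeta> * cnj (g \<zeta>)))"
  obtain g where g: "g \<in> bergman_space D" "\<And>f. f \<in> bergman_space D \<Longrightarrow> f w = l2ip f g"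
    using bergman_representer[OF w] by blast
  have "?P g" using g by (simp add: bergman_set_integral)
  moreover have "g' = g" if "?P g'" for g'
  proof -
    have g': "g' \<in> bergman_space D" "\<And>f. f \<in> bergman_space D \<Longrightarrow> f w = l2ip f g'"
      using that by (auto simp: bergman_set_integral)
    define k where "k = (\<lambda>z. g z - g' z)"
    have k: "k \<in> bergman_space D" unfolding k_def by (intro bergman_diff g g')
    have "l2ip k g = l2ip k g'" using g(2)[OF k] g'(2)[OF k] by simp
    moreover have "l2ip k k = l2ip k g - l2ip k g'"
      unfolding l2ip_def k_def using bergman_integrable_ip[OF k g(1)] bergman_integrable_ip[OF k g'(1)]
      by (simp add: k_def algebra_simps flip: Bochner_Integration.integral_diff)
    ultimately have "l2sq k = 0" by (simp add: l2ip_self)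
    then have "k z = 0" if z: "z \<in> D" for z
    proof -
      obtain e where e: "e > 0" "cball z e \<subseteq> D" using z D open_contains_cball by blast
      obtain B where "(norm (k z))\<^sup>2 \<le> B * l2sq k" using bergman_point_evaluation[OF e(1)] e(2) k by blast
      then show ?thesis using \<open>l2sq k = 0\<close> by simp
    qed
    then show "g' = g" using g(1) g'(1) by (auto simp: k_def fun_eq_iff bergman_space_def) metis
  qed
  ultimately have "(THE g. ?P g) = g" by (intro the_equality)
  then have "(\<lambda>z. bergman_kernel D z w) = g" by (simp add: bergman_kernel_def)
  then show "(\<lambda>z. bergman_kernel D z w) \<in> bergman_space D"
    "\<And>f. f \<in> bergman_space D \<Longrightarrow> f w = l2ip f (\<lambda>z. bergman_kernel D z w)"
    using g by auto
qed

lemma bergman_kernel_hermitian: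
  assumes "z \<in> D" "w \<in> D"
  shows "bergman_kernel D z w = cnj (bergman_kernel D w z)"
proof -
  have "bergman_kernel D z w = l2ip (\<lambda>x. bergman_kernel D x w) (\<lambda>x. bergman_kernel D x z)"
    by (rule bergman_kernel_eval[OF assms(1) bergman_kernel_in_space[OF assms(2)]])
  moreover have "bergman_kernel D w z = l2ip (\<lambda>x. bergman_kernel D x z) (\<lambda>x. bergman_kernel D x w)"
    by (rule bergman_kernel_eval[OF assms(2) bergman_kernel_in_space[OF assms(1)]])
  ultimately show ?thesis using l2ip_cnj by metis
qed

end

section \<open>Push-forward along a proper holomorphic map\<close>

text \<open>The product \<open>A z * R x\<close> is integrable on the product measure and, up to the
  factor \<open>B\<close>, dominates the integrand. The exchanges of push-forward, smoothing and
  circle average below are instances.\<close>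

lemma fixes A :: "'a \<Rightarrow> complex" and R :: "'b \<Rightarrow> complex" and c :: "'a \<Rightarrow> 'b \<Rightarrow> complex"
  assumes sf: "sigma_finite_measure M1" "sigma_finite_measure M2"
    and A: "integrable M1 A" and R: "integrable M2 R"
    and c: "(\<lambda>(z,x). c z x) \<in> borel_measurable (M1 \<Otimes>\<^sub>M M2)" and B: "\<And>z x. norm (c z x) \<le> B"
  shows fubini_bounded_kernel_integrable: "integrable M1 (\<lambda>z. A z * (\<integral>x. c z x * R x \<partial>M2))"
    and fubini_bounded_kernel: "(\<integral>z. A z * (\<integral>x. c z x * R x \<partial>M2) \<partial>M1) = (\<integral>x. (\<integral>z. A z * c z x \<partial>M1) * R x \<partial>M2)"
proof -
  interpret M1: sigma_finite_measure M1 by (rule sf)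
  interpret M2: sigma_finite_measure M2 by (rule sf)
  interpret P: pair_sigma_finite M1 M2 ..
  have [measurable]: "A \<in> borel_measurable M1" "R \<in> borel_measurable M2" using A R by auto
  have prod: "integrable (M1 \<Otimes>\<^sub>M M2) (\<lambda>(z,x). A z * R x)"
  proof (rule P.Fubini_integrable)
    show "(\<lambda>(z,x). A z * R x) \<in> borel_measurable (M1 \<Otimes>\<^sub>M M2)" by measurable
    show "integrable M1 (\<lambda>z. \<integral>x. norm (case (z,x) of (z,x) \<Rightarrow> A z * R x) \<partial>M2)"
      using A R by (simp add: norm_mult)
    show "AE z in M1. integrable M2 (\<lambda>x. case (z,x) of (z,x) \<Rightarrow> A z * R x)" using R by simp
  qed
  have int: "integrable (M1 \<Otimes>\<^sub>M M2) (\<lambda>(z,x). A z * c z x * R x)"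
  proof (rule Bochner_Integration.integrable_bound[of _ "\<lambda>(z,x). of_real B * (A z * R x)"])
    have "integrable (M1 \<Otimes>\<^sub>M M2) (\<lambda>p. of_real B * (case p of (z,x) \<Rightarrow> A z * R x))" using prod by simp
    then show "integrable (M1 \<Otimes>\<^sub>M M2) (\<lambda>(z,x). of_real B * (A z * R x))" by (simp add: case_prod_beta')
    have "(\<lambda>(z,x). A z * (case (z,x) of (z,x) \<Rightarrow> c z x) * R x) \<in> borel_measurable (M1 \<Otimes>\<^sub>M M2)"
      using c by measurable
    then show "(\<lambda>(z,x). A z * c z x * R x) \<in> borel_measurable (M1 \<Otimes>\<^sub>M M2)" by simp
    have "norm (A z * c z x * R x) \<le> norm (of_real B * (A z * R x))" for z x
    proof -
      have "norm (c z x) \<le> \<bar>B\<bar>" using B[of z x] by linarith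
      then have "norm (c z x) * norm (A z * R x) \<le> \<bar>B\<bar> * norm (A z * R x)" by (intro mult_right_mono) auto
      then show ?thesis by (simp add: norm_mult mult_ac)
    qed
    then show "AE p in M1 \<Otimes>\<^sub>M M2. norm (case p of (z,x) \<Rightarrow> A z * c z x * R x) \<le> norm (case p of (z,x) \<Rightarrow> of_real B * (A z * R x))"
      by (intro AE_I2) (auto simp: case_prod_beta')
  qed
  show "integrable M1 (\<lambda>z. A z * (\<integral>x. c z x * R x \<partial>M2))"
    using P.integrable_fst[OF int] by (simp add: mult.assoc)
  have "(\<integral>z. A z * (\<integral>x. c z x * R x \<partial>M2) \<partial>M1) = (\<integral>z. (\<integral>x. A z * c z x * R x \<partial>M2) \<partial>M1)"
    by (simp add: mult.assoc)
  also have "\<dots> = (\<integral>x. (\<integral>z. A z * c z x * R x \<partial>M1) \<partial>M2)"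
    using P.Fubini_integral[OF int] by simp
  also have "\<dots> = (\<integral>x. (\<integral>z. A z * c z x \<partial>M1) * R x \<partial>M2)" by simp
  finally show "(\<integral>z. A z * (\<integral>x. c z x * R x \<partial>M2) \<partial>M1) = (\<integral>x. (\<integral>z. A z * c z x \<partial>M1) * R x \<partial>M2)" .
qed

text \<open>Commutativity of convolution: substitute \<open>- (y + x)\<close> for \<open>x\<close>
  and use that bumps are radial.\<close>

lemma bump_convolution_commute:
  assumes e: "e > 0" "d > 0"
  shows "(\<integral>x. complex_of_real (bump e (y + x)) * of_real (bump d x) \<partial>lborel) =
         (\<integral>x. complex_of_real (bump d (y + x)) * of_real (bump e x) \<partial>(lborel :: 'a::euclidean_space measure))"
proof -
  note [measurable] = bump_measurable[OF e(1)] bump_measurable[OF e(2)]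
  let ?k = "\<lambda>x. complex_of_real (bump e (y + x)) * of_real (bump d x)"
  have "(\<integral>x. ?k x \<partial>lborel) = (\<integral>x. ?k (- x) \<partial>lborel)"
    by (rule integral_reflect[symmetric]) measurable
  also have "\<dots> = (\<integral>x. ?k (- (y + x)) \<partial>lborel)"
    by (rule integral_translate[symmetric, of "\<lambda>x. ?k (- x)"]) measurable
  also have "\<dots> = (\<integral>x. complex_of_real (bump d (y + x)) * of_real (bump e x) \<partial>lborel)"
  proof (rule Bochner_Integration.integral_cong[OF refl])
    fix x
    have "bump e (y + - (y + x)) = bump e x" by (rule bump_radial[OF e(1)]) simp
    moreover have "bump d (- (y + x)) = bump d (y + x)" by (rule bump_radial[OF e(2)]) (rule norm_minus_cancel)
    ultimately show "?k (- (y + x)) = complex_of_real (bump d (y + x)) * of_real (bump e x)"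
      by (simp only: mult.commute)
  qed
  finally show ?thesis .
qed

lemma cball_subset_open_enlarge:
  fixes w :: "'a::euclidean_space"
  assumes G: "open G" and e: "cball w e \<subseteq> G" "e > 0"
  shows "\<exists>d>0. cball w (e + d) \<subseteq> G"
proof -
  obtain r where r: "r > 0" "(\<Union>x\<in>cball w e. ball x r) \<subseteq> G"
    using compact_subset_open_imp_ball_epsilon_subset[OF compact_cball G e(1)] by blast
  have "cball w (e + r/2) \<subseteq> G"
  proof
    fix y assume y: "y \<in> cball w (e + r/2)"
    show "y \<in> G"
    proof (cases "dist w y \<le> e")
      case True
      then show ?thesis using e by auto
    next
      case False
      \<comment> \<open>With this factor \<open>x\<close> is the point of \<open>cball w e\<close>
        on the segment from \<open>w\<close> to \<open>y\<close>, at distance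
        \<open>norm (y - w) - e\<close> from \<open>y\<close>.\<close>
      define t where "t = e / norm (y - w)"
      have n: "norm (y - w) > e" using False by (simp add: dist_norm norm_minus_commute)
      then have np: "norm (y - w) > 0" using e by linarith
      then have t: "0 < t" "t < 1" unfolding t_def using n e by simp_all
      define x where "x = w + t *\<^sub>R (y - w)"
      have "dist w x = t * norm (y - w)" using t by (simp add: x_def dist_norm)
      then have "dist w x = e" using np by (simp add: t_def)
      have "y - x = (1 - t) *\<^sub>R (y - w)" by (simp add: x_def algebra_simps)
      then have "norm (y - x) = (1 - t) * norm (y - w)" using t by simp
      then have "dist x y = (1 - t) * norm (y - w)" by (simp only: dist_norm norm_minus_commute[of x y])
      moreover have "t * norm (y - w) = e" using np by (simp add: t_def)
      ultimately have "dist x y = norm (y - w) - e" by (simp add: left_diff_distrib)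
      then have "dist x y < r" using y r by (simp add: dist_norm norm_minus_commute)
      then have "y \<in> ball x r" by simp
      moreover have "x \<in> cball w e" using \<open>dist w x = e\<close> by simp
      ultimately show ?thesis using r(2) by blast
    qed
  qed
  then show ?thesis using r by (intro exI[of _ "r/2"]) auto
qed

lemma open_cball_inside:
  fixes G :: "'a::euclidean_space set"
  assumes "open G" "e > 0"
  shows "open {w. cball w e \<subseteq> G}"
  unfolding open_contains_ball
proof
  fix w assume "w \<in> {w. cball w e \<subseteq> G}"
  then obtain d where d: "d > 0" "cball w (e + d) \<subseteq> G" using cball_subset_open_enlarge[OF assms(1) _ assms(2)] by blast
  have "cball v e \<subseteq> G" if "v \<in> ball w d" for v
  proof
    fix y assume "y \<in> cball v e"
    then have "y \<in> cball w (e + d)" using that dist_triangle[of w y v] by auto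
    then show "y \<in> G" using d by blast
  qed
  then show "\<exists>d>0. ball w d \<subseteq> {w. cball w e \<subseteq> G}" using d by blast
qed

text \<open>With open balls the condition on the centre is closed, with closed balls it is open;
  combining the two kinds gives open sets inside compact ones.\<close>

lemma compact_ball_inside:
  fixes G :: "'a::euclidean_space set"
  assumes "bounded G" "e > 0"
  shows "compact {w. ball w e \<subseteq> G}" "{w. ball w e \<subseteq> G} \<subseteq> G"
proof -
  have sub: "{w. ball w e \<subseteq> G} \<subseteq> G" using assms(2) by auto
  then show "{w. ball w e \<subseteq> G} \<subseteq> G" .
  have "closed {w. ball w e \<subseteq> G}"
  proof -
    have "{w. ball w e \<subseteq> G} = - (\<Union>y\<in>- G. ball y e)" by (auto simp: dist_commute)
    then show ?thesis by (simp add: closed_def open_UN)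
  qed
  then show "compact {w. ball w e \<subseteq> G}"
    using bounded_subset[OF assms(1) sub] compact_eq_bounded_closed by blast
qed

lemma bump_deriv_uminus: "bump_deriv e x (- v) = - bump_deriv e x v"
  by (simp add: bump_deriv_def)

text \<open>Boundedness of \<open>D\<close>, connectedness of \<open>G\<close> and the circle action
  are added as hypotheses of the individual lemmas.\<close>

locale proper_hol_map =
  fixes D G :: "(complex^'n::finite) set" and f :: "complex^'n \<Rightarrow> complex^'n"
  assumes D: "open D" and G: "open G" "bounded G" and f: "holomorphic_map_on f D" and fDG: "f ` D \<subseteq> G"
    and proper: "\<And>C. compact C \<Longrightarrow> C \<subseteq> G \<Longrightarrow> compact {z \<in> D. f z \<in> C}"
begin

definition jac :: "complex^'n \<Rightarrow> complex" where "jac z = det (cjacobian f z)"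

text \<open>A Borel function on the whole space that agrees with \<open>f\<close> on
  \<open>D\<close>; outside \<open>D\<close> the values of \<open>f\<close> are arbitrary.\<close>

definition fD :: "complex^'n \<Rightarrow> complex^'n" where "fD z = indicator D z *\<^sub>R f z"

text \<open>The push-forward of the density \<open>cnj J * b\<close>, averaged with a bump of radius
  \<open>e\<close> around \<open>w\<close>. As long as \<open>cball w e\<close> lies in
  \<open>G\<close> the average turns out not to depend on \<open>e\<close>.\<close>

definition push :: "(complex^'n \<Rightarrow> complex) \<Rightarrow> real \<Rightarrow> complex^'n \<Rightarrow> complex" where
  "push b e w = (\<integral>z. (indicator D z *\<^sub>R (cnj (jac z) * b z)) * of_real (bump e (w - f z)) \<partial>lborel)"

lemma hol_jac: "holomorphic_fun_on jac D"
  unfolding jac_def by (rule hol_jacobian_det[OF f D])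

lemma fD_measurable [measurable]: "fD \<in> borel_measurable borel"
  unfolding fD_def using D hol_continuous[OF f] by (intro borel_measurable_continuous_on_indicator) auto

lemma continuous_weight: "holomorphic_fun_on b D \<Longrightarrow> continuous_on D (\<lambda>z. cnj (jac z) * b z)"
  by (intro continuous_intros hol_continuous[OF hol_jac] hol_continuous[of _ _ b])

lemma weight_integrable:
  assumes b: "holomorphic_fun_on b D" and C: "compact C" "C \<subseteq> G"
  shows "integrable lborel (\<lambda>z. indicator {z \<in> D. f z \<in> C} z *\<^sub>R (cnj (jac z) * b z))"
  by (intro borel_integrable_compact proper C continuous_on_subset[OF continuous_weight[OF b]]) auto

text \<open>To be used with \<open>C\<close> compact in \<open>G\<close>: on its preimage the weight
  is integrable, which is not known on all of \<open>D\<close>. Values of \<open>f\<close> outside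
  \<open>C\<close> are out of reach of the bump.\<close>

lemma push_restrict:
  assumes "e > 0" and C: "\<And>y. y \<in> G \<Longrightarrow> dist w y < e \<Longrightarrow> y \<in> C"
  shows "push b e w = (\<integral>z. (indicator {z \<in> D. f z \<in> C} z *\<^sub>R (cnj (jac z) * b z)) * of_real (bump e (w - fD z)) \<partial>lborel)"
  unfolding push_def
proof (rule Bochner_Integration.integral_cong[OF refl])
  fix z
  show "(indicator D z *\<^sub>R (cnj (jac z) * b z)) * of_real (bump e (w - f z)) =
    (indicator {z \<in> D. f z \<in> C} z *\<^sub>R (cnj (jac z) * b z)) * of_real (bump e (w - fD z))"
  proof (cases "z \<in> D \<and> f z \<notin> C")
    case True
    then have "\<not> dist w (f z) < e" using C fDG by blast
    then have "bump e (w - f z) = 0" using bump_zero[OF assms(1), of "w - f z"] by (simp add: dist_norm)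
    then show ?thesis using True by (simp add: fD_def)
  qed (auto simp: fD_def indicator_def)
qed

text \<open>Differentiation under the integral falls on the bump alone. Applying \<open>dbar\<close>
  yields the integral of \<open>integral_transform_dbar\<close>, which is zero, so the real
  derivative is complex linear.\<close>

lemma push_holomorphic:
  assumes b: "holomorphic_fun_on b D" and e: "e > 0"
  shows "holomorphic_fun_on (push b e) {w. cball w e \<subseteq> G}"
  unfolding hol_iff_complex_linear[OF open_cball_inside[OF G(1) e]]
proof
  fix w assume "w \<in> {w. cball w e \<subseteq> G}"
  then have we: "cball w e \<subseteq> G" by simp
  \<comment> \<open>The slack \<open>d\<close> allows one compact preimage to serve for all centres
    in \<open>ball w d\<close>.\<close>
  then obtain d where d: "d > 0" "cball w (e + d) \<subseteq> G" using cball_subset_open_enlarge[OF G(1) _ e] by blast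
  define K where "K = {z \<in> D. f z \<in> cball w (e + d)}"
  define A where "A = (\<lambda>z. indicator K z *\<^sub>R (cnj (jac z) * b z))"
  have Aint: "integrable lborel A" unfolding A_def K_def by (rule weight_integrable[OF b compact_cball d(2)])
  then have [measurable]: "A \<in> borel_measurable borel" by simp
  note [measurable] = bump_measurable[OF e]
  define F where "F = (\<lambda>v z. A z * complex_of_real (bump e (v - fD z)))"
  define L where "L = (\<lambda>z v. A z * complex_of_real (bump_deriv e (w - fD z) v))"
  obtain B where B: "B > 0" "\<And>(x::complex^'n) v. \<bar>bump_deriv e x v\<bar> \<le> B * norm v" using bump_deriv_bound[OF e] by blast
  obtain B0 where B0: "B0 > 0" "\<And>x::complex^'n. bump e x \<le> B0" using bump_bound[OF e] by blast
  have pushF: "push b e v = (\<integral>z. F v z \<partial>lborel)" if v: "v \<in> ball w d" for v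
    unfolding F_def A_def K_def
  proof (rule push_restrict[OF e])
    fix y assume "dist v y < e"
    then show "y \<in> cball w (e + d)" using v dist_triangle[of w y v] by auto
  qed
  have lipb: "\<bar>bump e (x + v) - bump e x\<bar> \<le> B * norm v" for x v :: "complex^'n"
  proof -
    have "norm (bump e (x + v) - bump e x) \<le> B * norm (x + v - x)"
    proof (rule differentiable_bound[of UNIV "bump e" "bump_deriv e"])
      show "(bump e has_derivative bump_deriv e y) (at y within UNIV)" for y :: "complex^'n"
        by (rule bump_has_derivative[OF e])
      show "onorm (bump_deriv e y) \<le> B" for y :: "complex^'n" using B by (intro onorm_bound) auto
    qed auto
    then show ?thesis by simp
  qed
  have intF: "integrable lborel (F (w + v))" for v
  proof (rule Bochner_Integration.integrable_bound)
    show "integrable lborel (\<lambda>z. of_real B0 * A z)" using Aint by simp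
    show "F (w + v) \<in> borel_measurable lborel" unfolding F_def by measurable
    show "AE z in lborel. norm (F (w + v) z) \<le> norm (of_real B0 * A z)"
      using B0 by (intro AE_I2) (auto simp: F_def norm_mult mult.commute[of _ "bump e _"] bump_nonneg[OF e] intro!: mult_right_mono)
  qed
  have derF: "((\<lambda>v. F v z) has_derivative L z) (at w)" for z
  proof -
    have "((\<lambda>v. v - fD z) has_derivative (\<lambda>v. v)) (at w)" by (auto intro!: derivative_eq_intros)
    from has_derivative_compose[OF this bump_has_derivative[OF e]]
    have "((\<lambda>v. bump e (v - fD z)) has_derivative bump_deriv e (w - fD z)) (at w)" .
    then have "((\<lambda>v. complex_of_real (bump e (v - fD z))) has_derivative (\<lambda>v. of_real (bump_deriv e (w - fD z) v))) (at w)"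
      by (rule bounded_linear.has_derivative[OF bounded_linear_of_real])
    then show ?thesis unfolding F_def L_def by (rule has_derivative_mult_right)
  qed
  have lipF: "norm (F (w + v) z - F w z) \<le> (B * norm (A z)) * norm v" for v z
  proof -
    have "F (w + v) z - F w z = A z * of_real (bump e ((w - fD z) + v) - bump e (w - fD z))"
      by (simp add: F_def algebra_simps)
    then have "norm (F (w + v) z - F w z) = norm (A z) * \<bar>bump e ((w - fD z) + v) - bump e (w - fD z)\<bar>"
      by (simp only: norm_mult norm_of_real)
    also have "\<dots> \<le> norm (A z) * (B * norm v)" by (intro mult_left_mono lipb) auto
    finally show ?thesis by (simp add: mult_ac)
  qed
  have Bint: "integrable lborel (\<lambda>z. B * norm (A z))" using Aint by simp
  note DI = derivative_lebesgue_integral[of d lborel F w L "\<lambda>z. B * norm (A z)"]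
  have iL: "integrable lborel (\<lambda>z. L z v)" for v
    by (rule DI(1)) (use d intF derF lipF Bint in auto)
  define \<Lambda> where "\<Lambda> = (\<lambda>v. \<integral>z. L z v \<partial>lborel)"
  have der: "((\<lambda>v. \<integral>z. F v z \<partial>lborel) has_derivative \<Lambda>) (at w)"
    unfolding \<Lambda>_def by (rule DI(2)) (use d intF derF lipF Bint in auto)
  then have derp: "(push b e has_derivative \<Lambda>) (at w)"
    by (rule has_derivative_transform_within_open[of _ _ _ _ "ball w d"]) (use d pushF in auto)
  then have lin: "linear \<Lambda>" using has_derivative_bounded_linear bounded_linear.linear by blast
  have "dbar \<Lambda> (axis j 1) = 0" for j
  proof -
    have "dbar \<Lambda> (axis j 1) = (\<integral>z. L z (axis j 1) + \<i> * L z (\<i> *s axis j 1) \<partial>lborel)"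
      unfolding dbar_def \<Lambda>_def using iL by simp
    \<comment> \<open>The sign appears because the test function is \<open>bump e (w - y)\<close> as
      a function of \<open>y\<close>, whereas \<open>push\<close> is differentiated in
      \<open>w\<close>.\<close>
    also have "\<dots> = - (\<integral>z. indicator D z *\<^sub>R (cnj (det (cjacobian f z)) * b z *
        dbar (\<lambda>v. complex_of_real (bump_deriv e (w - f z) (- v))) (axis j 1)) \<partial>lborel)"
      unfolding Bochner_Integration.integral_minus[symmetric]
    proof (rule Bochner_Integration.integral_cong[OF refl])
      fix z
      have "bump_deriv e (w - f z) v = 0" if "z \<in> D" "z \<notin> K" for v
      proof -
        have "norm (w - f z) > e" using that d by (auto simp: K_def dist_norm)
        then have "e\<^sup>2 \<le> (norm (w - f z))\<^sup>2" using e by (intro power_mono) auto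
        then show ?thesis by (simp add: bump_deriv_def dot_square_norm)
      qed
      then show "L z (axis j 1) + \<i> * L z (\<i> *s axis j 1) = - (indicator D z *\<^sub>R (cnj (det (cjacobian f z)) * b z *
        dbar (\<lambda>v. complex_of_real (bump_deriv e (w - f z) (- v))) (axis j 1)))"
        by (auto simp: L_def A_def dbar_def bump_deriv_uminus jac_def fD_def indicator_def K_def algebra_simps)
    qed
    also have "\<dots> = 0"
      using integral_transform_dbar[OF D f proper[OF compact_cball we] test_function_bump[OF e] b, of j] by simp
    finally show ?thesis .
  qed
  then have "dbar \<Lambda> v = 0" for v using dbar_expand[OF lin, of v] by simp
  then have i\<Lambda>: "\<Lambda> (\<i> *s v) = \<i> * \<Lambda> v" for v
  proof -
    have "\<i> * (\<Lambda> v + \<i> * \<Lambda> (\<i> *s v)) = 0" using \<open>\<And>v. dbar \<Lambda> v = 0\<close>[of v] by (simp add: dbar_def)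
    then have "\<i> * \<Lambda> v - \<Lambda> (\<i> *s v) = 0" by (simp add: distrib_left mult.assoc[symmetric])
    then show ?thesis by simp
  qed
  have "\<Lambda> (c *s v) = c * \<Lambda> v" for c v
  proof -
    have "\<Lambda> (c *s v) = Re c *\<^sub>R \<Lambda> v + Im c *\<^sub>R \<Lambda> (\<i> *s v)"
      using complex_scale_split[of c v] lin by (simp add: linear_add linear_cmul)
    also have "\<dots> = (of_real (Re c) + \<i> * of_real (Im c)) * \<Lambda> v"
      by (simp add: i\<Lambda> scaleR_conv_of_real algebra_simps)
    finally show ?thesis using complex_eq[of c] by simp
  qed
  then have "complex_linear \<Lambda>" using lin by (simp add: complex_linear_def linear_add)
  then show "\<exists>L. (push b e has_derivative L) (at w) \<and> complex_linear L" using derp by blast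
qed

lemma push_convolution:
  assumes b: "holomorphic_fun_on b D" and e: "e > 0" and d: "d > 0" and w: "cball w (e + d) \<subseteq> G"
  shows "push b e w = (\<integral>z. (indicator {z \<in> D. f z \<in> cball w (e + d)} z *\<^sub>R (cnj (jac z) * b z)) *
      (\<integral>x. complex_of_real (bump e ((w - fD z) + x)) * of_real (bump d x) \<partial>lborel) \<partial>lborel)"
proof -
  define A where "A = (\<lambda>z. indicator {z \<in> D. f z \<in> cball w (e + d)} z *\<^sub>R (cnj (jac z) * b z))"
  have Aint: "integrable lborel A" unfolding A_def by (rule weight_integrable[OF b compact_cball w])
  note [measurable] = bump_measurable[OF e]
  obtain B0 where B0: "B0 > 0" "\<And>x::complex^'n. bump e x \<le> B0" using bump_bound[OF e] by blast
  have sub: "cball w d \<subseteq> {w. cball w e \<subseteq> G}"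
  proof
    fix v assume v: "v \<in> cball w d"
    have "cball v e \<subseteq> cball w (e + d)"
    proof
      fix y assume "y \<in> cball v e"
      then show "y \<in> cball w (e + d)" using v dist_triangle[of w y v] by auto
    qed
    then show "v \<in> {w. cball w e \<subseteq> G}" using w by blast
  qed
  have "push b e w = (\<integral>x. indicator (ball 0 d) x *\<^sub>R (push b e (w + x) * of_real (bump d x)) \<partial>lborel)"
    using hol_mean_value[OF d push_holomorphic[OF b e] open_cball_inside[OF G(1) e] sub] by simp
  also have "\<dots> = (\<integral>x. (\<integral>z. A z * of_real (bump e ((w - fD z) + x)) \<partial>lborel) * of_real (bump d x) \<partial>lborel)"
  proof (rule Bochner_Integration.integral_cong[OF refl])
    fix x :: "complex^'n"
    show "indicator (ball 0 d) x *\<^sub>R (push b e (w + x) * of_real (bump d x)) =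
      (\<integral>z. A z * of_real (bump e ((w - fD z) + x)) \<partial>lborel) * of_real (bump d x)"
    proof (cases "norm x < d")
      case True
      have "push b e (w + x) = (\<integral>z. A z * of_real (bump e ((w + x) - fD z)) \<partial>lborel)"
        unfolding A_def
      proof (rule push_restrict[OF e])
        fix y assume y: "dist (w + x) y < e"
        have "dist w (w + x) < d" using True by (simp add: dist_norm)
        then show "y \<in> cball w (e + d)" using y dist_triangle[of w y "w + x"] by simp
      qed
      then show ?thesis using True by (simp add: algebra_simps)
    next
      case False
      then show ?thesis using bump_zero[OF d, of x] by simp
    qed
  qed
  also have "\<dots> = (\<integral>z. A z * (\<integral>x. complex_of_real (bump e ((w - fD z) + x)) * of_real (bump d x) \<partial>lborel) \<partial>lborel)"
  proof (rule fubini_bounded_kernel[symmetric, where B = B0])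
    show "integrable lborel (\<lambda>x::complex^'n. complex_of_real (bump d x))"
      using integrable_bump[OF d] by (intro integrable_of_real)
    show "norm (complex_of_real (bump e ((w - fD z) + x))) \<le> B0" for z x
      using B0 by (simp add: bump_nonneg[OF e])
  qed (auto intro: Aint lborel.sigma_finite_measure_axioms)
  finally show ?thesis by (simp add: A_def)
qed

text \<open>Since \<open>push b e\<close> is holomorphic, averaging it against \<open>bump d\<close> reproduces it; but that amounts to
  testing with the convolution of the two bump functions, which is symmetric in \<open>e\<close> and \<open>d\<close>.\<close>

lemma push_independent:
  assumes b: "holomorphic_fun_on b D" and e: "e > 0" "cball w e \<subseteq> G" and d: "d > 0" "cball w d \<subseteq> G"
  shows "push b e w = push b d w"
proof -
  have aux: "push b e w = push b d w" if "e > 0" "d > 0" "cball w (e + d) \<subseteq> G" for e d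
    proof -
    have w': "cball w (d + e) \<subseteq> G" using that(3) by (simp add: add.commute)
    note eq = bump_convolution_commute[OF that(1,2), of "w - fD z" for z]
    show ?thesis
      unfolding push_convolution[OF b that] push_convolution[OF b that(2,1) w'] add.commute[of d e] eq ..
  qed
  obtain e1 where e1: "e1 > 0" "cball w (e + e1) \<subseteq> G" using cball_subset_open_enlarge[OF G(1) e(2,1)] by blast
  obtain d1 where d1: "d1 > 0" "cball w (d + d1) \<subseteq> G" using cball_subset_open_enlarge[OF G(1) d(2,1)] by blast
  \<comment> \<open>A ball of radius \<open>e + d\<close> need not fit into \<open>G\<close>, so
    both radii are compared with a third, small one.\<close>
  define r where "r = min e1 d1"
  have "cball w (e + r) \<subseteq> cball w (e + e1)" "cball w (d + r) \<subseteq> cball w (d + d1)" by (auto simp: r_def)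
  then have "push b e w = push b r w" "push b d w = push b r w"
    using e1 d1 e d by (auto intro!: aux simp: r_def)
  then show ?thesis by simp
qed

text \<open>The holomorphic density of the push-forward. At a regular value \<open>w\<close> this is
  the classical trace, the sum of \<open>b z / jac z\<close> over the preimages \<open>z\<close> of
  \<open>w\<close>.\<close>

definition trace_fun :: "(complex^'n \<Rightarrow> complex) \<Rightarrow> complex^'n \<Rightarrow> complex" where
  "trace_fun b w = push b (SOME e. e > 0 \<and> cball w e \<subseteq> G) w"

lemma trace_fun_eq:
  assumes b: "holomorphic_fun_on b D" and e: "e > 0" "cball w e \<subseteq> G"
  shows "trace_fun b w = push b e w"
proof -
  have "(SOME e. e > 0 \<and> cball w e \<subseteq> G) > 0 \<and> cball w (SOME e. e > 0 \<and> cball w e \<subseteq> G) \<subseteq> G"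
    by (rule someI[of _ e]) (use e in simp)
  then show ?thesis unfolding trace_fun_def by (intro push_independent[OF b]) (use e in auto)
qed

lemma trace_fun_holomorphic:
  assumes b: "holomorphic_fun_on b D"
  shows "holomorphic_fun_on (trace_fun b) G"
proof (rule hol_locally[OF G(1)])
  fix w assume "w \<in> G"
  then obtain e where e: "e > 0" "cball w e \<subseteq> G" using G open_contains_cball by blast
  have o: "open {w. cball w e \<subseteq> G}" by (rule open_cball_inside[OF G(1) e(1)])
  have "holomorphic_fun_on (trace_fun b) {w. cball w e \<subseteq> G}"
    by (rule hol_transform[OF o push_holomorphic[OF b e(1)]]) (use trace_fun_eq[OF b e(1)] in auto)
  then show "\<exists>T. open T \<and> w \<in> T \<and> holomorphic_fun_on (trace_fun b) T" using o e by blast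
qed

end

lemma hol_real_valued_constant:
  fixes h :: "complex^'n::finite \<Rightarrow> complex"
  assumes S: "open S" "connected S" and h: "holomorphic_fun_on h S" and real: "\<And>z. z \<in> S \<Longrightarrow> Im (h z) = 0"
    and x: "x \<in> S" "y \<in> S"
  shows "h x = h y"
proof (rule has_derivative_zero_unique_connected[OF S _ x])
  fix z assume z: "z \<in> S"
  obtain L where L: "(h has_derivative L) (at z)" "complex_linear L" using h z hol_iff_complex_linear[OF S(1)] by meson
  have "((\<lambda>z. Im (h z)) has_derivative (\<lambda>v. Im (L v))) (at z)"
    by (rule bounded_linear.has_derivative[OF bounded_linear_Im L(1)])
  moreover have "((\<lambda>z. Im (h z)) has_derivative (\<lambda>v. 0)) (at z)"
    by (rule has_derivative_transform_within_open[of "\<lambda>_. 0" _ _ _ S]) (use S z real in auto)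
  ultimately have "(\<lambda>v. Im (L v)) = (\<lambda>v. 0)" by (rule has_derivative_unique)
  then have Im0: "Im (L v) = 0" for v by metis
  have "L v = 0" for v
  proof -
    have "L (\<i> *s v) = \<i> * L v" using L(2) by (simp add: complex_linear_def)
    then have "Im (\<i> * L v) = 0" using Im0[of "\<i> *s v"] by simp
    then show ?thesis using Im0[of v] by (simp add: complex_eq_iff)
  qed
  then have "L = (\<lambda>_. 0)" by blast
  then show "(h has_derivative (\<lambda>_. 0)) (at z)" using L(1) by simp
qed

context proper_hol_map
begin

text \<open>These sets exhaust \<open>G\<close>, are relatively compact in it and invariant under the circle action, so
  \<open>trace_fun b\<close>, whose integrability over \<open>G\<close> is not clear, can safely be integrated over them.\<close>

abbreviation inner_set :: "real \<Rightarrow> (complex^'n) set" where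
  "inner_set e \<equiv> {w. cball w (2 * e) \<subseteq> G}"

text \<open>What \<open>cnj q\<close> becomes when the bump averaging the push-forward is moved onto
  it.\<close>

definition smoothing :: "real \<Rightarrow> (complex^'n \<Rightarrow> complex) \<Rightarrow> complex^'n \<Rightarrow> complex" where
  "smoothing e q y = (\<integral>w. of_real (bump e (w - y)) * (indicator (inner_set e) w *\<^sub>R cnj (q w)) \<partial>lborel)"

lemma open_inner_set: "e > 0 \<Longrightarrow> open (inner_set e)"
  by (rule open_cball_inside[OF G(1)]) simp

lemma inner_set_subset: "e > 0 \<Longrightarrow> inner_set e \<subseteq> G"
  by force

lemma bounded_subset_integrable:
  fixes q :: "complex^'n \<Rightarrow> complex"
  assumes q: "continuous_on UNIV q" and W: "open W" "W \<subseteq> G"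
  shows "integrable lborel (\<lambda>w. indicator W w *\<^sub>R q w)"
proof -
  obtain R where R: "\<And>x. x \<in> G \<Longrightarrow> norm x \<le> R" using G(2) bounded_iff by blast
  have "integrable lborel (\<lambda>w. indicator W w *\<^sub>R (indicator (cball 0 R) w *\<^sub>R q w))"
    by (intro integrable_mult_indicator borel_integrable_compact) (use W q in \<open>auto intro: continuous_on_subset\<close>)
  moreover have "(\<lambda>w. indicator W w *\<^sub>R (indicator (cball 0 R) w *\<^sub>R q w)) = (\<lambda>w. indicator W w *\<^sub>R q w)"
    using R W by (auto simp: indicator_def fun_eq_iff)
  ultimately show ?thesis by simp
qed

text \<open>Fubini moves the bump from the push-forward to \<open>q\<close>. The radius
  \<open>2 * e\<close> in \<open>inner_set\<close> leaves room: every point within \<open>e\<close>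
  of that set lies in the compact \<open>C\<close>, over whose preimage the weight is
  integrable.\<close>

lemma
  assumes b: "holomorphic_fun_on b D" and e: "e > 0" and q: "continuous_on UNIV q"
  shows smoothing_integrable: "integrable lborel (\<lambda>z. (indicator D z *\<^sub>R (cnj (jac z) * b z)) * smoothing e q (f z))"
    and trace_pairing: "(\<integral>w. indicator (inner_set e) w *\<^sub>R (trace_fun b w * cnj (q w)) \<partial>lborel) =
      (\<integral>z. (indicator D z *\<^sub>R (cnj (jac z) * b z)) * smoothing e q (f z) \<partial>lborel)"
proof -
  let ?W = "inner_set e"
  define C where "C = {w. ball w e \<subseteq> G}"
  have C: "compact C" "C \<subseteq> G" unfolding C_def by (rule compact_ball_inside[OF G(2) e])+
  define A where "A = (\<lambda>z. indicator {z \<in> D. f z \<in> C} z *\<^sub>R (cnj (jac z) * b z))"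
  define R where "R = (\<lambda>w. indicator ?W w *\<^sub>R cnj (q w))"
  have A: "integrable lborel A" unfolding A_def by (rule weight_integrable[OF b C])
  have R: "integrable lborel R"
    unfolding R_def by (intro bounded_subset_integrable continuous_intros q open_inner_set e inner_set_subset)
  note [measurable] = bump_measurable[OF e]
  obtain B0 where B0: "B0 > 0" "\<And>x::complex^'n. bump e x \<le> B0" using bump_bound[OF e] by blast
  have near: "y \<in> C" if "w \<in> ?W" "dist w y < e" for w y
  proof -
    have "ball y e \<subseteq> cball w (2 * e)"
    proof
      fix x assume "x \<in> ball y e"
      then show "x \<in> cball w (2 * e)" using that(2) dist_triangle[of w x y] by simp
    qed
    then show ?thesis using that by (auto simp: C_def)
  qed
  have c: "(\<lambda>(z,x). complex_of_real (bump e (x - fD z))) \<in> borel_measurable (lborel \<Otimes>\<^sub>M lborel)"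
    by measurable
  have cB: "norm (complex_of_real (bump e (x - fD z))) \<le> B0" for z x
    using B0 by (simp add: bump_nonneg[OF e])
  note F = lborel.sigma_finite_measure_axioms lborel.sigma_finite_measure_axioms A R c cB
  have Asm: "A z * (\<integral>x. complex_of_real (bump e (x - fD z)) * R x \<partial>lborel) =
     (indicator D z *\<^sub>R (cnj (jac z) * b z)) * smoothing e q (f z)" for z
  proof (cases "z \<in> D \<and> f z \<notin> C")
    case True
    have zk: "complex_of_real (bump e (w - f z)) * (indicator ?W w *\<^sub>R cnj (q w)) = 0" for w
    proof (cases "w \<in> ?W")
      case True
      then have "\<not> dist w (f z) < e" using near \<open>z \<in> D \<and> f z \<notin> C\<close> by blast
      then show ?thesis using bump_zero[OF e, of "w - f z"] by (simp add: dist_norm)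
    qed simp
    have "smoothing e q (f z) = 0" unfolding smoothing_def zk by simp
    then show ?thesis using True by (simp add: A_def)
  qed (auto simp: A_def smoothing_def R_def fD_def indicator_def)
  show "integrable lborel (\<lambda>z. (indicator D z *\<^sub>R (cnj (jac z) * b z)) * smoothing e q (f z))"
    using fubini_bounded_kernel_integrable[OF F] unfolding Asm .
  have "(\<integral>w. indicator ?W w *\<^sub>R (trace_fun b w * cnj (q w)) \<partial>lborel) =
    (\<integral>w. (\<integral>z. A z * complex_of_real (bump e (w - fD z)) \<partial>lborel) * R w \<partial>lborel)"
  proof (rule Bochner_Integration.integral_cong[OF refl])
    fix w
    show "indicator ?W w *\<^sub>R (trace_fun b w * cnj (q w)) = (\<integral>z. A z * complex_of_real (bump e (w - fD z)) \<partial>lborel) * R w"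
    proof (cases "w \<in> ?W")
      case True
      have "cball w e \<subseteq> G" using True e by (auto simp: subset_eq)
      then have "trace_fun b w = push b e w" by (rule trace_fun_eq[OF b e])
      also have "\<dots> = (\<integral>z. A z * complex_of_real (bump e (w - fD z)) \<partial>lborel)"
        unfolding A_def by (rule push_restrict[OF e]) (use near[OF True] in blast)
      finally show ?thesis using True by (simp add: R_def)
    qed (simp add: R_def)
  qed
  also have "\<dots> = (\<integral>z. A z * (\<integral>x. complex_of_real (bump e (x - fD z)) * R x \<partial>lborel) \<partial>lborel)"
    using fubini_bounded_kernel[OF F] by simp
  also have "\<dots> = (\<integral>z. (indicator D z *\<^sub>R (cnj (jac z) * b z)) * smoothing e q (f z) \<partial>lborel)"
    unfolding Asm ..
  finally show "(\<integral>w. indicator ?W w *\<^sub>R (trace_fun b w * cnj (q w)) \<partial>lborel) =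
      (\<integral>z. (indicator D z *\<^sub>R (cnj (jac z) * b z)) * smoothing e q (f z) \<partial>lborel)" .
qed

lemma bump_shift_integral:
  assumes e: "e > 0"
  shows "integrable lborel (\<lambda>w. bump e (w - y))" "(\<integral>w. bump e (w - y) \<partial>(lborel :: (complex^'n) measure)) = 1"
proof -
  note [measurable] = bump_measurable[OF e]
  have "integrable (distr lborel borel ((+) (- y))) (bump e)"
    using integrable_bump[OF e] by (simp add: lborel_distr_plus)
  then have "integrable lborel (\<lambda>w. bump e (- y + w))"
    by (subst (asm) integrable_distr_eq) auto
  then show "integrable lborel (\<lambda>w. bump e (w - y))" by (simp add: add.commute)
  have "(\<integral>w. complex_of_real (bump e (- y + w)) \<partial>lborel) = (\<integral>w. complex_of_real (bump e w) \<partial>(lborel :: (complex^'n) measure))"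
    by (rule integral_translate) measurable
  then have "(\<integral>w. bump e (- y + w) \<partial>lborel) = (\<integral>w. bump e w \<partial>(lborel :: (complex^'n) measure))"
    by (simp only: integral_complex_of_real of_real_eq_iff)
  then show "(\<integral>w. bump e (w - y) \<partial>(lborel :: (complex^'n) measure)) = 1"
    using integral_bump[OF e] by (simp add: add.commute)
qed

lemma smoothing_bound:
  assumes e: "e > 0" and q: "continuous_on UNIV q" and M: "\<And>w. w \<in> G \<Longrightarrow> norm (q w) \<le> M" "M \<ge> 0"
  shows "norm (smoothing e q y) \<le> M"
proof -
  have qm: "q \<in> borel_measurable borel" by (rule borel_measurable_continuous_onI[OF q])
  note [measurable] = bump_measurable[OF e] qm
  have [measurable]: "inner_set e \<in> sets borel" using open_inner_set[OF e] by simp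
  let ?k = "\<lambda>w. of_real (bump e (w - y)) * (indicator (inner_set e) w *\<^sub>R cnj (q w))"
  have kb: "norm (?k w) \<le> M * bump e (w - y)" for w
  proof (cases "w \<in> inner_set e")
    case True
    then have "norm (q w) \<le> M" using M inner_set_subset[OF e] by blast
    then have "norm (q w) * bump e (w - y) \<le> M * bump e (w - y)" by (intro mult_right_mono bump_nonneg[OF e])
    then show ?thesis using True by (simp add: norm_mult bump_nonneg[OF e] mult.commute)
  qed (simp add: M bump_nonneg[OF e])
  have int: "integrable lborel ?k"
  proof (rule Bochner_Integration.integrable_bound)
    show "integrable lborel (\<lambda>w. M * bump e (w - y))" using bump_shift_integral(1)[OF e] by (rule integrable_mult_right)
    show "?k \<in> borel_measurable lborel" by measurable
    show "AE w in lborel. norm (?k w) \<le> norm (M * bump e (w - y))"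
      using kb M by (intro AE_I2) (simp add: abs_mult bump_nonneg[OF e])
  qed
  have "norm (smoothing e q y) \<le> (\<integral>w. norm (?k w) \<partial>lborel)" unfolding smoothing_def by (rule integral_norm_bound)
  also have "\<dots> \<le> (\<integral>w. M * bump e (w - y) \<partial>lborel)"
    by (intro integral_mono integrable_norm int integrable_mult_right bump_shift_integral(1)[OF e] kb)
  also have "\<dots> = M" using bump_shift_integral(2)[OF e] by simp
  finally show ?thesis .
qed

text \<open>Away from the boundary smoothing is exact by the mean value property of
  \<open>q\<close>; the radius \<open>3 * e\<close> ensures that all points within \<open>e\<close>
  of \<open>y\<close> belong to \<open>inner_set e\<close>.\<close>

lemma smoothing_eq:
  assumes e: "e > 0" and q: "holomorphic_fun_on q UNIV" and y: "cball y (3 * e) \<subseteq> G"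
  shows "smoothing e q y = cnj (q y)"
proof -
  have qc: "continuous_on UNIV q" by (rule hol_continuous[OF q])
  have qm: "q \<in> borel_measurable borel" by (rule borel_measurable_continuous_onI[OF qc])
  note [measurable] = bump_measurable[OF e] qm
  have "smoothing e q y = (\<integral>w. of_real (bump e (w - y)) * cnj (q w) \<partial>lborel)"
    unfolding smoothing_def
  proof (rule Bochner_Integration.integral_cong[OF refl])
    fix w
    show "of_real (bump e (w - y)) * (indicator (inner_set e) w *\<^sub>R cnj (q w)) = of_real (bump e (w - y)) * cnj (q w)"
    proof (cases "dist w y < e")
      case True
      have "cball w (2 * e) \<subseteq> cball y (3 * e)"
      proof
        fix x assume "x \<in> cball w (2 * e)"
        then show "x \<in> cball y (3 * e)" using True dist_triangle[of y x w] by (simp add: dist_commute)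
      qed
      then show ?thesis using y by auto
    next
      case False
      then show ?thesis using bump_zero[OF e, of "w - y"] by (simp add: dist_norm)
    qed
  qed
  also have "\<dots> = (\<integral>w. of_real (bump e ((y + w) - y)) * cnj (q (y + w)) \<partial>lborel)"
    by (rule integral_translate[symmetric, of "\<lambda>w. of_real (bump e (w - y)) * cnj (q w)"]) measurable
  also have "\<dots> = (\<integral>w. cnj (indicator (ball 0 e) w *\<^sub>R (q (y + w) * of_real (bump e w))) \<partial>lborel)"
  proof (rule Bochner_Integration.integral_cong[OF refl])
    fix w :: "complex^'n"
    show "of_real (bump e ((y + w) - y)) * cnj (q (y + w)) = cnj (indicator (ball 0 e) w *\<^sub>R (q (y + w) * of_real (bump e w)))"
      using bump_zero[OF e, of w] by (cases "norm w < e") auto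
  qed
  also have "\<dots> = cnj (q y)"
    unfolding Bochner_Integration.integral_cnj using hol_mean_value[OF e q, of y] by simp
  finally show ?thesis .
qed

lemma smoothing_tendsto:
  assumes q: "holomorphic_fun_on q UNIV" and y: "y \<in> G"
  shows "(\<lambda>n. smoothing (1 / real (Suc n)) q y) \<longlonglongrightarrow> cnj (q y)"
proof -
  obtain r where r: "r > 0" "cball y r \<subseteq> G" using y G open_contains_cball by blast
  obtain N where N: "1 / real (Suc N) < r / 3" using nat_approx_posE[of "r/3"] r by auto
  show ?thesis
  proof (rule tendsto_eventually, rule eventually_sequentiallyI[of N])
    fix n assume "n \<ge> N"
    then have "1 / real (Suc n) \<le> 1 / real (Suc N)" by (intro divide_left_mono) auto
    then have "3 * (1 / real (Suc n)) \<le> r" using N by linarith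
    then have "cball y (3 * (1 / real (Suc n))) \<subseteq> G" using r by (auto simp: subset_eq)
    then show "smoothing (1 / real (Suc n)) q y = cnj (q y)" by (intro smoothing_eq q) auto
  qed
qed

text \<open>The constant \<open>c\<close> is classically the multiplicity of \<open>f\<close>.
  Pairing the trace of \<open>jac\<close> with the function 1 over \<open>inner_set e\<close> gives
  the bound \<open>c * measure lborel G\<close> for every \<open>e\<close>, and Fatou's lemma
  removes the smoothing as \<open>e\<close> tends to 0.\<close>

lemma jacobian_det_square_integrable:
  assumes conn: "connected G"
  shows "integrable lborel (\<lambda>z. (norm (indicator D z *\<^sub>R jac z))\<^sup>2)"
proof (cases "D = {}")
  case True
  then show ?thesis by simp
next
  case False
  then obtain w0 where w0: "w0 \<in> G" using fDG by blast
  \<comment> \<open>With \<open>b = jac\<close> the weight is the squared modulus of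
    \<open>jac\<close>, so the push-forward is real and nonnegative.\<close>
  have push_real: "push jac e w = of_real (\<integral>z. (indicator D z * (norm (jac z))\<^sup>2) * bump e (w - f z) \<partial>lborel)" for e w
    unfolding push_def integral_complex_of_real[symmetric]
    by (rule Bochner_Integration.integral_cong[OF refl])
       (auto simp: indicator_def complex_norm_square mult.commute simp del: of_real_power)
  have tr: "\<exists>e>0. trace_fun jac w = push jac e w" if "w \<in> G" for w
    using that G open_contains_cball trace_fun_eq[OF hol_jac] by metis
  define c where "c = Re (trace_fun jac w0)"
  have Im0: "Im (trace_fun jac w) = 0" if "w \<in> G" for w using tr[OF that] push_real by force
  have const: "trace_fun jac w = of_real c" if "w \<in> G" for w
  proof -
    have "trace_fun jac w = trace_fun jac w0"
      by (rule hol_real_valued_constant[OF G(1) conn trace_fun_holomorphic[OF hol_jac] Im0 that w0])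
    then show ?thesis using Im0[OF w0] by (simp add: c_def complex_eq_iff)
  qed
  have c0: "c \<ge> 0"
  proof -
    obtain e where e: "e > 0" "trace_fun jac w0 = push jac e w0" using tr[OF w0] by blast
    have "0 \<le> (\<integral>z. (indicator D z * (norm (jac z))\<^sup>2) * bump e (w0 - f z) \<partial>lborel)"
      by (intro integral_nonneg_AE AE_I2) (simp add: bump_nonneg[OF e(1)])
    then show ?thesis using e(2) push_real by (simp add: c_def)
  qed
  define g where "g = (\<lambda>e y. \<integral>w. bump e (w - y) * indicator (inner_set e) w \<partial>lborel)"
  have sm: "smoothing e (\<lambda>_. 1) y = of_real (g e y)" for e y
    unfolding smoothing_def g_def integral_complex_of_real[symmetric]
    by (rule Bochner_Integration.integral_cong[OF refl]) (simp add: scaleR_conv_of_real)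
  have g0: "g e y \<ge> 0" if "e > 0" for e y
    unfolding g_def by (intro integral_nonneg_AE AE_I2) (simp add: bump_nonneg[OF that])
  define U where "U = (\<lambda>e z. (indicator D z * (norm (jac z))\<^sup>2) * g e (f z))"
  have uU: "(indicator D z *\<^sub>R (cnj (jac z) * jac z)) * smoothing e (\<lambda>_. 1) (f z) = of_real (U e z)" for e z
    unfolding sm U_def by (simp add: complex_norm_square scaleR_conv_of_real mult.commute[of "cnj (jac z)"] del: of_real_power)
  have Uint: "integrable lborel (U e)" if e: "e > 0" for e
  proof -
    have "integrable lborel (\<lambda>z. complex_of_real (U e z))"
      using smoothing_integrable[OF hol_jac e, of "\<lambda>_. 1"] unfolding uU by simp
    then show ?thesis by (simp only: complex_of_real_integrable_eq)
  qed
  have Uval: "(\<integral>z. U e z \<partial>lborel) \<le> c * measure lborel G" if e: "e > 0" for e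
  proof -
    have fin: "emeasure lborel G < \<infinity>" using emeasure_bounded_finite[OF G(2)] by simp
    have Wm: "inner_set e \<in> sets lborel" using open_inner_set[OF e] by simp
    have "complex_of_real (\<integral>z. U e z \<partial>lborel) = (\<integral>w. indicator (inner_set e) w *\<^sub>R (trace_fun jac w * cnj 1) \<partial>lborel)"
      using trace_pairing[OF hol_jac e, of "\<lambda>_. 1"] unfolding uU by (simp add: integral_complex_of_real)
    also have "\<dots> = (\<integral>w. complex_of_real (c * indicator (inner_set e) w) \<partial>lborel)"
    proof (rule Bochner_Integration.integral_cong[OF refl])
      fix w show "indicator (inner_set e) w *\<^sub>R (trace_fun jac w * cnj 1) = complex_of_real (c * indicator (inner_set e) w)"
        using const inner_set_subset[OF e] by (auto simp: indicator_def)
    qed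
    finally have "(\<integral>z. U e z \<partial>lborel) = (\<integral>w. c * indicator (inner_set e) w \<partial>lborel)"
      by (simp only: integral_complex_of_real of_real_eq_iff)
    also have "\<dots> = c * measure lborel (inner_set e)" using Wm by simp
    also have "\<dots> \<le> c * measure lborel G"
      using c0 fin Wm G(1) inner_set_subset[OF e] by (intro mult_left_mono measure_mono_fmeasurable) (auto simp: fmeasurable_def)
    finally show ?thesis .
  qed
  define e where "e = (\<lambda>n::nat. 1 / real (Suc n))"
  have e: "e n > 0" for n by (simp add: e_def)
  have lim: "(\<lambda>n. ennreal (U (e n) z)) \<longlonglongrightarrow> ennreal ((norm (indicator D z *\<^sub>R jac z))\<^sup>2)" for z
  proof (cases "z \<in> D")
    case True
    then have "f z \<in> G" using fDG by blast
    from smoothing_tendsto[OF hol_const[OF open_UNIV, of 1] this]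
    have "(\<lambda>n. complex_of_real (g (e n) (f z))) \<longlonglongrightarrow> of_real 1" by (simp add: sm e_def)
    then have "(\<lambda>n. g (e n) (f z)) \<longlonglongrightarrow> 1" by (simp only: tendsto_of_real_iff)
    then have "(\<lambda>n. U (e n) z) \<longlonglongrightarrow> (indicator D z * (norm (jac z))\<^sup>2) * 1"
      unfolding U_def by (intro tendsto_mult tendsto_const)
    then show ?thesis using True by (intro tendsto_ennrealI) simp
  qed (simp add: U_def)
  have "(\<integral>\<^sup>+z. ennreal ((norm (indicator D z *\<^sub>R jac z))\<^sup>2) \<partial>lborel) \<le> ennreal (c * measure lborel G)"
  proof (rule nn_integral_limit_bound[OF _ lim])
    show "(\<lambda>z. ennreal (U (e n) z)) \<in> borel_measurable lborel" for n using Uint[OF e[of n]] by simp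
    have "(\<integral>\<^sup>+z. ennreal (U (e n) z) \<partial>lborel) = ennreal (\<integral>z. U (e n) z \<partial>lborel)" for n
      by (rule nn_integral_eq_integral[OF Uint[OF e]]) (simp add: U_def g0[OF e])
    then show "(\<integral>\<^sup>+z. ennreal (U (e n) z) \<partial>lborel) \<le> ennreal (c * measure lborel G)" for n
      using Uval[OF e] by (simp add: ennreal_leI)
  qed
  moreover have m: "(\<lambda>z. indicator D z *\<^sub>R jac z) \<in> borel_measurable lborel"
    unfolding measurable_lborel2 by (rule indicator_times_measurable[OF D hol_continuous[OF hol_jac]])
  then have "(\<lambda>z. (norm (indicator D z *\<^sub>R jac z))\<^sup>2) \<in> borel_measurable lborel"
    by (intro borel_measurable_power measurable_compose[OF m borel_measurable_norm])
  ultimately show ?thesis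
    by (intro integrableI_nonneg) (auto intro: le_less_trans ennreal_less_top simp del: norm_scaleR)
qed

text \<open>For an integrable weight the right-hand side of \<open>trace_pairing\<close> converges
  by domination, because the smoothings are uniformly bounded. Only the limit of the integrals of
  the trace is obtained, not its integrability over \<open>G\<close>.\<close>

lemma trace_pairing_tendsto:
  assumes b: "holomorphic_fun_on b D" and int: "integrable lborel (\<lambda>z. indicator D z *\<^sub>R (cnj (jac z) * b z))"
    and q: "holomorphic_fun_on q UNIV"
  shows "(\<lambda>n. \<integral>w. indicator (inner_set (1 / real (Suc n))) w *\<^sub>R (trace_fun b w * cnj (q w)) \<partial>lborel) \<longlonglongrightarrow>
    (\<integral>z. (indicator D z *\<^sub>R (cnj (jac z) * b z)) * cnj (q (f z)) \<partial>lborel)"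
proof -
  have qc: "continuous_on UNIV q" by (rule hol_continuous[OF q])
  obtain R where R: "\<And>x. x \<in> G \<Longrightarrow> norm x \<le> R" using G(2) bounded_iff by blast
  obtain M where M: "\<And>x. x \<in> cball 0 R \<Longrightarrow> norm (q x) \<le> M" using hol_bounded_cball[OF q, of 0 R] by blast
  have qM: "norm (q w) \<le> max 0 M" if "w \<in> G" for w using M[of w] R[OF that] by simp
  have sb: "norm (smoothing (1 / real (Suc n)) q y) \<le> max 0 M" for n y
    by (rule smoothing_bound[OF _ qc qM]) auto
  have fqm: "(\<lambda>z. indicator D z *\<^sub>R (q (f z))) \<in> borel_measurable borel"
    by (intro indicator_times_measurable[OF D] continuous_on_compose2[OF qc hol_continuous[OF f]]) auto
  show ?thesis
    unfolding trace_pairing[OF b _ qc, OF divide_pos_pos[OF zero_less_one of_nat_0_less_iff[THEN iffD2, OF zero_less_Suc]]]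
  proof (rule integral_dominated_convergence[where w = "\<lambda>z. max 0 M * norm (indicator D z *\<^sub>R (cnj (jac z) * b z))"])
    show "integrable lborel (\<lambda>z. max 0 M * norm (indicator D z *\<^sub>R (cnj (jac z) * b z)))"
      by (intro integrable_mult_right integrable_norm int)
    show "AE z in lborel. (\<lambda>n. (indicator D z *\<^sub>R (cnj (jac z) * b z)) * smoothing (1 / real (Suc n)) q (f z))
       \<longlonglongrightarrow> (indicator D z *\<^sub>R (cnj (jac z) * b z)) * cnj (q (f z))"
    proof (rule AE_I2)
      fix z
      show "(\<lambda>n. (indicator D z *\<^sub>R (cnj (jac z) * b z)) * smoothing (1 / real (Suc n)) q (f z))
       \<longlonglongrightarrow> (indicator D z *\<^sub>R (cnj (jac z) * b z)) * cnj (q (f z))"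
      proof (cases "z \<in> D")
        case True
        then have "f z \<in> G" using fDG by blast
        then show ?thesis by (intro tendsto_mult tendsto_const smoothing_tendsto q)
      qed simp
    qed
    show "(\<lambda>z. (indicator D z *\<^sub>R (cnj (jac z) * b z)) * smoothing (1 / real (Suc n)) q (f z)) \<in> borel_measurable lborel" for n
      using smoothing_integrable[OF b _ qc, of "1 / real (Suc n)"] by simp
    show "AE z in lborel. norm ((indicator D z *\<^sub>R (cnj (jac z) * b z)) * smoothing (1 / real (Suc n)) q (f z))
       \<le> max 0 M * norm (indicator D z *\<^sub>R (cnj (jac z) * b z))" for n
    proof (rule AE_I2)
      fix z
      show "norm ((indicator D z *\<^sub>R (cnj (jac z) * b z)) * smoothing (1 / real (Suc n)) q (f z))
       \<le> max 0 M * norm (indicator D z *\<^sub>R (cnj (jac z) * b z))"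
        unfolding norm_mult[of _ "smoothing _ _ _"] mult.commute[of "max 0 M"] by (intro mult_left_mono sb) simp
    qed
    show "(\<lambda>z. (indicator D z *\<^sub>R (cnj (jac z) * b z)) * cnj (q (f z))) \<in> borel_measurable lborel"
    proof -
      have "(\<lambda>z. (indicator D z *\<^sub>R (cnj (jac z) * b z)) * cnj (indicator D z *\<^sub>R (q (f z)))) \<in> borel_measurable lborel"
        using fqm int by measurable
      moreover have "(\<lambda>z. (indicator D z *\<^sub>R (cnj (jac z) * b z)) * cnj (indicator D z *\<^sub>R (q (f z)))) =
        (\<lambda>z. (indicator D z *\<^sub>R (cnj (jac z) * b z)) * cnj (q (f z)))" by (auto simp: indicator_def)
      ultimately show ?thesis by simp
    qed
  qed
qed

end

section \<open>Quasi-circular domains\<close>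

definition wact :: "('n \<Rightarrow> nat) \<Rightarrow> complex \<Rightarrow> complex^'n \<Rightarrow> complex^'n::finite" where
  "wact m c = dscale (\<lambda>j. c ^ m j)"

lemma wact_nth [simp]: "wact m c w $ j = c ^ m j * w $ j"
  by (simp add: wact_def)

lemma wact_wact: "wact m a (wact m b w) = wact m (a * b) w"
  by (simp add: vec_eq_iff power_mult_distrib mult.assoc)

lemma wact_commute: "wact m a (wact m b w) = wact m b (wact m a w)"
  by (simp add: wact_wact mult.commute)

lemma continuous_wact: "continuous_on S f \<Longrightarrow> continuous_on S g \<Longrightarrow> continuous_on S (\<lambda>x. wact m (f x) (g x))"
  unfolding wact_def dscale_def by (intro continuous_intros)

lemma norm_wact: "norm c = 1 \<Longrightarrow> norm (wact m c w) = norm w"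
  unfolding wact_def by (rule norm_dscale) (simp add: norm_power)

text \<open>Positive weights give \<open>norm c ^ m j \<le> norm c\<close>, so weighted dilations
  contract at least as much as scalar multiplication.\<close>

lemma norm_wact_le:
  assumes "norm c \<le> 1" "\<And>j. m j > 0"
  shows "norm (wact m c w) \<le> norm c * norm w"
proof -
  have "norm (wact m c w $ j) \<le> norm ((c *s w) $ j)" for j
  proof -
    have "norm c ^ m j \<le> norm c ^ 1" using assms(1) assms(2)[of j] by (intro power_decreasing) auto
    then show ?thesis by (simp add: norm_mult norm_power mult_right_mono)
  qed
  then have "norm (wact m c w) \<le> norm (c *s w)" by (rule norm_le_componentwise_cart)
  then show ?thesis by simp
qed

lemma quasi_circularD: "quasi_circular m G \<Longrightarrow> w \<in> G \<Longrightarrow> norm c = 1 \<Longrightarrow> wact m c w \<in> G"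
  by (simp add: quasi_circular_def wact_def dscale_def)

lemma hol_wact:
  assumes "holomorphic_fun_on h S" "open S" "open T" "\<And>w. w \<in> T \<Longrightarrow> wact m c w \<in> S"
  shows "holomorphic_fun_on (\<lambda>w. h (wact m c w)) T"
  using assms(4) by (intro hol_compose[OF assms(2,3,1)]) (auto intro!: hol_cmult hol_component assms(3))

text \<open>The \<open>d\<close>-th Fourier coefficient along the circle orbits; in contrast to a
  Taylor expansion it makes sense on all of \<open>G\<close>.\<close>

definition weight_part :: "('n \<Rightarrow> nat) \<Rightarrow> nat \<Rightarrow> (complex^'n::finite \<Rightarrow> complex) \<Rightarrow> complex^'n \<Rightarrow> complex" where
  "weight_part m d h w = (\<integral>t. h (wact m (unit_circle t) w) / unit_circle t ^ d \<partial>circle_measure)"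

context
  fixes m :: "'n::finite \<Rightarrow> nat" and G :: "(complex^'n) set"
  assumes G: "open G" and circ: "quasi_circular m G"
begin

lemma orbit_bounded:
  assumes h: "holomorphic_fun_on h G" and C: "compact C" "C \<subseteq> G"
  shows "\<exists>B. \<forall>w\<in>C. \<forall>c. norm c = 1 \<longrightarrow> norm (h (wact m c w)) \<le> B"
proof -
  let ?S = "sphere (0::complex) 1 \<times> C"
  have "continuous_on ?S (\<lambda>p. wact m (fst p) (snd p))" by (intro continuous_wact continuous_intros)
  then have "continuous_on ?S (\<lambda>p. h (wact m (fst p) (snd p)))"
    using C quasi_circularD[OF circ]
    by (intro continuous_on_compose2[OF hol_continuous[OF h]]) auto
  then have "compact ((\<lambda>p. h (wact m (fst p) (snd p))) ` ?S)"
    using C by (intro compact_continuous_image compact_Times) auto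
  then obtain B where B: "\<And>p. p \<in> ?S \<Longrightarrow> norm (h (wact m (fst p) (snd p))) \<le> B"
    unfolding compact_eq_bounded_closed bounded_iff by blast
  have "norm (h (wact m c w)) \<le> B" if "w \<in> C" "norm c = 1" for w c
    using B[of "(c, w)"] that by simp
  then show ?thesis by blast
qed

lemma weight_part_holomorphic:
  assumes h: "holomorphic_fun_on h G"
  shows "holomorphic_fun_on (weight_part m d h) G"
  unfolding weight_part_def[abs_def]
proof (rule hol_lebesgue_integral[OF G])
  show "holomorphic_fun_on (\<lambda>w. h (wact m (unit_circle t) w) / unit_circle t ^ d) G" for t
    by (intro hol_divide hol_wact[OF h G G] hol_const G quasi_circularD[OF circ]) auto
  show "(\<lambda>t. h (wact m (unit_circle t) w) / unit_circle t ^ d) \<in> borel_measurable circle_measure" if "w \<in> G" for w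
    using quasi_circularD[OF circ that]
    by (intro continuous_circle_measurable continuous_on_divide continuous_on_compose2[OF hol_continuous[OF h]] continuous_wact continuous_intros) auto
  fix w assume "w \<in> G"
  then obtain r where r: "r > 0" "cball w r \<subseteq> G" using G open_contains_cball by blast
  obtain B where B: "\<And>y c. y \<in> cball w r \<Longrightarrow> norm c = 1 \<Longrightarrow> norm (h (wact m c y)) \<le> B"
    using orbit_bounded[OF h compact_cball r(2)] by blast
  have "norm (h (wact m (unit_circle t) y) / unit_circle t ^ d) \<le> B" if "y \<in> ball w r" for t y
    using B[of y "unit_circle t"] that by (simp add: norm_divide norm_power)
  moreover have "integrable circle_measure (\<lambda>_. B)"
    using finite_measure.integrable_const[OF finite_measure_circle] .
  moreover have "ball w r \<subseteq> G" using r by auto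
  ultimately show "\<exists>r>0. \<exists>B. ball w r \<subseteq> G \<and> integrable circle_measure B \<and>
     (\<forall>y\<in>ball w r. \<forall>t\<in>space circle_measure. norm (h (wact m (unit_circle t) y) / unit_circle t ^ d) \<le> B t)"
    using r(1) by (intro exI[of _ r] conjI exI[of _ "\<lambda>_. B"]) auto
qed

text \<open>Rotating the variable leaves the integral over the invariant set \<open>W\<close>
  unchanged and divides \<open>cnj q\<close> by the \<open>d\<close>-th power of the rotation.
  Averaging over all rotations turns \<open>h\<close> into its Fourier coefficient.\<close>

lemma weight_part_pairing:
  assumes h: "holomorphic_fun_on h G" and W: "open W" "W \<subseteq> C" and C: "compact C" "C \<subseteq> G"
    and inv: "\<And>c w. norm c = 1 \<Longrightarrow> wact m c w \<in> W \<longleftrightarrow> w \<in> W"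
    and q: "continuous_on UNIV q" and hom: "\<And>c w. q (wact m c w) = c ^ d * q w"
  shows "(\<integral>w. indicator W w *\<^sub>R (weight_part m d h w * cnj (q w)) \<partial>lborel) =
         (\<integral>w. indicator W w *\<^sub>R (h w * cnj (q w)) \<partial>lborel)"
proof -
  define R where "R = (\<lambda>w. indicator W w *\<^sub>R cnj (q w))"
  define c where "c = (\<lambda>t w. indicator W w *\<^sub>R (h (wact m (unit_circle t) w) / unit_circle t ^ d))"
  obtain B where B: "\<And>y c. y \<in> C \<Longrightarrow> norm c = 1 \<Longrightarrow> norm (h (wact m c y)) \<le> B"
    using orbit_bounded[OF h C] by blast
  have cB: "norm (c t w) \<le> max 0 B" for t w
    using B[of w "unit_circle t"] W by (cases "w \<in> W") (auto simp: c_def norm_divide norm_power)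
  have Rint: "integrable lborel R"
  proof -
    have "integrable lborel (\<lambda>w. indicator W w *\<^sub>R (indicator C w *\<^sub>R cnj (q w)))"
      by (intro integrable_mult_indicator borel_integrable_compact continuous_intros)
         (use W C q in \<open>auto intro: continuous_on_subset\<close>)
    moreover have "(\<lambda>w. indicator W w *\<^sub>R (indicator C w *\<^sub>R cnj (q w))) = R"
      using W by (auto simp: R_def indicator_def fun_eq_iff)
    ultimately show ?thesis by simp
  qed
  interpret CM: finite_measure circle_measure by (rule finite_measure_circle)
  have cm: "(\<lambda>(t,w). c t w) \<in> borel_measurable (circle_measure \<Otimes>\<^sub>M lborel)"
  proof -
    have "(\<lambda>p. indicator (UNIV \<times> W) p *\<^sub>R (h (wact m (unit_circle (fst p)) (snd p)) / unit_circle (fst p) ^ d))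
        \<in> borel_measurable (borel :: (real \<times> (complex^'n)) measure)"
      using W C quasi_circularD[OF circ]
      by (intro indicator_times_measurable open_Times continuous_on_divide continuous_on_compose2[OF hol_continuous[OF h]]
           continuous_wact continuous_intros) auto
    moreover have "(\<lambda>p. indicator (UNIV \<times> W) p *\<^sub>R (h (wact m (unit_circle (fst p)) (snd p)) / unit_circle (fst p) ^ d))
       = (\<lambda>(t,w). c t w)"
      by (auto simp: c_def indicator_def fun_eq_iff)
    ultimately show ?thesis
      by (simp add: borel_prod[symmetric] cong: measurable_cong_sets sets_pair_measure_cong)
  qed
  define K where "K = (\<lambda>w. indicator W w *\<^sub>R (h w * cnj (q w)))"
  have Km: "K \<in> borel_measurable borel"
    unfolding K_def using W C q
    by (intro indicator_times_measurable continuous_intros continuous_on_subset[OF hol_continuous[OF h]]) (auto intro: continuous_on_subset)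
  have inner: "(\<integral>w. c t w * R w \<partial>lborel) = (\<integral>w. K w \<partial>lborel)" for t
  proof -
    let ?e = "unit_circle t"
    have "(\<integral>w. K (wact m ?e w) \<partial>lborel) = (\<integral>w. K w \<partial>lborel)"
      unfolding wact_def
      by (rule integral_isometry[OF Km linear_dscale norm_dscale]) (simp add: norm_power)
    moreover have "K (wact m ?e w) = c t w * R w" for w
    proof -
      have "cnj ?e = 1 / ?e"
        using complex_norm_square[of ?e] by (simp add: field_simps)
      then have "cnj (q (wact m ?e w)) = cnj (q w) / ?e ^ d"
        unfolding hom by (simp add: power_divide)
      then show ?thesis using inv[of ?e w] by (cases "w \<in> W") (simp_all add: K_def c_def R_def)
    qed
    ultimately show ?thesis by simp
  qed
  have "(\<integral>w. K w \<partial>lborel) = (\<integral>t. (\<integral>w. K w \<partial>lborel) \<partial>circle_measure)"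
    by (simp only: circle_integral_const)
  also have "\<dots> = (\<integral>t. 1 * (\<integral>w. c t w * R w \<partial>lborel) \<partial>circle_measure)" by (simp only: inner mult_1)
  also have "\<dots> = (\<integral>w. (\<integral>t. 1 * c t w \<partial>circle_measure) * R w \<partial>lborel)"
  proof (rule fubini_bounded_kernel[OF CM.sigma_finite_measure_axioms lborel.sigma_finite_measure_axioms _ Rint cm cB])
    show "integrable circle_measure (\<lambda>t. 1::complex)" by (rule CM.integrable_const)
  qed
  also have "\<dots> = (\<integral>w. indicator W w *\<^sub>R (weight_part m d h w * cnj (q w)) \<partial>lborel)"
  proof (rule Bochner_Integration.integral_cong[OF refl])
    fix w
    show "(\<integral>t. 1 * c t w \<partial>circle_measure) * R w = indicator W w *\<^sub>R (weight_part m d h w * cnj (q w))"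
      by (cases "w \<in> W") (simp_all add: R_def c_def weight_part_def)
  qed
  finally show ?thesis by (simp add: K_def)
qed

text \<open>Near the origin \<open>weight_part m d h\<close> is the part of weight \<open>d\<close> of the Taylor series of \<open>h\<close>.\<close>

lemma weight_part_homogeneous:
  assumes h: "holomorphic_fun_on h G" and conn: "connected G" and m: "\<And>j. m j > 0"
    and e: "e > 0" "ball 0 e \<subseteq> G" and s: "0 < s" "s \<le> 1" and sG: "\<And>w. w \<in> G \<Longrightarrow> wact m (of_real s) w \<in> ball 0 e"
    and w: "w \<in> G"
  shows "weight_part m d h (wact m (of_real s) w) = of_real s ^ d * weight_part m d h w"
proof -
  have near: "weight_part m d h (wact m (of_real s) w) / of_real s ^ d = weight_part m d h w" if w: "w \<in> ball 0 e" for w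
  proof -
    \<comment> \<open>On this analytic disc the circles of radius 1 and \<open>s\<close> compute the
      same Taylor coefficient at 0.\<close>
    define g where "g = (\<lambda>c. h (wact m c w))"
    define S where "S = {c. wact m c w \<in> ball 0 e}"
    have S: "open S"
      unfolding S_def using open_vimage[OF open_ball, of "\<lambda>c. wact m c w" 0 e]
      by (simp add: vimage_def continuous_wact continuous_on_id continuous_on_const)
    have gS: "g holomorphic_on S"
      unfolding g_def using e(2) by (intro hol_compose_curve[OF G S h]) (auto simp: S_def intro!: holomorphic_intros)
    have cS: "cball 0 1 \<subseteq> S"
    proof
      fix c :: complex assume "c \<in> cball 0 1"
      then have c: "norm c \<le> 1" by simp
      have "norm (wact m c w) \<le> norm c * norm w" by (rule norm_wact_le[OF c m])
      also have "\<dots> \<le> 1 * norm w" using c by (intro mult_right_mono) auto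
      finally show "c \<in> S" using w by (simp add: S_def)
    qed
    have "weight_part m d h w = (deriv ^^ d) g 0 / fact d"
      using circle_coefficient[OF gS S cS zero_less_one, of d] by (simp add: weight_part_def g_def)
    moreover have "(deriv ^^ d) g 0 / fact d = weight_part m d h (wact m (of_real s) w) / of_real s ^ d"
    proof -
      have "cball 0 s \<subseteq> S" using cS s by auto
      then have "(deriv ^^ d) g 0 / fact d = (\<integral>t. g (of_real s * unit_circle t) / (of_real s * unit_circle t) ^ d \<partial>circle_measure)"
        using circle_coefficient[OF gS S _ s(1), of d] by simp
      also have "\<dots> = (\<integral>t. h (wact m (unit_circle t) (wact m (of_real s) w)) / unit_circle t ^ d / of_real s ^ d \<partial>circle_measure)"
        by (simp add: g_def wact_wact mult.commute power_mult_distrib)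
      also have "\<dots> = weight_part m d h (wact m (of_real s) w) / of_real s ^ d"
        unfolding weight_part_def by (rule integral_divide_zero)
      finally show ?thesis .
    qed
    ultimately show ?thesis by simp
  qed
  have inG: "wact m (of_real s) w \<in> G" if "w \<in> G" for w using sG[OF that] e(2) by blast
  \<comment> \<open>The dilation maps all of \<open>G\<close> into the ball, so both sides are
    holomorphic on the connected \<open>G\<close> and the relation spreads from the ball.\<close>
  have "weight_part m d h (wact m (of_real s) w) / of_real s ^ d = weight_part m d h w"
  proof (rule hol_identity[OF _ weight_part_holomorphic[OF h] G conn open_ball _ e(2) near w])
    show "holomorphic_fun_on (\<lambda>w. weight_part m d h (wact m (of_real s) w) / of_real s ^ d) G"
      using s by (intro hol_divide hol_wact[OF weight_part_holomorphic[OF h]] hol_const G inG) auto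
  qed (use e in auto)
  then show ?thesis using s by (simp add: field_simps)
qed

text \<open>The function \<open>q\<close> sees only the part of weight \<open>d\<close>, on which
  the dilation is multiplication by \<open>s ^ d\<close>. Thus values of \<open>h\<close> in a small
  ball determine its pairing with \<open>q\<close> over all of \<open>W\<close>.\<close>

lemma dilation_pairing:
  assumes h: "holomorphic_fun_on h G" and conn: "connected G" and m: "\<And>j. m j > 0"
    and e: "e > 0" "ball 0 e \<subseteq> G" and s: "0 < s" "s \<le> 1" and sG: "\<And>w. w \<in> G \<Longrightarrow> wact m (of_real s) w \<in> ball 0 e"
    and W: "open W" "W \<subseteq> C" and C: "compact C" "C \<subseteq> G"
    and inv: "\<And>c w. norm c = 1 \<Longrightarrow> wact m c w \<in> W \<longleftrightarrow> w \<in> W"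
    and q: "continuous_on UNIV q" and hom: "\<And>c w. q (wact m c w) = c ^ d * q w"
  shows "(\<integral>w. indicator W w *\<^sub>R (h (wact m (of_real s) w) * cnj (q w)) \<partial>lborel) =
         of_real s ^ d * (\<integral>w. indicator W w *\<^sub>R (h w * cnj (q w)) \<partial>lborel)"
proof -
  let ?hs = "\<lambda>w. h (wact m (of_real s) w)"
  have inG: "wact m (of_real s) w \<in> G" if "w \<in> G" for w using sG[OF that] e(2) by blast
  have hs: "holomorphic_fun_on ?hs G" by (intro hol_wact[OF h] G inG)
  have "(\<integral>w. indicator W w *\<^sub>R (?hs w * cnj (q w)) \<partial>lborel) = (\<integral>w. indicator W w *\<^sub>R (weight_part m d ?hs w * cnj (q w)) \<partial>lborel)"
    by (rule weight_part_pairing[OF hs W C inv q hom, symmetric])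
  also have "\<dots> = (\<integral>w. of_real s ^ d * (indicator W w *\<^sub>R (weight_part m d h w * cnj (q w))) \<partial>lborel)"
  proof (rule Bochner_Integration.integral_cong[OF refl])
    fix w
    have "weight_part m d ?hs w = of_real s ^ d * weight_part m d h w" if "w \<in> W"
    proof -
      have "weight_part m d ?hs w = weight_part m d h (wact m (of_real s) w)"
        unfolding weight_part_def by (simp add: wact_commute[of m "of_real s"])
      then show ?thesis using weight_part_homogeneous[OF h conn m e s sG, of w d] that W C by auto
    qed
    then show "indicator W w *\<^sub>R (weight_part m d ?hs w * cnj (q w)) = of_real s ^ d * (indicator W w *\<^sub>R (weight_part m d h w * cnj (q w)))"
      by (cases "w \<in> W") auto
  qed
  also have "\<dots> = of_real s ^ d * (\<integral>w. indicator W w *\<^sub>R (weight_part m d h w * cnj (q w)) \<partial>lborel)"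
    by (rule integral_mult_right_zero)
  also have "(\<integral>w. indicator W w *\<^sub>R (weight_part m d h w * cnj (q w)) \<partial>lborel) = (\<integral>w. indicator W w *\<^sub>R (h w * cnj (q w)) \<partial>lborel)"
    by (rule weight_part_pairing[OF h W C inv q hom])
  finally show ?thesis .
qed

end

section \<open>Bounded quotients of holomorphic functions\<close>

text \<open>The zeros of \<open>c\<close> are isolated, and the bound by \<open>R\<close> makes the
  singularities of \<open>a / c\<close> there removable. The local quotients agree because
  \<open>c\<close> is nonzero on each of their balls except possibly at the centre.\<close>

lemma holomorphic_quotient_bounded:
  fixes a c :: "complex \<Rightarrow> complex"
  assumes S: "open S" "connected S" and a: "a holomorphic_on S" and c: "c holomorphic_on S"
    and le: "\<And>t. t \<in> S \<Longrightarrow> norm (a t) \<le> R * norm (c t)" and t0: "t0 \<in> S" "c t0 \<noteq> 0"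
  shows "\<exists>k. k holomorphic_on S \<and> (\<forall>t\<in>S. a t = k t * c t)"
proof -
  have "\<exists>h r. r > 0 \<and> ball t r \<subseteq> S \<and> h holomorphic_on ball t r \<and> (\<forall>x\<in>ball t r. a x = h x * c x) \<and> (\<forall>x\<in>ball t r - {t}. c x \<noteq> 0)"
    if t: "t \<in> S" for t
  proof (cases "c t = 0")
    case True
    obtain r where r: "r > 0" "ball t r \<subseteq> S" "\<And>z. z \<in> ball t r - {t} \<Longrightarrow> c z \<noteq> 0"
      using isolated_zeros[OF c S t True t0] by metis
    have hol: "(\<lambda>x. a x / c x) holomorphic_on ball t r - {t}"
      using r a c by (intro holomorphic_on_divide) (auto intro: holomorphic_on_subset)
    have "\<forall>\<^sub>F x in at t. norm (a x / c x) \<le> R"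
      unfolding eventually_at
    proof (intro exI[of _ r] conjI ballI impI r(1))
      fix x assume "x \<noteq> t \<and> dist x t < r"
      then have "c x \<noteq> 0" "x \<in> S" using r by (auto simp: dist_commute)
      then show "norm (a x / c x) \<le> R" using le[of x] by (simp add: norm_divide divide_le_eq)
    qed
    moreover have "t \<in> interior (ball t r)" using r by simp
    ultimately obtain h where h: "h holomorphic_on ball t r" "\<And>z. z \<in> ball t r - {t} \<Longrightarrow> h z = a z / c z"
      using holomorphic_on_extend_bounded[OF hol] by blast
    have "a x = h x * c x" if "x \<in> ball t r" for x
    proof (cases "x = t")
      case True
      then show ?thesis using le[OF t] \<open>c t = 0\<close> by simp
    next
      case False
      then show ?thesis using h(2)[of x] r(3)[of x] that by simp
    qed
    then show ?thesis using h r by blast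
  next
    case False
    have "open (S \<inter> c -` (- {0}))"
      using holomorphic_on_imp_continuous_on[OF c] S by (intro continuous_open_preimage) auto
    moreover have "t \<in> S \<inter> c -` (- {0})" using t False by simp
    ultimately obtain r where r: "r > 0" "ball t r \<subseteq> S \<inter> c -` (- {0})" unfolding open_contains_ball by blast
    then have nz: "c x \<noteq> 0" if "x \<in> ball t r" for x using that by blast
    have "(\<lambda>x. a x / c x) holomorphic_on ball t r"
      using r nz a c by (intro holomorphic_on_divide) (auto intro: holomorphic_on_subset)
    then show ?thesis using r nz by (intro exI[of _ "\<lambda>x. a x / c x"] exI[of _ r]) auto
  qed
  then have "\<forall>t. \<exists>h r. t \<in> S \<longrightarrow> r > 0 \<and> ball t r \<subseteq> S \<and> h holomorphic_on ball t r \<and>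
      (\<forall>x\<in>ball t r. a x = h x * c x) \<and> (\<forall>x\<in>ball t r - {t}. c x \<noteq> 0)"
    by blast
  then obtain h r where *: "\<And>t. t \<in> S \<longrightarrow> r t > 0 \<and> ball t (r t) \<subseteq> S \<and> h t holomorphic_on ball t (r t) \<and>
      (\<forall>x\<in>ball t (r t). a x = h t x * c x) \<and> (\<forall>x\<in>ball t (r t) - {t}. c x \<noteq> 0)"
    by metis
  have hr: "\<And>t. t \<in> S \<Longrightarrow> r t > 0" "\<And>t. t \<in> S \<Longrightarrow> ball t (r t) \<subseteq> S"
    "\<And>t. t \<in> S \<Longrightarrow> h t holomorphic_on ball t (r t)" "\<And>t x. t \<in> S \<Longrightarrow> x \<in> ball t (r t) \<Longrightarrow> a x = h t x * c x"
    "\<And>t x. t \<in> S \<Longrightarrow> x \<in> ball t (r t) - {t} \<Longrightarrow> c x \<noteq> 0"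
    using * by blast+
  define k where "k = (\<lambda>t. h t t)"
  have kh: "k x = h t x" if t: "t \<in> S" "x \<in> ball t (r t)" for t x
  proof (cases "x = t")
    case False
    have x: "x \<in> S" using that hr(2) by blast
    have "a x = h x x * c x" using hr(4)[OF x] hr(1)[OF x] by simp
    moreover have "a x = h t x * c x" using hr(4)[OF t] .
    moreover have "c x \<noteq> 0" using hr(5)[OF t(1)] t(2) False by blast
    ultimately show ?thesis by (simp add: k_def)
  qed (simp add: k_def)
  have "k field_differentiable at t" if t: "t \<in> S" for t
  proof -
    have "k holomorphic_on ball t (r t)"
      by (rule holomorphic_transform[OF hr(3)[OF t]]) (rule kh[OF t, symmetric])
    then show ?thesis using hr(1)[OF t] holomorphic_on_imp_differentiable_at[OF _ open_ball] by simp
  qed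
  then have "k holomorphic_on S" by (simp add: holomorphic_on_def field_differentiable_at_within)
  moreover have "a t = k t * c t" if "t \<in> S" for t
    using hr(4)[OF that, of t] hr(1)[OF that] by (simp add: k_def)
  ultimately show ?thesis by blast
qed

text \<open>Some complex line through \<open>p\<close> carries a circle around \<open>p\<close>
  without zeros of \<open>h\<close>. Nearby parallel circles avoid the zeros too, and the mean of
  \<open>g / h\<close> over them is a holomorphic function of the centre.\<close>

lemma local_quotient_bounded:
  fixes g h :: "complex^'n::finite \<Rightarrow> complex"
  assumes U: "open U" and g: "holomorphic_fun_on g U" and h: "holomorphic_fun_on h U"
    and le: "\<And>z. z \<in> U \<Longrightarrow> norm (g z) \<le> R * norm (h z)"
    and nz: "\<And>T. open T \<Longrightarrow> T \<noteq> {} \<Longrightarrow> T \<subseteq> U \<Longrightarrow> \<exists>z\<in>T. h z \<noteq> 0" and p: "p \<in> U"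
  shows "\<exists>d>0. \<exists>F. ball p d \<subseteq> U \<and> holomorphic_fun_on F (ball p d) \<and> (\<forall>z\<in>ball p d. g z = h z * F z)"
proof -
  obtain \<rho> where \<rho>: "\<rho> > 0" "ball p \<rho> \<subseteq> U" using U p open_contains_ball by blast
  let ?B = "ball p \<rho>"
  have hB: "holomorphic_fun_on h ?B" and gB: "holomorphic_fun_on g ?B" using hol_subset[OF h \<rho>(2)] hol_subset[OF g \<rho>(2)] by auto
  obtain x where x: "x \<in> ?B" "h x \<noteq> 0" using nz[of ?B] \<rho> by auto
  define v where "v = x - p"
  define A where "A = (\<lambda>z. {t. z + t *s v \<in> ?B})"
  have A: "open (A z)" "connected (A z)" for z
    unfolding A_def by (rule open_line_preimage[OF open_ball], rule connected_line_ball)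
  have holA: "(\<lambda>t. h (z + t *s v)) holomorphic_on A z" "(\<lambda>t. g (z + t *s v)) holomorphic_on A z" for z
    unfolding A_def by (rule hol_line[OF open_ball hB], rule hol_line[OF open_ball gB])
  have A0: "0 \<in> A p" "1 \<in> A p" using \<rho> x by (auto simp: A_def v_def)
  obtain r where r: "r > 0" "cball 0 r \<subseteq> A p" "\<And>t. norm t = r \<Longrightarrow> h (p + t *s v) \<noteq> 0"
  proof (cases "h p = 0")
    case True
    obtain r where r: "r > 0" "ball 0 r \<subseteq> A p" "\<And>t. t \<in> ball 0 r - {0} \<Longrightarrow> h (p + t *s v) \<noteq> 0"
      using isolated_zeros[OF holA(1) A A0(1) _ A0(2)] True x by (auto simp: v_def)
    show ?thesis
    proof (rule that[of "r/2"])
      show "r / 2 > 0" using r by simp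
      show "cball 0 (r/2) \<subseteq> A p" using r by auto
      show "h (p + t *s v) \<noteq> 0" if "norm t = r / 2" for t
        using that r by (intro r(3)) auto
    qed
  next
    case False
    have "open (A p \<inter> (\<lambda>t. h (p + t *s v)) -` (- {0}))"
      using holomorphic_on_imp_continuous_on[OF holA(1)] A by (intro continuous_open_preimage) auto
    moreover have "0 \<in> A p \<inter> (\<lambda>t. h (p + t *s v)) -` (- {0})" using A0 False by simp
    ultimately obtain r where r: "r > 0" "cball 0 r \<subseteq> A p \<inter> (\<lambda>t. h (p + t *s v)) -` (- {0})"
      unfolding open_contains_cball by blast
    show ?thesis
    proof (rule that[OF r(1)])
      show "cball 0 r \<subseteq> A p" using r by blast
      fix t :: complex assume "norm t = r"
      then have "t \<in> cball 0 r" by simp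
      then show "h (p + t *s v) \<noteq> 0" using r by blast
    qed
  qed
  let ?O = "?B \<inter> h -` (- {0})"
  have O: "open ?O" using hol_continuous[OF hB] by (intro continuous_open_preimage) auto
  have comp: "compact ((\<lambda>t. p + t *s v) ` T)" if "compact T" for T
    using that by (intro compact_continuous_image continuous_intros)
  have "(\<lambda>t. p + t *s v) ` sphere 0 r \<subseteq> ?O" using r by (auto simp: A_def)
  then obtain d1 where d1: "d1 > 0" "(\<Union>y\<in>(\<lambda>t. p + t *s v) ` sphere 0 r. ball y d1) \<subseteq> ?O"
    using compact_subset_open_imp_ball_epsilon_subset[OF comp[OF compact_sphere] O] by metis
  have "(\<lambda>t. p + t *s v) ` cball 0 r \<subseteq> ?B" using r by (auto simp: A_def)
  then obtain d2 where d2: "d2 > 0" "(\<Union>y\<in>(\<lambda>t. p + t *s v) ` cball 0 r. ball y d2) \<subseteq> ?B"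
    using compact_subset_open_imp_ball_epsilon_subset[OF comp[OF compact_cball] open_ball] by metis
  \<comment> \<open>For centres within \<open>d\<close> of \<open>p\<close>, \<open>d1\<close> keeps
    the circle off the zeros of \<open>h\<close> and \<open>d2\<close> keeps the disc inside the
    ball.\<close>
  define d where "d = min d1 d2"
  have d: "d > 0" using d1 d2 by (simp add: d_def)
  have shift: "dist (p + t *s v) (z + t *s v) = dist p z" for z t by (simp add: dist_norm)
  have on_circle: "z + t *s v \<in> ?B" "h (z + t *s v) \<noteq> 0" if z: "z \<in> ball p d" and t: "norm t = r" for z t
  proof -
    have "z + t *s v \<in> ball (p + t *s v) d1" using z shift[of t z] by (simp add: d_def)
    moreover have "p + t *s v \<in> (\<lambda>t. p + t *s v) ` sphere 0 r" using t by (intro imageI) simp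
    ultimately have "z + t *s v \<in> ?O" using d1(2) by blast
    then show "z + t *s v \<in> ?B" "h (z + t *s v) \<noteq> 0" by auto
  qed
  have in_disc: "cball 0 r \<subseteq> A z" if z: "z \<in> ball p d" for z
  proof
    fix t :: complex assume t: "t \<in> cball 0 r"
    have "z + t *s v \<in> ball (p + t *s v) d2" using z shift[of t z] by (simp add: d_def)
    then have "z + t *s v \<in> ?B" using d2(2) t by blast
    then show "t \<in> A z" by (simp add: A_def)
  qed
  have dU: "ball p d \<subseteq> U"
  proof
    fix z assume "z \<in> ball p d"
    then have "0 \<in> A z" using in_disc r(1) by fastforce
    then show "z \<in> U" using \<rho> by (auto simp: A_def)
  qed
  define k where "k = (\<lambda>z t. g (z + (of_real r * unit_circle t) *s v) / h (z + (of_real r * unit_circle t) *s v))"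
  have nr: "norm (of_real r * unit_circle t) = r" for t using r by (simp add: norm_mult)
  define F where "F = (\<lambda>z. \<integral>t. k z t \<partial>circle_measure)"
  have "holomorphic_fun_on F (ball p d)"
    unfolding F_def
  proof (rule hol_lebesgue_integral[OF open_ball])
    show "holomorphic_fun_on (\<lambda>z. k z t) (ball p d)" for t
      unfolding k_def using on_circle[OF _ nr]
      by (intro hol_divide hol_translate[OF open_ball gB] hol_translate[OF open_ball hB]) auto
    show "k z \<in> borel_measurable circle_measure" if z: "z \<in> ball p d" for z
      unfolding k_def using on_circle[OF z nr]
      by (intro continuous_circle_measurable continuous_on_divide continuous_intros
          continuous_on_compose2[OF hol_continuous[OF gB]] continuous_on_compose2[OF hol_continuous[OF hB]]) auto
    fix z assume z: "z \<in> ball p d"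
    have "norm (k y t) \<le> R" if "y \<in> ball p d" for y t
    proof -
      let ?y = "y + (of_real r * unit_circle t) *s v"
      have "h ?y \<noteq> 0" "?y \<in> U" using on_circle[OF that nr] \<rho> by auto
      then show ?thesis using le[of ?y] by (simp add: k_def norm_divide divide_le_eq)
    qed
    moreover have "integrable circle_measure (\<lambda>_. R)"
      using finite_measure.integrable_const[OF finite_measure_circle] .
    moreover obtain e where "e > 0" "ball z e \<subseteq> ball p d" using z open_ball open_contains_ball by blast
    ultimately show "\<exists>e>0. \<exists>B. ball z e \<subseteq> ball p d \<and> integrable circle_measure B \<and>
       (\<forall>y\<in>ball z e. \<forall>t\<in>space circle_measure. norm (k y t) \<le> B t)"
      by (intro exI[of _ e] conjI exI[of _ "\<lambda>_. R"]) auto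
  qed
  \<comment> \<open>If \<open>h z\<close> is nonzero, the quotient on the slice through
    \<open>z\<close> extends over the disc by the one-variable lemma, and its circle mean is its
    value at the centre. If \<open>h z = 0\<close>, the bound gives \<open>g z = 0\<close>.\<close>
  moreover have "g z = h z * F z" if z: "z \<in> ball p d" for z
  proof (cases "h z = 0")
    case True
    then show ?thesis using le[of z] z dU by auto
  next
    case False
    have z0: "0 \<in> A z" using in_disc[OF z] r(1) by fastforce
    have leA: "norm (g (z + t *s v)) \<le> R * norm (h (z + t *s v))" if "t \<in> A z" for t
      using that \<rho> by (intro le) (auto simp: A_def)
    have "h (z + 0 *s v) \<noteq> 0" using False by simp
    from holomorphic_quotient_bounded[OF A holA(2,1) leA z0 this]
    obtain q where q: "q holomorphic_on A z" "\<And>t. t \<in> A z \<Longrightarrow> g (z + t *s v) = q t * h (z + t *s v)"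
      by blast
    have "F z = (\<integral>t. q (of_real r * unit_circle t) \<partial>circle_measure)"
      unfolding F_def
    proof (rule Bochner_Integration.integral_cong[OF refl])
      fix t
      have "of_real r * unit_circle t \<in> cball 0 r" using nr[of t] by simp
      then have "of_real r * unit_circle t \<in> A z" using in_disc[OF z] by blast
      then show "k z t = q (of_real r * unit_circle t)"
        using q(2) on_circle(2)[OF z nr[of t]] by (simp add: k_def)
    qed
    also have "\<dots> = q 0" using circle_mean[OF q(1) A(1) in_disc[OF z]] r by simp
    finally show ?thesis using q(2)[OF z0] by (simp add: mult.commute)
  qed
  ultimately show ?thesis using d dU by blast
qed

text \<open>Local quotients agree where \<open>h\<close> is nonzero. If two of them differed
  somewhere, they would differ on an open set, on which \<open>h\<close> would have to
  vanish.\<close>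

lemma hol_quotient_bounded:
  fixes g h :: "complex^'n::finite \<Rightarrow> complex"
  assumes U: "open U" and g: "holomorphic_fun_on g U" and h: "holomorphic_fun_on h U"
    and le: "\<And>z. z \<in> U \<Longrightarrow> norm (g z) \<le> R * norm (h z)"
    and nz: "\<And>T. open T \<Longrightarrow> T \<noteq> {} \<Longrightarrow> T \<subseteq> U \<Longrightarrow> \<exists>z\<in>T. h z \<noteq> 0"
  shows "\<exists>F. holomorphic_fun_on F U \<and> (\<forall>z\<in>U. g z = h z * F z)"
proof -
  have "\<forall>p. \<exists>d F. p \<in> U \<longrightarrow> d > 0 \<and> ball p d \<subseteq> U \<and> holomorphic_fun_on F (ball p d) \<and> (\<forall>z\<in>ball p d. g z = h z * F z)"
    using local_quotient_bounded[OF assms] by blast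
  then obtain d F where dF: "\<And>p. p \<in> U \<Longrightarrow> d p > 0" "\<And>p. p \<in> U \<Longrightarrow> ball p (d p) \<subseteq> U"
    "\<And>p. p \<in> U \<Longrightarrow> holomorphic_fun_on (F p) (ball p (d p))" "\<And>p z. p \<in> U \<Longrightarrow> z \<in> ball p (d p) \<Longrightarrow> g z = h z * F p z"
    by metis
  define Q where "Q = (\<lambda>z. F z z)"
  have QF: "F p z = Q z" if p: "p \<in> U" "z \<in> ball p (d p)" for p z
  proof (rule ccontr)
    assume ne: "F p z \<noteq> Q z"
    have z: "z \<in> U" using p dF(2) by blast
    let ?S = "ball p (d p) \<inter> ball z (d z)"
    have "continuous_on ?S (\<lambda>x. F p x - F z x)"
      by (intro continuous_on_diff continuous_on_subset[OF hol_continuous[OF dF(3)[OF p(1)]]]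
           continuous_on_subset[OF hol_continuous[OF dF(3)[OF z]]]) auto
    then have 1: "open (?S \<inter> (\<lambda>x. F p x - F z x) -` (- {0}))" by (intro continuous_open_preimage) auto
    have "z \<in> ?S \<inter> (\<lambda>x. F p x - F z x) -` (- {0})" using ne p dF(1)[OF z] by (simp add: Q_def)
    then have 2: "?S \<inter> (\<lambda>x. F p x - F z x) -` (- {0}) \<noteq> {}" by blast
    have "?S \<inter> (\<lambda>x. F p x - F z x) -` (- {0}) \<subseteq> U" using dF(2)[OF z] by blast
    from nz[OF 1 2 this] obtain x where "x \<in> ?S \<inter> (\<lambda>x. F p x - F z x) -` (- {0})" "h x \<noteq> 0" by blast
    then have x: "x \<in> ?S" "F p x \<noteq> F z x" "h x \<noteq> 0" by simp_all
    then have "h x * F p x = h x * F z x" using dF(4)[OF p(1), of x] dF(4)[OF z, of x] by simp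
    then show False using x by simp
  qed
  have "holomorphic_fun_on Q U"
  proof (rule hol_locally[OF U])
    fix p assume p: "p \<in> U"
    have "holomorphic_fun_on Q (ball p (d p))"
      by (rule hol_transform[OF open_ball dF(3)[OF p] QF[OF p]])
    then show "\<exists>T. open T \<and> p \<in> T \<and> holomorphic_fun_on Q T" using dF(1)[OF p] by (intro exI[of _ "ball p (d p)"]) auto
  qed
  moreover have "g z = h z * Q z" if "z \<in> U" for z
    using dF(4)[OF that, of z] dF(1)[OF that] by (simp add: Q_def)
  ultimately show ?thesis by blast
qed

lemma hol2_section:
  fixes F :: "(complex^'n::finite) \<times> (complex^'m::finite) \<Rightarrow> complex"
  assumes F: "holomorphic_fun2_on F (U \<times> S)" and w: "w \<in> S"
  shows "holomorphic_fun_on (\<lambda>z. F (z, w)) U"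
  unfolding holomorphic_wrt_def
proof
  fix z assume z: "z \<in> U"
  obtain L where L: "(F has_derivative L) (at (z, w) within U \<times> S)" "Vector_Spaces.linear pair_scale (*) L"
    using F z w unfolding holomorphic_wrt_def by blast
  have 1: "((\<lambda>z. (z, w)) has_derivative (\<lambda>v. (v, 0))) (at z within U)"
    by (intro derivative_eq_intros) auto
  have "(F has_derivative L) (at (z, w) within (\<lambda>z. (z, w)) ` U)"
    using L(1) by (rule has_derivative_subset) (use w in auto)
  from has_derivative_in_compose[OF 1 this]
  have "((\<lambda>z. F (z, w)) has_derivative (\<lambda>v. L (v, 0))) (at z within U)" .
  moreover have "complex_linear (\<lambda>v. L (v, 0))"
  proof -
    have add: "L (a + b) = L a + L b" and sc: "L (pair_scale c a) = c * L a" for a b c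
      using L(2) unfolding Vector_Spaces.linear_iff by blast+
    show ?thesis
      unfolding complex_linear_def using add[of "(x, 0)" "(y, 0)" for x y] sc[of _ "(x, 0)" for x] by (auto simp: pair_scale_def)
  qed
  ultimately show "\<exists>L. ((\<lambda>z. F (z, w)) has_derivative L) (at z within U) \<and> Vector_Spaces.linear (*s) (*) L"
    unfolding linear_scale_iff_complex_linear by blast
qed

section \<open>The extension theorem\<close>

context proper_hol_map
begin

text \<open>The image of the density \<open>cnj q\<close> on \<open>G\<close> under the dilation by
  \<open>s\<close>, smoothed with the bump: if the dilation maps \<open>G\<close> into
  \<open>ball 0 e\<close>, it vanishes outside \<open>ball 0 (2 * e)\<close>.\<close>

definition dilated_kernel :: "('n \<Rightarrow> nat) \<Rightarrow> real \<Rightarrow> real \<Rightarrow> (complex^'n \<Rightarrow> complex) \<Rightarrow> complex^'n \<Rightarrow> complex" where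
  "dilated_kernel m e s q y =
     (\<integral>w. of_real (bump e (wact m (of_real s) w - y)) * (indicator G w *\<^sub>R cnj (q w)) \<partial>lborel)"

text \<open>For unimodular \<open>c\<close> the action is a linear isometry preserving
  \<open>G\<close>, hence it preserves the balls contained in \<open>G\<close>; \<open>1 / c\<close>
  provides the converse.\<close>

lemma inner_set_invariant:
  assumes circ: "quasi_circular m G" and c: "norm c = 1"
  shows "wact m c w \<in> inner_set e \<longleftrightarrow> w \<in> inner_set e"
proof -
  have imp: "wact m c w \<in> inner_set e" if w: "w \<in> inner_set e" and c: "norm c = 1" for c w
  proof -
    have "y \<in> G" if y: "y \<in> cball (wact m c w) (2 * e)" for y
    proof -
      have c0: "c \<noteq> 0" using c by auto
      define x where "x = wact m (1 / c) y"
      have yx: "wact m c x = y" using c0 by (simp add: x_def wact_wact vec_eq_iff)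
      have "wact m c w - y = wact m c (w - x)" by (simp add: vec_eq_iff right_diff_distrib flip: yx)
      then have "dist (wact m c w) y = dist w x" by (simp add: dist_norm norm_wact[OF c])
      then have "x \<in> G" using y w by auto
      then show ?thesis using quasi_circularD[OF circ _ c] yx by metis
    qed
    then show ?thesis by blast
  qed
  have "c \<noteq> 0" using c by auto
  then have "wact m (1 / c) (wact m c w) = w" by (simp add: wact_wact vec_eq_iff)
  moreover have "norm (1 / c) = 1" using c by (simp add: norm_divide)
  ultimately show ?thesis using imp[of w c] imp[of "wact m c w" "1 / c"] c by auto
qed

lemma G_integrable:
  assumes "continuous_on UNIV q"
  shows "integrable lborel (\<lambda>w. indicator G w *\<^sub>R cnj (q w))"
  by (intro bounded_subset_integrable continuous_intros assms G) simp

lemma dilated_kernel_measurable: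
  assumes e: "e > 0" and q: "continuous_on UNIV q"
  shows "dilated_kernel m e s q \<in> borel_measurable borel"
proof -
  note [measurable] = bump_measurable[OF e]
  have [measurable]: "(\<lambda>w. indicator G w *\<^sub>R cnj (q w)) \<in> borel_measurable borel"
    using G_integrable[OF q] by simp
  have [measurable]: "(\<lambda>w. wact m (of_real s) w) \<in> borel_measurable borel"
    by (intro borel_measurable_continuous_onI continuous_wact continuous_intros)
  have "(\<lambda>y. \<integral>w. of_real (bump e (wact m (of_real s) w - y)) * (indicator G w *\<^sub>R cnj (q w)) \<partial>lborel) \<in> borel_measurable borel"
    by (rule lborel.borel_measurable_lebesgue_integral) measurable
  then show ?thesis by (simp add: dilated_kernel_def[abs_def])
qed

text \<open>Linear in the bound \<open>M\<close> of \<open>q\<close>, so that a power of degree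
  \<open>k\<close> produces a bound geometric in \<open>k\<close>.\<close>

lemma dilated_kernel_bound:
  assumes e: "e > 0" and q: "continuous_on UNIV q" and B: "\<And>x::complex^'n. bump e x \<le> B"
    and M: "\<And>w. w \<in> G \<Longrightarrow> norm (q w) \<le> M"
  shows "norm (dilated_kernel m e s q y) \<le> B * measure lborel G * M"
proof -
  let ?k = "\<lambda>w. of_real (bump e (wact m (of_real s) w - y)) * (indicator G w *\<^sub>R cnj (q w))"
  have fin: "emeasure lborel G < \<infinity>" using emeasure_bounded_finite[OF G(2)] by simp
  have kb: "norm (?k w) \<le> B * M * indicator G w" for w
  proof (cases "w \<in> G")
    case True
    have "bump e (wact m (of_real s) w - y) * norm (q w) \<le> B * M"
      using M[OF True] B[of "wact m (of_real s) w - y"] bump_nonneg[OF e, of "wact m (of_real s) w - y"]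
      by (intro mult_mono) (auto intro: order_trans)
    then show ?thesis using True by (simp add: norm_mult bump_nonneg[OF e])
  qed simp
  have int: "integrable lborel (\<lambda>w. B * M * indicator G w)"
    using fin G(1) by (intro integrable_mult_right integrable_real_indicator) auto
  have "norm (dilated_kernel m e s q y) \<le> (\<integral>w. norm (?k w) \<partial>lborel)"
    unfolding dilated_kernel_def by (rule integral_norm_bound)
  also have "\<dots> \<le> (\<integral>w. B * M * indicator G w \<partial>lborel)"
  proof (rule integral_mono'[OF int])
    show "norm (?k w) \<le> B * M * indicator G w" for w by (rule kb)
    show "0 \<le> B * M * indicator G w" for w using kb[of w] norm_ge_zero order_trans by blast
  qed
  also have "\<dots> = B * measure lborel G * M" using G(1) by simp
  finally show ?thesis .
qed

lemma dilated_kernel_zero: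
  assumes e: "e > 0" and sG: "\<And>w. w \<in> G \<Longrightarrow> wact m (of_real s) w \<in> ball 0 e" and y: "norm y \<ge> 2 * e"
  shows "dilated_kernel m e s q y = 0"
proof -
  have z: "of_real (bump e (wact m (of_real s) w - y)) * (indicator G w *\<^sub>R cnj (q w)) = 0" for w
  proof (cases "w \<in> G")
    case True
    then have "norm (wact m (of_real s) w) < e" using sG by simp
    then have "e \<le> norm (wact m (of_real s) w - y)"
      using norm_triangle_ineq2[of y "wact m (of_real s) w"] y by (simp add: norm_minus_commute)
    then show ?thesis using bump_zero[OF e, of "wact m (of_real s) w - y"] by simp
  qed simp
  show ?thesis unfolding dilated_kernel_def z by simp
qed

text \<open>\<open>dilation_pairing\<close> is applied to the trace of \<open>b\<close> on the sets
  \<open>inner_set\<close>, which then exhaust \<open>G\<close>. On the dilated side the limit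
  exists by domination, since the trace is evaluated only inside \<open>cball 0 e\<close>, where it
  is bounded. There it also equals \<open>push b e\<close>, and Fubini produces the dilated
  kernel.\<close>

lemma pairing_dilated_kernel:
  assumes circ: "quasi_circular m G" and conn: "connected G" and m: "\<And>j. m j > 0"
    and e: "e > 0" "cball 0 (2 * e) \<subseteq> G" and s: "0 < s" "s \<le> 1"
    and sG: "\<And>w. w \<in> G \<Longrightarrow> wact m (of_real s) w \<in> ball 0 e"
    and b: "holomorphic_fun_on b D" and int: "integrable lborel (\<lambda>z. indicator D z *\<^sub>R (cnj (jac z) * b z))"
    and q: "holomorphic_fun_on q UNIV" and hom: "\<And>c w. q (wact m c w) = c ^ d * q w"
  shows "of_real s ^ d * (\<integral>z. (indicator D z *\<^sub>R (cnj (jac z) * b z)) * cnj (q (f z)) \<partial>lborel) =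
     (\<integral>z. (indicator D z *\<^sub>R (cnj (jac z) * b z)) * dilated_kernel m e s q (fD z) \<partial>lborel)"
proof -
  have qc: "continuous_on UNIV q" by (rule hol_continuous[OF q])
  define A where "A = (\<lambda>z. indicator D z *\<^sub>R (cnj (jac z) * b z))"
  have A: "integrable lborel A" using int by (simp add: A_def)
  define H where "H = trace_fun b"
  have H: "holomorphic_fun_on H G" unfolding H_def by (rule trace_fun_holomorphic[OF b])
  let ?W = "\<lambda>n. inner_set (1 / real (Suc n))"
  have eball: "cball 0 e \<subseteq> G" using e by (auto simp: subset_eq)
  have eball': "ball 0 e \<subseteq> G" using eball by auto
  have sG': "wact m (of_real s) w \<in> G" if "w \<in> G" for w using sG[OF that] eball' by blast
  have seq: "(\<integral>w. indicator (?W n) w *\<^sub>R (H (wact m (of_real s) w) * cnj (q w)) \<partial>lborel) =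
     of_real s ^ d * (\<integral>w. indicator (?W n) w *\<^sub>R (H w * cnj (q w)) \<partial>lborel)" for n
  proof (rule dilation_pairing[OF G(1) circ H conn m e(1) eball' s sG])
    show "open (?W n)" by (rule open_inner_set) simp
    have "ball w (1 / real (Suc n)) \<subseteq> cball w (2 * (1 / real (Suc n)))" for w :: "complex^'n"
    proof
      fix x assume "x \<in> ball w (1 / real (Suc n))"
      then have "dist w x < 1 / real (Suc n)" by simp
      moreover have "0 < 1 / real (Suc n)" by simp
      ultimately have "dist w x \<le> 2 * (1 / real (Suc n))" by linarith
      then show "x \<in> cball w (2 * (1 / real (Suc n)))" by simp
    qed
    then show "?W n \<subseteq> {w. ball w (1 / real (Suc n)) \<subseteq> G}" by blast
    show "compact {w. ball w (1 / real (Suc n)) \<subseteq> G}" "{w. ball w (1 / real (Suc n)) \<subseteq> G} \<subseteq> G"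
      by (rule compact_ball_inside[OF G(2)], simp)+
  show "wact m c w \<in> ?W n \<longleftrightarrow> w \<in> ?W n" if "norm c = 1" for c w by (rule inner_set_invariant[OF circ that])
    show "continuous_on UNIV q" by (rule qc)
    show "q (wact m c w) = c ^ d * q w" for c w by (rule hom)
  qed
  obtain B where B: "\<And>x. x \<in> cball 0 e \<Longrightarrow> norm (H x) \<le> B" using hol_bounded_cball[OF H eball] by blast
  obtain R where R: "\<And>x. x \<in> G \<Longrightarrow> norm x \<le> R" using G(2) bounded_iff by blast
  obtain M where M: "\<And>x. x \<in> cball 0 R \<Longrightarrow> norm (q x) \<le> M" using hol_bounded_cball[OF q, of 0 R] by blast
  have fin: "emeasure lborel G < \<infinity>" using emeasure_bounded_finite[OF G(2)] by simp
  have Hs: "continuous_on G (\<lambda>w. H (wact m (of_real s) w) * cnj (q w))"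
    using sG' by (intro continuous_intros continuous_on_compose2[OF hol_continuous[OF H]] continuous_wact continuous_on_subset[OF qc]) auto
  have lim1: "(\<lambda>n. \<integral>w. indicator (?W n) w *\<^sub>R (H (wact m (of_real s) w) * cnj (q w)) \<partial>lborel) \<longlonglongrightarrow>
     (\<integral>w. indicator G w *\<^sub>R (H (wact m (of_real s) w) * cnj (q w)) \<partial>lborel)"
  proof (rule integral_dominated_convergence[where w = "\<lambda>w. (max 0 B * max 0 M) * indicator G w"])
    show "integrable lborel (\<lambda>w. (max 0 B * max 0 M) * indicator G w)"
      using fin G(1) by (intro integrable_mult_right integrable_real_indicator) auto
    show "(\<lambda>w. indicator G w *\<^sub>R (H (wact m (of_real s) w) * cnj (q w))) \<in> borel_measurable lborel"
      unfolding measurable_lborel2 by (rule indicator_times_measurable[OF G(1) Hs])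
    show "(\<lambda>w. indicator (?W n) w *\<^sub>R (H (wact m (of_real s) w) * cnj (q w))) \<in> borel_measurable lborel" for n
      unfolding measurable_lborel2
      by (intro indicator_times_measurable open_inner_set continuous_on_subset[OF Hs] inner_set_subset) simp_all
    show "AE w in lborel. (\<lambda>n. indicator (?W n) w *\<^sub>R (H (wact m (of_real s) w) * cnj (q w))) \<longlonglongrightarrow>
       indicator G w *\<^sub>R (H (wact m (of_real s) w) * cnj (q w))"
    proof (rule AE_I2)
      fix w
      have "\<exists>N. \<forall>n\<ge>N. w \<in> ?W n \<longleftrightarrow> w \<in> G"
      proof (cases "w \<in> G")
        case True
        then obtain r where r: "r > 0" "cball w r \<subseteq> G" using G open_contains_cball by blast
        obtain N where N: "1 / real (Suc N) < r / 2" using nat_approx_posE[of "r/2"] r by auto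
        have "w \<in> ?W n" if "n \<ge> N" for n
        proof -
          have "1 / real (Suc n) \<le> 1 / real (Suc N)" using that by (intro divide_left_mono) auto
          then have "2 * (1 / real (Suc n)) \<le> r" using N by linarith
          then show ?thesis using r by (auto simp: subset_eq)
        qed
        then show ?thesis using True by blast
      next
        case False
        have "w \<notin> ?W n" for n using False inner_set_subset[of "1 / real (Suc n)"] by (meson subsetD zero_less_divide_1_iff of_nat_0_less_iff zero_less_Suc)
        then show ?thesis using False by blast
      qed
      then obtain N where "\<And>n. n \<ge> N \<Longrightarrow> w \<in> ?W n \<longleftrightarrow> w \<in> G" by blast
      then show "(\<lambda>n. indicator (?W n) w *\<^sub>R (H (wact m (of_real s) w) * cnj (q w))) \<longlonglongrightarrow>
       indicator G w *\<^sub>R (H (wact m (of_real s) w) * cnj (q w))"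
        by (intro tendsto_eventually eventually_sequentiallyI[of N]) (simp add: indicator_def)
    qed
    show "AE w in lborel. norm (indicator (?W n) w *\<^sub>R (H (wact m (of_real s) w) * cnj (q w)))
       \<le> (max 0 B * max 0 M) * indicator G w" for n
    proof (rule AE_I2)
      fix w
      show "norm (indicator (?W n) w *\<^sub>R (H (wact m (of_real s) w) * cnj (q w))) \<le> (max 0 B * max 0 M) * indicator G w"
      proof (cases "w \<in> ?W n")
        case True
        then have w: "w \<in> G" using inner_set_subset[of "1 / real (Suc n)"] by (meson subsetD zero_less_divide_1_iff of_nat_0_less_iff zero_less_Suc)
        have "norm (H (wact m (of_real s) w)) \<le> max 0 B" using B[of "wact m (of_real s) w"] sG[OF w] by simp
        moreover have "norm (q w) \<le> max 0 M" using M[of w] R[OF w] by simp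
        ultimately have "norm (H (wact m (of_real s) w)) * norm (q w) \<le> max 0 B * max 0 M" by (intro mult_mono) auto
        then show ?thesis using True w by (simp add: norm_mult)
      qed (simp add: indicator_def)
    qed
  qed
  have lim2: "(\<lambda>n. of_real s ^ d * (\<integral>w. indicator (?W n) w *\<^sub>R (H w * cnj (q w)) \<partial>lborel)) \<longlonglongrightarrow>
     of_real s ^ d * (\<integral>z. A z * cnj (q (f z)) \<partial>lborel)"
    unfolding H_def A_def by (intro tendsto_mult tendsto_const trace_pairing_tendsto b int q)
  have "of_real s ^ d * (\<integral>z. A z * cnj (q (f z)) \<partial>lborel) =
     (\<integral>w. indicator G w *\<^sub>R (H (wact m (of_real s) w) * cnj (q w)) \<partial>lborel)"
    by (rule LIMSEQ_unique[OF lim2]) (use lim1 in \<open>simp only: seq\<close>)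
  also have "\<dots> = (\<integral>w. (\<integral>z. A z * of_real (bump e (wact m (of_real s) w - fD z)) \<partial>lborel) * (indicator G w *\<^sub>R cnj (q w)) \<partial>lborel)"
  proof (rule Bochner_Integration.integral_cong[OF refl])
    fix w
    show "indicator G w *\<^sub>R (H (wact m (of_real s) w) * cnj (q w)) =
      (\<integral>z. A z * of_real (bump e (wact m (of_real s) w - fD z)) \<partial>lborel) * (indicator G w *\<^sub>R cnj (q w))"
    proof (cases "w \<in> G")
      case True
      have "cball (wact m (of_real s) w) e \<subseteq> cball 0 (2 * e)"
      proof
        fix y assume "y \<in> cball (wact m (of_real s) w) e"
        then show "y \<in> cball 0 (2 * e)" using sG[OF True] dist_triangle[of 0 y "wact m (of_real s) w"] by simp
      qed
      then have "H (wact m (of_real s) w) = push b e (wact m (of_real s) w)"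
        unfolding H_def using e by (intro trace_fun_eq b) auto
      also have "\<dots> = (\<integral>z. A z * of_real (bump e (wact m (of_real s) w - fD z)) \<partial>lborel)"
        unfolding push_def A_def
        by (rule Bochner_Integration.integral_cong[OF refl]) (simp add: fD_def indicator_def)
      finally show ?thesis using True by simp
    qed simp
  qed
  also have "\<dots> = (\<integral>z. A z * dilated_kernel m e s q (fD z) \<partial>lborel)"
  proof -
    note [measurable] = bump_measurable[OF e(1)]
    have [measurable]: "(\<lambda>w. wact m (of_real s) w) \<in> borel_measurable borel"
      by (intro borel_measurable_continuous_onI continuous_wact continuous_intros)
    obtain B0 where B0: "\<And>x::complex^'n. bump e x \<le> B0" using bump_bound[OF e(1)] by blast
    have "(\<lambda>(z, w). complex_of_real (bump e (wact m (of_real s) w - fD z))) \<in> borel_measurable (lborel \<Otimes>\<^sub>M lborel)"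
      by measurable
    moreover have "norm (complex_of_real (bump e (wact m (of_real s) w - fD z))) \<le> B0" for z w
      using B0 by (simp add: bump_nonneg[OF e(1)])
    ultimately show ?thesis
      unfolding dilated_kernel_def
      by (intro fubini_bounded_kernel[symmetric] lborel.sigma_finite_measure_axioms A G_integrable qc)
  qed
  finally show ?thesis by (simp add: A_def)
qed

end

lemma norm_component_power_le:
  fixes w :: "complex^'n::finite"
  assumes "norm w \<le> R"
  shows "norm (w $ j ^ k) \<le> R ^ k"
  unfolding norm_power by (rule power_mono[OF order_trans[OF Finite_Cartesian_Product.norm_nth_le assms]]) simp

lemma cnj_vec_cnj_vec [simp]: "cnj_vec (cnj_vec x) = x"
  by (simp add: cnj_vec_def vec_eq_iff)

lemma continuous_cnj_vec: "continuous_on S cnj_vec"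
  unfolding cnj_vec_def by (intro continuous_intros)

text \<open>The bound \<open>B\<close> depends on \<open>z\<close>, but on \<open>k\<close> only
  through \<open>M\<close>; thus one constant covers a whole family of densities at once.\<close>

lemma kernel_integral:
  fixes F :: "(complex^'n::finite) \<times> (complex^'n) \<Rightarrow> complex"
  assumes U: "open U" and K: "open K" and F: "holomorphic_fun2_on F (U \<times> (cnj_vec ` K))"
    and C: "compact C" "C \<subseteq> K"
  shows kernel_integral_holomorphic:
    "\<And>k M. k \<in> borel_measurable borel \<Longrightarrow> (\<And>\<zeta>. norm (k \<zeta>) \<le> M) \<Longrightarrow> (\<And>\<zeta>. \<zeta> \<notin> C \<Longrightarrow> k \<zeta> = 0) \<Longrightarrow>
      holomorphic_fun_on (\<lambda>z. \<integral>\<zeta>. k \<zeta> * F (z, cnj_vec \<zeta>) \<partial>lborel) U"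
    and kernel_integral_bound:
    "\<And>z. z \<in> U \<Longrightarrow> \<exists>B. \<forall>k M. k \<in> borel_measurable borel \<longrightarrow> (\<forall>\<zeta>. norm (k \<zeta>) \<le> M) \<longrightarrow> (\<forall>\<zeta>. \<zeta> \<notin> C \<longrightarrow> k \<zeta> = 0) \<longrightarrow>
      norm (\<integral>\<zeta>. k \<zeta> * F (z, cnj_vec \<zeta>) \<partial>lborel) \<le> B * M"
proof -
  have contF: "continuous_on (U \<times> (cnj_vec ` K)) F" by (rule hol_continuous[OF F])
  have Cm: "C \<in> sets lborel" using C(1) by (simp add: borel_closed compact_imp_closed)
  have finC: "emeasure lborel C < \<infinity>" using emeasure_bounded_finite[OF compact_imp_bounded[OF C(1)]] by simp
  have bnd: "\<exists>r>0. \<exists>B\<ge>0. ball z r \<subseteq> U \<and> (\<forall>y\<in>ball z r. \<forall>\<zeta>\<in>C. norm (F (y, cnj_vec \<zeta>)) \<le> B)" if z: "z \<in> U" for z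
  proof -
    obtain r where r: "r > 0" "cball z r \<subseteq> U" using U z open_contains_cball by blast
    have "continuous_on (cball z r \<times> C) (\<lambda>p. F (fst p, cnj_vec (snd p)))"
      using r C by (intro continuous_on_compose2[OF contF] continuous_intros continuous_on_compose2[OF continuous_cnj_vec[of UNIV]]) auto
    then have "compact ((\<lambda>p. F (fst p, cnj_vec (snd p))) ` (cball z r \<times> C))"
      using C by (intro compact_continuous_image compact_Times) auto
    then obtain B where B: "\<And>p. p \<in> cball z r \<times> C \<Longrightarrow> norm (F (fst p, cnj_vec (snd p))) \<le> B"
      unfolding compact_eq_bounded_closed bounded_iff by blast
    have "norm (F (y, cnj_vec \<zeta>)) \<le> max 0 B" if "y \<in> ball z r" "\<zeta> \<in> C" for y \<zeta>
      using B[of "(y, \<zeta>)"] that by simp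
    moreover have "ball z r \<subseteq> U" using r by auto
    ultimately show ?thesis using r(1) by (intro exI[of _ r] conjI exI[of _ "max 0 B"]) auto
  qed
  have meas: "(\<lambda>\<zeta>. k \<zeta> * F (z, cnj_vec \<zeta>)) \<in> borel_measurable lborel"
    if "k \<in> borel_measurable borel" "\<And>\<zeta>. \<zeta> \<notin> C \<Longrightarrow> k \<zeta> = 0" "z \<in> U" for k z
  proof -
    have "continuous_on K (\<lambda>\<zeta>. F (z, cnj_vec \<zeta>))"
      using that(3) by (intro continuous_on_compose2[OF contF] continuous_intros continuous_cnj_vec) auto
    from indicator_times_measurable[OF K this] that(1)
    have "(\<lambda>\<zeta>. k \<zeta> * (indicator K \<zeta> *\<^sub>R F (z, cnj_vec \<zeta>))) \<in> borel_measurable borel"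
      by (rule borel_measurable_times[rotated])
    moreover have "(\<lambda>\<zeta>. k \<zeta> * (indicator K \<zeta> *\<^sub>R F (z, cnj_vec \<zeta>))) = (\<lambda>\<zeta>. k \<zeta> * F (z, cnj_vec \<zeta>))"
      using that(2) C(2) by (auto simp: fun_eq_iff indicator_def)
    ultimately show ?thesis by simp
  qed
  have kF: "norm (k \<zeta> * F (y, cnj_vec \<zeta>)) \<le> M * B * indicator C \<zeta>"
    if "norm (k \<zeta>) \<le> M" "\<zeta> \<notin> C \<Longrightarrow> k \<zeta> = 0" "\<zeta> \<in> C \<Longrightarrow> norm (F (y, cnj_vec \<zeta>)) \<le> B" "B \<ge> 0" for k :: "complex^'n \<Rightarrow> complex" and \<zeta> y M B
  proof (cases "\<zeta> \<in> C")
    case True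
    have "norm (k \<zeta>) * norm (F (y, cnj_vec \<zeta>)) \<le> M * B"
      using that(1,4) that(3)[OF True] by (intro mult_mono) (auto intro: order_trans[OF norm_ge_zero])
    then show ?thesis using True by (simp add: norm_mult)
  qed (use that in simp)
  have intC: "integrable lborel (\<lambda>\<zeta>. c * indicator C \<zeta> :: real)" for c
    using finC Cm by (intro integrable_mult_right integrable_real_indicator) auto
  show "holomorphic_fun_on (\<lambda>z. \<integral>\<zeta>. k \<zeta> * F (z, cnj_vec \<zeta>) \<partial>lborel) U"
    if k: "k \<in> borel_measurable borel" and M: "\<And>\<zeta>. norm (k \<zeta>) \<le> M" and k0: "\<And>\<zeta>. \<zeta> \<notin> C \<Longrightarrow> k \<zeta> = 0" for k M
  proof (rule hol_lebesgue_integral[OF U])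
    show "holomorphic_fun_on (\<lambda>z. k \<zeta> * F (z, cnj_vec \<zeta>)) U" for \<zeta>
    proof (cases "\<zeta> \<in> C")
      case True
      then have "cnj_vec \<zeta> \<in> cnj_vec ` K" using C by blast
      then show ?thesis by (intro hol_cmult[OF U] hol2_section[OF F])
    next
      case False
      then show ?thesis using k0 by (simp add: hol_const[OF U])
    qed
    show "(\<lambda>\<zeta>. k \<zeta> * F (z, cnj_vec \<zeta>)) \<in> borel_measurable lborel" if "z \<in> U" for z
      using meas[OF k k0 that] by simp
    fix z assume "z \<in> U"
    then obtain r B where r: "r > 0" "B \<ge> 0" "ball z r \<subseteq> U" "\<And>y \<zeta>. y \<in> ball z r \<Longrightarrow> \<zeta> \<in> C \<Longrightarrow> norm (F (y, cnj_vec \<zeta>)) \<le> B"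
      using bnd by blast
    have "\<forall>y\<in>ball z r. \<forall>\<zeta>\<in>space lborel. norm (k \<zeta> * F (y, cnj_vec \<zeta>)) \<le> M * B * indicator C \<zeta>"
      proof (intro ballI)
      fix y \<zeta> assume "y \<in> ball z r"
      then show "norm (k \<zeta> * F (y, cnj_vec \<zeta>)) \<le> M * B * indicator C \<zeta>"
        by (intro kF[OF M k0] r)
    qed
    then show "\<exists>r>0. \<exists>B. ball z r \<subseteq> U \<and> integrable lborel B \<and> (\<forall>y\<in>ball z r. \<forall>\<zeta>\<in>space lborel. norm (k \<zeta> * F (y, cnj_vec \<zeta>)) \<le> B \<zeta>)"
      using r intC by blast
  qed
  show "\<exists>B. \<forall>k M. k \<in> borel_measurable borel \<longrightarrow> (\<forall>\<zeta>. norm (k \<zeta>) \<le> M) \<longrightarrow> (\<forall>\<zeta>. \<zeta> \<notin> C \<longrightarrow> k \<zeta> = 0) \<longrightarrow>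
      norm (\<integral>\<zeta>. k \<zeta> * F (z, cnj_vec \<zeta>) \<partial>lborel) \<le> B * M" if z: "z \<in> U" for z
  proof -
    obtain r B where r: "r > 0" "B \<ge> 0" "ball z r \<subseteq> U" "\<And>y \<zeta>. y \<in> ball z r \<Longrightarrow> \<zeta> \<in> C \<Longrightarrow> norm (F (y, cnj_vec \<zeta>)) \<le> B"
      using bnd[OF z] by blast
    have "norm (\<integral>\<zeta>. k \<zeta> * F (z, cnj_vec \<zeta>) \<partial>lborel) \<le> (B * measure lborel C) * M"
      if k: "k \<in> borel_measurable borel" and M: "\<And>\<zeta>. norm (k \<zeta>) \<le> M" and k0: "\<And>\<zeta>. \<zeta> \<notin> C \<Longrightarrow> k \<zeta> = 0" for k M
    proof -
      have b: "norm (k \<zeta> * F (z, cnj_vec \<zeta>)) \<le> M * B * indicator C \<zeta>" for \<zeta>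
        by (rule kF[OF M k0]) (use r in auto)
      have "norm (\<integral>\<zeta>. k \<zeta> * F (z, cnj_vec \<zeta>) \<partial>lborel) \<le> (\<integral>\<zeta>. norm (k \<zeta> * F (z, cnj_vec \<zeta>)) \<partial>lborel)"
        by (rule integral_norm_bound)
      also have "\<dots> \<le> (\<integral>\<zeta>. M * B * indicator C \<zeta> \<partial>lborel)"
        by (rule integral_mono'[OF intC b]) (rule order_trans[OF norm_ge_zero b])
      also have "\<dots> = (B * measure lborel C) * M" using Cm by simp
      finally show ?thesis .
    qed
    then show ?thesis by blast
  qed
qed

context proper_hol_map
begin

text \<open>The reproducing formula for \<open>jac * q \<circ> f\<close>, rewritten with the dilated
  kernel, involves the Bergman kernel only for second arguments in a compact part of
  \<open>K\<close>, where \<open>F\<close> extends it. The rate \<open>L\<close> is common to all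
  points and components.\<close>

lemma jacobian_power_extension:
  assumes circ: "quasi_circular m G" and connG: "connected G" and m: "\<And>j. m j > 0" and bD: "bounded D"
    and e: "e > 0" "cball 0 (3 * e) \<subseteq> G"
    and U: "open U" and K: "K = {z \<in> D. f z \<in> ball 0 (3 * e)}"
    and F: "holomorphic_fun2_on F (U \<times> (cnj_vec ` K))"
    and FK: "\<And>z w. z \<in> D \<Longrightarrow> w \<in> cnj_vec ` K \<Longrightarrow> F (z, w) = bergman_kernel D z (cnj_vec w)"
  shows "\<exists>E L. (\<forall>j k. holomorphic_fun_on (E j k) U \<and> (\<forall>z\<in>D. E j k z = jac z * (f z $ j) ^ k)) \<and>
     (\<forall>z\<in>U. \<exists>C. \<forall>j k. norm (E j k z) \<le> C * L ^ k)"
proof -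
  define R where "R = (SOME R. \<forall>x\<in>G. norm x \<le> R)"
  have R: "norm x \<le> R" if "x \<in> G" for x
    using someI_ex[of "\<lambda>R. \<forall>x\<in>G. norm x \<le> R"] G(2) that unfolding bounded_iff R_def by blast
  have "(0::complex^'n) \<in> G" using e by auto
  from R[OF this] have R0: "R \<ge> 0" by simp
  \<comment> \<open>Dilation by \<open>s\<close> multiplies norms by at most \<open>s\<close>, which
    brings \<open>G\<close> within distance \<open>e / 2\<close> of the origin; \<open>R + 1\<close>
    avoids division by zero.\<close>
  define s where "s = min 1 (e / (R + 1) / 2)"
  have s: "0 < s" "s \<le> 1" using e R0 by (auto simp: s_def)
  have sG: "wact m (of_real s) w \<in> ball 0 e" if w: "w \<in> G" for w
  proof -
    have "norm (wact m (of_real s) w) \<le> norm (complex_of_real s) * norm w" using s by (intro norm_wact_le m) simp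
    also have "\<dots> \<le> (e / (R + 1) / 2) * (R + 1)" using s R[OF w] R0 by (intro mult_mono) (auto simp: s_def)
    also have "\<dots> = (e / (R + 1) * (R + 1)) / 2" by (simp only: times_divide_eq_left)
    also have "\<dots> = e / 2" using R0 by simp
    also have "\<dots> < e" using e by simp
    finally show ?thesis by simp
  qed
  have e2: "cball 0 (2 * e) \<subseteq> G" using e by (auto simp: subset_eq)
  \<comment> \<open>The two radii separate \<open>C\<close> from \<open>K\<close>: the dilated
    kernel lives over \<open>2 * e\<close>, while \<open>F\<close> is available on the open preimage
    belonging to \<open>3 * e\<close>.\<close>
  define C where "C = {z \<in> D. f z \<in> cball 0 (2 * e)}"
  have C: "compact C" "C \<subseteq> K" "C \<subseteq> D" using proper[OF compact_cball e2] e by (auto simp: C_def K)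
  have oK: "open K"
  proof -
    have "K = D \<inter> f -` ball 0 (3 * e)" by (auto simp: K)
    then show ?thesis using continuous_open_preimage[OF hol_continuous[OF f] D open_ball] by simp
  qed
  define q where "q = (\<lambda>j k (w :: complex^'n). (w $ j) ^ k)"
  have qhol: "holomorphic_fun_on (q j k) S" if "open S" for j k S
    unfolding q_def by (intro hol_power hol_component that)
  have qc: "continuous_on UNIV (q j k)" for j k by (rule hol_continuous[OF qhol[OF open_UNIV]])
  have qhom: "q j k (wact m c w) = c ^ (m j * k) * q j k w" for j k c w
    by (simp add: q_def power_mult_distrib power_mult)
  have qR: "norm (q j k w) \<le> R ^ k" if "w \<in> G" for j k w
    unfolding q_def by (rule norm_component_power_le[OF R[OF that]])
  define \<phi> where "\<phi> = (\<lambda>j k. dilated_kernel m e s (q j k))"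
  \<comment> \<open>The conjugated integrand of the pairing without the Bergman kernel; dividing by
    \<open>s ^ (m j * k)\<close> undoes the dilation, since the \<open>k\<close>-th power of
    coordinate \<open>j\<close> has weight \<open>m j * k\<close>.\<close>
  define \<kappa> where "\<kappa> = (\<lambda>j k \<zeta>. (indicator C \<zeta> *\<^sub>R jac \<zeta>) * cnj (\<phi> j k (fD \<zeta>)) / of_real s ^ (m j * k))"
  define E where "E = (\<lambda>j k z. \<integral>\<zeta>. \<kappa> j k \<zeta> * F (z, cnj_vec \<zeta>) \<partial>lborel)"
  obtain Bb where Bb: "Bb > 0" "\<And>x::complex^'n. bump e x \<le> Bb" using bump_bound[OF e(1)] by blast
  have \<phi>b: "norm (\<phi> j k y) \<le> Bb * measure lborel G * R ^ k" for j k y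
    unfolding \<phi>_def by (rule dilated_kernel_bound[OF e(1) qc Bb(2) qR])
  have "compact (jac ` C)" using C hol_continuous[OF hol_jac] by (intro compact_continuous_image) (auto intro: continuous_on_subset)
  then obtain Bu' where Bu': "\<And>\<zeta>. \<zeta> \<in> C \<Longrightarrow> norm (jac \<zeta>) \<le> Bu'" unfolding compact_eq_bounded_closed bounded_iff by blast
  define Bu where "Bu = max 0 Bu'"
  have Bu: "norm (indicator C \<zeta> *\<^sub>R jac \<zeta>) \<le> Bu" for \<zeta> using Bu'[of \<zeta>] by (cases "\<zeta> \<in> C") (auto simp: Bu_def)
  have Bu0: "Bu \<ge> 0" by (simp add: Bu_def)
  \<comment> \<open>The sum dominates every single weight, which makes \<open>L\<close> independent
    of \<open>j\<close>.\<close>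
  define N where "N = (\<Sum>j\<in>UNIV. m j)"
  define L where "L = R / s ^ N"
  have Lle: "R ^ k / s ^ (m j * k) \<le> L ^ k" for j k
  proof -
    have "m j \<le> N" unfolding N_def by (rule member_le_sum) auto
    then have "s ^ N \<le> s ^ m j" using s by (intro power_decreasing) auto
    then have "R / s ^ m j \<le> L" unfolding L_def using s R0 by (intro divide_left_mono) auto
    then have "(R / s ^ m j) ^ k \<le> L ^ k" using s R0 by (intro power_mono) auto
    then show ?thesis by (simp add: power_divide power_mult)
  qed
  have \<kappa>b: "norm (\<kappa> j k \<zeta>) \<le> (Bu * Bb * measure lborel G) * L ^ k" for j k \<zeta>
  proof -
    have "norm (\<kappa> j k \<zeta>) = norm (indicator C \<zeta> *\<^sub>R jac \<zeta>) * norm (\<phi> j k (fD \<zeta>)) / s ^ (m j * k)"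
      using s by (simp add: \<kappa>_def norm_mult norm_divide norm_power)
    also have "\<dots> \<le> Bu * (Bb * measure lborel G * R ^ k) / s ^ (m j * k)"
      using s Bu0 by (intro divide_right_mono mult_mono Bu \<phi>b) auto
    also have "\<dots> = (Bu * Bb * measure lborel G) * (R ^ k / s ^ (m j * k))" by simp
    also have "\<dots> \<le> (Bu * Bb * measure lborel G) * L ^ k"
      using Bu0 Bb by (intro mult_left_mono Lle) auto
    finally show ?thesis .
  qed
  have \<kappa>m: "\<kappa> j k \<in> borel_measurable borel" for j k
  proof -
    have "(\<lambda>\<zeta>. indicator C \<zeta> *\<^sub>R (indicator D \<zeta> *\<^sub>R jac \<zeta>)) \<in> borel_measurable borel"
      proof (rule borel_measurable_scaleR[OF borel_measurable_indicator])
      show "C \<in> sets borel" using C(1) by (simp add: borel_closed compact_imp_closed)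
    qed (rule indicator_times_measurable[OF D hol_continuous[OF hol_jac]])
    moreover have "(\<lambda>\<zeta>. indicator C \<zeta> *\<^sub>R (indicator D \<zeta> *\<^sub>R jac \<zeta>)) = (\<lambda>\<zeta>. indicator C \<zeta> *\<^sub>R jac \<zeta>)"
      using C(3) by (auto simp: indicator_def fun_eq_iff)
    ultimately have [measurable]: "(\<lambda>\<zeta>. indicator C \<zeta> *\<^sub>R jac \<zeta>) \<in> borel_measurable borel" by simp
    have [measurable]: "\<phi> j k \<in> borel_measurable borel" unfolding \<phi>_def by (rule dilated_kernel_measurable[OF e(1) qc])
    show ?thesis unfolding \<kappa>_def by measurable
  qed
  have \<kappa>0: "\<kappa> j k \<zeta> = 0" if "\<zeta> \<notin> C" for j k \<zeta> using that by (simp add: \<kappa>_def)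
  have Ehol: "holomorphic_fun_on (E j k) U" for j k
    unfolding E_def by (rule kernel_integral_holomorphic[OF U oK F C(1,2) \<kappa>m \<kappa>b \<kappa>0])
  have Ebound: "\<exists>B. \<forall>j k. norm (E j k z) \<le> B * L ^ k" if z: "z \<in> U" for z
  proof -
    obtain B where B: "\<And>k M. k \<in> borel_measurable borel \<Longrightarrow> (\<And>\<zeta>. norm (k \<zeta>) \<le> M) \<Longrightarrow> (\<And>\<zeta>. \<zeta> \<notin> C \<Longrightarrow> k \<zeta> = 0) \<Longrightarrow>
      norm (\<integral>\<zeta>. k \<zeta> * F (z, cnj_vec \<zeta>) \<partial>lborel) \<le> B * M"
      using kernel_integral_bound[OF U oK F C(1,2) z] by blast
    have "norm (E j k z) \<le> (B * (Bu * Bb * measure lborel G)) * L ^ k" for j k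
      using B[OF \<kappa>m \<kappa>b \<kappa>0] by (simp add: E_def mult.assoc)
    then show ?thesis by blast
  qed
  have uD: "(\<lambda>z. indicator D z * jac z) \<in> bergman_space D"
    unfolding bergman_space_iff[OF D]
  proof (intro conjI allI impI)
    show "holomorphic_fun_on (\<lambda>z. indicator D z * jac z) D" by (rule hol_transform[OF D hol_jac]) simp
    have "(\<lambda>z. (norm (indicator D z *\<^sub>R jac z))\<^sup>2) = (\<lambda>z. (norm (indicator D z * jac z))\<^sup>2)"
      by (auto simp: indicator_def fun_eq_iff)
    then show "integrable lborel (\<lambda>z. (norm (indicator D z * jac z))\<^sup>2)"
      using jacobian_det_square_integrable[OF connG] by simp
  qed simp
  have Eval: "E j k z = jac z * (f z $ j) ^ k" if z: "z \<in> D" for j k z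
  proof -
    define b where "b = (\<lambda>\<zeta>. bergman_kernel D \<zeta> z)"
    have b: "b \<in> bergman_space D" unfolding b_def by (rule bergman_kernel_in_space[OF D bD z])
    then have bhol: "holomorphic_fun_on b D" by (simp add: bergman_space_def)
    have intA: "integrable lborel (\<lambda>\<zeta>. indicator D \<zeta> *\<^sub>R (cnj (jac \<zeta>) * b \<zeta>))"
    proof -
      have "integrable lborel (\<lambda>\<zeta>. b \<zeta> * cnj (indicator D \<zeta> * jac \<zeta>))" by (rule bergman_integrable_ip[OF D bD b uD])
      moreover have "(\<lambda>\<zeta>. b \<zeta> * cnj (indicator D \<zeta> * jac \<zeta>)) = (\<lambda>\<zeta>. indicator D \<zeta> *\<^sub>R (cnj (jac \<zeta>) * b \<zeta>))"
        by (auto simp: indicator_def fun_eq_iff)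
      ultimately show ?thesis by simp
    qed
    \<comment> \<open>This lies in the Bergman space because \<open>jac\<close> is square integrable
      and \<open>q j k\<close> is bounded on \<open>G\<close>.\<close>
    define P where "P = (\<lambda>\<zeta>. indicator D \<zeta> * (jac \<zeta> * q j k (f \<zeta>)))"
    have P: "P \<in> bergman_space D"
      unfolding bergman_space_iff[OF D]
    proof (intro conjI allI impI)
      have "holomorphic_fun_on (\<lambda>\<zeta>. jac \<zeta> * q j k (f \<zeta>)) D"
        using f hol_map_components[OF D] by (intro hol_mult D hol_jac hol_compose[OF open_UNIV D qhol[OF open_UNIV]]) auto
      then show "holomorphic_fun_on P D" by (rule hol_transform[OF D]) (simp add: P_def)
      then have Pm: "P \<in> borel_measurable borel"
      proof -
        have "(\<lambda>\<zeta>. indicator D \<zeta> *\<^sub>R P \<zeta>) \<in> borel_measurable borel"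
          by (rule indicator_times_measurable[OF D hol_continuous[OF \<open>holomorphic_fun_on P D\<close>]])
        moreover have "(\<lambda>\<zeta>. indicator D \<zeta> *\<^sub>R P \<zeta>) = P" by (auto simp: P_def indicator_def fun_eq_iff)
        ultimately show ?thesis by simp
      qed
      show "integrable lborel (\<lambda>\<zeta>. (norm (P \<zeta>))\<^sup>2)"
      proof (rule Bochner_Integration.integrable_bound)
        show "integrable lborel (\<lambda>\<zeta>. (R ^ k)\<^sup>2 * (norm (indicator D \<zeta> * jac \<zeta>))\<^sup>2)"
          by (intro integrable_mult_right bergman_integrable_sq[OF D bD uD])
        show "(\<lambda>\<zeta>. (norm (P \<zeta>))\<^sup>2) \<in> borel_measurable lborel"
          unfolding measurable_lborel2
          by (intro borel_measurable_power measurable_compose[OF Pm borel_measurable_norm])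
        have "(norm (P \<zeta>))\<^sup>2 \<le> (R ^ k)\<^sup>2 * (norm (indicator D \<zeta> * jac \<zeta>))\<^sup>2" for \<zeta>
        proof (cases "\<zeta> \<in> D")
          case True
          then have "f \<zeta> \<in> G" using fDG by blast
          then have "norm (jac \<zeta>) * norm (q j k (f \<zeta>)) \<le> norm (jac \<zeta>) * R ^ k" by (intro mult_left_mono qR) auto
          then have "(norm (jac \<zeta>) * norm (q j k (f \<zeta>)))\<^sup>2 \<le> (norm (jac \<zeta>) * R ^ k)\<^sup>2" by (intro power_mono) auto
          then show ?thesis using True by (simp add: P_def norm_mult power_mult_distrib mult.commute)
        qed (simp add: P_def)
        then show "AE \<zeta> in lborel. norm ((norm (P \<zeta>))\<^sup>2) \<le> norm ((R ^ k)\<^sup>2 * (norm (indicator D \<zeta> * jac \<zeta>))\<^sup>2)"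
          by simp
      qed
    qed (simp add: P_def)
    define A where "A = (\<lambda>\<zeta>. indicator D \<zeta> *\<^sub>R (cnj (jac \<zeta>) * b \<zeta>))"
    define sd where "sd = complex_of_real s ^ (m j * k)"
    have sd: "sd \<noteq> 0" "cnj sd = sd" using s by (simp_all add: sd_def)
    have "jac z * (f z $ j) ^ k = P z" using z by (simp add: P_def q_def)
    also have "\<dots> = l2ip P b" unfolding b_def by (rule bergman_kernel_eval[OF D bD z P])
    also have "\<dots> = (\<integral>\<zeta>. cnj (A \<zeta> * cnj (q j k (f \<zeta>))) \<partial>lborel)"
      unfolding l2ip_def
      by (rule Bochner_Integration.integral_cong[OF refl]) (simp add: P_def A_def indicator_def)
    also have "\<dots> = cnj (\<integral>\<zeta>. A \<zeta> * cnj (q j k (f \<zeta>)) \<partial>lborel)" by (rule Bochner_Integration.integral_cnj)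
    also have "(\<integral>\<zeta>. A \<zeta> * cnj (q j k (f \<zeta>)) \<partial>lborel) = (\<integral>\<zeta>. A \<zeta> * \<phi> j k (fD \<zeta>) \<partial>lborel) / sd"
      using pairing_dilated_kernel[OF circ connG m e(1) e2 s sG bhol intA qhol[OF open_UNIV] qhom, of j k] sd
      by (simp add: A_def sd_def \<phi>_def field_simps)
    also have "cnj ((\<integral>\<zeta>. A \<zeta> * \<phi> j k (fD \<zeta>) \<partial>lborel) / sd) = (\<integral>\<zeta>. cnj (A \<zeta> * \<phi> j k (fD \<zeta>)) / sd \<partial>lborel)"
      unfolding integral_divide_zero Bochner_Integration.integral_cnj by (simp add: sd)
    also have "\<dots> = E j k z"
      unfolding E_def
    proof (rule Bochner_Integration.integral_cong[OF refl])
      fix \<zeta>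
      show "cnj (A \<zeta> * \<phi> j k (fD \<zeta>)) / sd = \<kappa> j k \<zeta> * F (z, cnj_vec \<zeta>)"
      proof (cases "\<zeta> \<in> C")
        case True
        then have \<zeta>: "\<zeta> \<in> D" "\<zeta> \<in> K" using C by auto
        have "F (z, cnj_vec \<zeta>) = bergman_kernel D z \<zeta>" using FK[OF z, of "cnj_vec \<zeta>"] \<zeta> by simp
        \<comment> \<open>In the pairing the kernel is holomorphic in \<open>\<zeta>\<close> with
          \<open>z\<close> as parameter; Hermitian symmetry returns it to the form that
          \<open>F\<close> extends in \<open>z\<close>.\<close>
        also have "\<dots> = cnj (b \<zeta>)" unfolding b_def by (rule bergman_kernel_hermitian[OF D bD z \<zeta>(1)])
        finally show ?thesis using True \<zeta> by (simp add: A_def \<kappa>_def sd_def)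
      next
        case False
        have "A \<zeta> * \<phi> j k (fD \<zeta>) = 0"
        proof (cases "\<zeta> \<in> D")
          case True
          then have "2 * e \<le> norm (fD \<zeta>)" using False by (simp add: C_def fD_def)
          then show ?thesis unfolding \<phi>_def using dilated_kernel_zero[OF e(1) sG] by simp
        qed (simp add: A_def)
        then show ?thesis using \<kappa>0[OF False] by simp
      qed
    qed
    finally show ?thesis ..
  qed
  show ?thesis
    by (intro exI[of _ E] exI[of _ L] conjI allI ballI Ehol Eval Ebound)
qed

end

text \<open>The constant \<open>C\<close> is lost in the limit of \<open>k\<close>-th roots: if
  \<open>a\<close> exceeded \<open>b\<close>, the powers of \<open>a / b\<close> would outgrow
  it.\<close>

lemma le_of_power_bounds:
  fixes a b :: real
  assumes "0 \<le> a" "0 < b" and le: "\<And>k. k \<ge> 1 \<Longrightarrow> a ^ k \<le> C * b ^ k"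
  shows "a \<le> b"
proof (rule ccontr)
  assume "\<not> a \<le> b"
  then have "1 < a / b" using assms by simp
  then obtain n where "C < (a / b) ^ n" using real_arch_pow by blast
  also have "\<dots> \<le> (a / b) ^ Suc n" using \<open>1 < a / b\<close> by (intro power_increasing) auto
  also have "\<dots> \<le> C" using le[of "Suc n"] assms(2) unfolding power_divide by (simp add: divide_le_eq)
  finally show False by simp
qed

theorem lemma6:
  fixes m :: "'n::finite \<Rightarrow> nat"
    and D G :: "(complex^'n) set"
    and f :: "complex^'n \<Rightarrow> complex^'n"
  assumes m_pos: "\<And>j. m j > 0"
    and m_coprime: "Gcd (range m) = 1"
    and D: "bounded_domain D"
    and G: "bounded_domain G"
    and G_circular: "quasi_circular m G"
    and G_origin: "0 \<in> G"
    and D_kernel: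
      "\<And>K. open K \<Longrightarrow> compact (closure K) \<Longrightarrow> closure K \<subseteq> D \<Longrightarrow>
        \<exists>U F. open U \<and> closure D \<subseteq> U \<and>
          holomorphic_fun2_on F (U \<times> (cnj_vec ` K)) \<and>
          (\<forall>z\<in>D. \<forall>w\<in>cnj_vec ` K. F (z, w) = bergman_kernel D z (cnj_vec w))"
    and f: "proper_holomorphic D G f"
  shows "\<exists>V F. open V \<and> closure D \<subseteq> V \<and> holomorphic_map_on F V \<and> (\<forall>z\<in>D. F z = f z)"
proof -
  have D': "open D" "connected D" "D \<noteq> {}" "bounded D" using D by (auto simp: bounded_domain_def)
  have G': "open G" "connected G" "bounded G" using G by (auto simp: bounded_domain_def)
  have f': "holomorphic_map_on f D" "f ` D \<subseteq> G" "\<And>C. compact C \<Longrightarrow> C \<subseteq> G \<Longrightarrow> compact {z \<in> D. f z \<in> C}"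
    using f unfolding proper_holomorphic_iff_compact_preimages by auto
  interpret proper_hol_map D G f by unfold_locales (use D' G' f' in auto)
  obtain e' where e': "e' > 0" "cball 0 e' \<subseteq> G" using G_origin G'(1) open_contains_cball by blast
  \<comment> \<open>The extension lemma works with the radii \<open>e\<close>, \<open>2 * e\<close>
    and \<open>3 * e\<close>, the largest of which has to fit into \<open>G\<close>.\<close>
  define e where "e = e' / 3"
  have e: "e > 0" "cball 0 (3 * e) \<subseteq> G" using e' by (auto simp: e_def)
  define K where "K = {z \<in> D. f z \<in> ball 0 (3 * e)}"
  have oK: "open K"
  proof -
    have "K = D \<inter> f -` ball 0 (3 * e)" by (auto simp: K_def)
    then show ?thesis using continuous_open_preimage[OF hol_continuous[OF f'(1)] D'(1) open_ball] by simp
  qed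
  have cpt: "compact {z \<in> D. f z \<in> cball 0 (3 * e)}" by (rule f'(3)[OF compact_cball e(2)])
  have clK: "closure K \<subseteq> {z \<in> D. f z \<in> cball 0 (3 * e)}"
    by (rule closure_minimal[OF _ compact_imp_closed[OF cpt]]) (auto simp: K_def)
  have "compact (closure K)" using compact_closure bounded_subset[OF compact_imp_bounded[OF cpt]] clK closure_subset by blast
  moreover have "closure K \<subseteq> D" using clK by blast
  ultimately obtain U F where U: "open U" "closure D \<subseteq> U" and F: "holomorphic_fun2_on F (U \<times> (cnj_vec ` K))"
    and FK: "\<And>z w. z \<in> D \<Longrightarrow> w \<in> cnj_vec ` K \<Longrightarrow> F (z, w) = bergman_kernel D z (cnj_vec w)"
    using D_kernel[OF oK] by blast
  obtain E L where Ehol: "\<And>j k. holomorphic_fun_on (E j k) U" and ED: "\<And>j k z. z \<in> D \<Longrightarrow> E j k z = jac z * (f z $ j) ^ k"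
    and EL: "\<And>z. z \<in> U \<Longrightarrow> \<exists>C. \<forall>j k. norm (E j k z) \<le> C * L ^ k"
    using jacobian_power_extension[OF G_circular G'(2) m_pos D'(4) e U(1) K_def F FK] by blast
  obtain z0 where z0: "z0 \<in> D" "jac z0 \<noteq> 0"
    using jacobian_det_nonzero[OF D'(1,3) G'(1) f'] unfolding jac_def by blast
  \<comment> \<open>Identities on \<open>D\<close> are continued over a connected set only; this
    component contains the closure of \<open>D\<close>, which is connected.\<close>
  define V where "V = connected_component_set U z0"
  have V: "open V" "connected V" "V \<subseteq> U"
    using U(1) by (simp_all add: V_def open_connected_component connected_component_subset)
  have DV: "closure D \<subseteq> V"
    unfolding V_def using z0 closure_subset U(2) D'(2)
    by (intro connected_component_maximal connected_imp_connected_closure) auto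
  have DV': "D \<subseteq> V" using DV closure_subset by blast
  have EV: "holomorphic_fun_on (E j k) V" for j k by (rule hol_subset[OF Ehol V(3)])
  obtain j0 :: 'n where True by blast
  \<comment> \<open>Exponent 0 gives the extension of \<open>jac\<close> itself, whichever index is
    chosen.\<close>
  define h where "h = E j0 0"
  have hV: "holomorphic_fun_on h V" unfolding h_def by (rule EV)
  have hD: "h z = jac z" if "z \<in> D" for z using ED[OF that, of j0 0] by (simp add: h_def)
  have nz: "\<exists>z\<in>T. h z \<noteq> 0" if T: "open T" "T \<noteq> {}" "T \<subseteq> V" for T
  proof (rule ccontr)
    assume "\<not> (\<exists>z\<in>T. h z \<noteq> 0)"
    then have "h z0 = 0"
      using hol_identity_zero[OF hV V(1,2) T] z0(1) DV' by blast
    then show False using hD z0 by simp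
  qed
  \<comment> \<open>On \<open>D\<close> both sides equal
    \<open>jac z ^ Suc k * (f z $ j) ^ Suc k\<close>; the identity theorem carries the relation to
    points where \<open>f\<close> is not defined yet.\<close>
  have pow: "E j 1 z ^ Suc k = h z ^ k * E j (Suc k) z" if z: "z \<in> V" for j k z
  proof (rule hol_identity[OF _ _ V(1,2) D'(1,3) DV' _ z])
    show "holomorphic_fun_on (\<lambda>z. E j 1 z ^ Suc k) V" by (intro hol_power V EV)
    show "holomorphic_fun_on (\<lambda>z. h z ^ k * E j (Suc k) z) V" by (intro hol_mult hol_power V EV hV)
    show "E j 1 z ^ Suc k = h z ^ k * E j (Suc k) z" if "z \<in> D" for z
      using ED[OF that] hD[OF that] by (simp add: power_mult_distrib mult_ac)
  qed
  \<comment> \<open>Extracting roots calls for a strictly positive rate.\<close>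
  define L' where "L' = \<bar>L\<bar> + 1"
  have le: "norm (E j 1 z) \<le> L' * norm (h z)" if z: "z \<in> V" for j z
  proof (cases "h z = 0")
    case True
    \<comment> \<open>At a zero of \<open>h\<close> the relation for the square already forces the
      numerator to vanish.\<close>
    then have "E j 1 z ^ Suc 1 = 0" using pow[OF z, of j 1] by simp
    then show ?thesis using True by simp
  next
    case False
    obtain C where C: "\<And>j k. norm (E j k z) \<le> C * L ^ k" using EL z V(3) by blast
    have C0: "C \<ge> 0" using order_trans[OF norm_ge_zero C[of j 0]] by simp
    have "norm (E j 1 z) ^ k \<le> (C / norm (h z)) * (L' * norm (h z)) ^ k" if "k \<ge> 1" for k
    proof -
      obtain i where k: "k = Suc i" using \<open>k \<ge> 1\<close> by (cases k) auto
      have "norm (E j 1 z) ^ k = norm (h z) ^ i * norm (E j k z)"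
        using pow[OF z, of j i] unfolding k by (simp only: norm_power[symmetric] norm_mult[symmetric])
      also have "\<dots> \<le> norm (h z) ^ i * (C * L' ^ k)"
      proof (rule mult_left_mono)
        have "L ^ k \<le> \<bar>L\<bar> ^ k" by (metis abs_ge_self power_abs)
        also have "\<dots> \<le> L' ^ k" by (intro power_mono) (auto simp: L'_def)
        finally have "C * L ^ k \<le> C * L' ^ k" using C0 by (intro mult_left_mono)
        then show "norm (E j k z) \<le> C * L' ^ k" using C[of j k] by linarith
      qed simp
      also have "\<dots> = (C / norm (h z)) * (L' * norm (h z)) ^ k"
        using False by (simp add: k power_mult_distrib)
      finally show ?thesis .
    qed
    note pb = this
    have "L' > 0" by (simp add: L'_def)
    then have "0 < L' * norm (h z)" using False by simp
    from le_of_power_bounds[OF norm_ge_zero this pb] show ?thesis .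
  qed
  have "\<forall>j. \<exists>Fj. holomorphic_fun_on Fj V \<and> (\<forall>z\<in>V. E j 1 z = h z * Fj z)"
    by (intro allI hol_quotient_bounded[OF V(1) EV hV le nz])
  then obtain Fj where Fj: "\<And>j. holomorphic_fun_on (Fj j) V" "\<And>j z. z \<in> V \<Longrightarrow> E j 1 z = h z * Fj j z" by metis
  define \<Psi> where "\<Psi> = (\<lambda>z. \<chi> j. Fj j z)"
  have "holomorphic_map_on \<Psi> V" using Fj(1) by (simp add: hol_map_components[OF V(1)] \<Psi>_def)
  moreover have "\<Psi> z = f z" if z: "z \<in> D" for z
  proof -
    \<comment> \<open>Off the zeros of \<open>jac\<close> the factor can be cancelled; the identity
      theorem then gives equality on all of \<open>D\<close>.\<close>
    let ?T = "D \<inter> jac -` (- {0})"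
    have T: "open ?T" "?T \<noteq> {}" "?T \<subseteq> D"
      using continuous_open_preimage[OF hol_continuous[OF hol_jac] D'(1), of "- {0}"] z0 by auto
    have "Fj j z = f z $ j" for j
    proof (rule hol_identity[OF hol_subset[OF Fj(1) DV'] _ D'(1,2) T _ z])
      show "holomorphic_fun_on (\<lambda>z. f z $ j) D" using f'(1) hol_map_components[OF D'(1)] by blast
      fix x assume x: "x \<in> ?T"
      then have "jac x * Fj j x = jac x * f x $ j" using Fj(2)[of x j] ED[of x j 1] hD[of x] DV' by auto
      then show "Fj j x = f x $ j" using x by simp
    qed
    then show ?thesis by (simp add: \<Psi>_def vec_eq_iff)
  qed
  ultimately show ?thesis using V(1) DV by blast
qed

end
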